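(* Let $d \in \mathbb{N}$ and let $A \subset \mathbb{N}$ be a subset that is recursively enumerable but not recursive. Set $\alpha := \sum_{n \in A} 2^{-n}$. Then $\alpha$ is transcendental over $\mathbb{Q}$. Moreover, there is no oriented closed connected $d$-manifold $M$ with $\|M\| \in \mathbb{R}^c_{>0} \cdot \alpha$, where $\mathbb{R}^c_{>0}$ denotes the set of positive computable real numbers.
   Context: The simplicial volume $\|M\|$ of an oriented closed connected $d$-manifold $M$ is the $\ell^1$-semi-norm of the real fundamental class. That is, it is the infimum of $\sum_i|a_i|$ over all singular real cycles $\sum_i a_i\sigma_i$ representing $[M]_\mathbb{R}$. A real number $\beta$ is right-computable if $\{x\in\mathbb{Q} \mid \beta<x\}$ is recursively enumerable. It is computable if both $\{x\in\mathbb{Q}\mid \beta<x\}$ and $\{x\in\mathbb{Q}\mid\beta>x\}$ are recursively enumerable. We write $\mathbb{R}^c_{>0}\cdot\alpha = \{c\alpha \mid c \in \mathbb{R}^c_{>0}\}$. *)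

theory Defs
  imports "HOL-Analysis.Analysis" "HOL-Homology.Homology" "HOL-Computational_Algebra.Polynomial" "HOL-Library.Nat_Bijection"
begin

datatype recf = Zr | Sc | Proj nat | Comp recf "recf list" | Prec recf recf | Mn recf

inductive reval :: "recf \<Rightarrow> nat list \<Rightarrow> nat \<Rightarrow> bool" where
  zero: "reval Zr xs 0"
| succ: "reval Sc (x # xs) (Suc x)"
| proj: "i < length xs \<Longrightarrow> reval (Proj i) xs (xs ! i)"
| comp: "list_all2 (\<lambda>g y. reval g xs y) gs ys \<Longrightarrow> reval f ys z \<Longrightarrow> reval (Comp f gs) xs z"
| prec0: "reval f xs y \<Longrightarrow> reval (Prec f g) (0 # xs) y"
| precS: "reval (Prec f g) (n # xs) y \<Longrightarrow> reval g (n # y # xs) z \<Longrightarrow> reval (Prec f g) (Suc n # xs) z"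
| mn: "reval f (n # xs) 0 \<Longrightarrow> (\<forall>m<n. \<exists>y. reval f (m # xs) (Suc y)) \<Longrightarrow> reval (Mn f) xs n"

definition re_set :: "nat set \<Rightarrow> bool" where
  "re_set A \<longleftrightarrow> (\<exists>f. \<forall>n. n \<in> A \<longleftrightarrow> (\<exists>y. reval f [n] y))"

definition recursive_set :: "nat set \<Rightarrow> bool" where
  "recursive_set A \<longleftrightarrow> (\<exists>f. \<forall>n y. reval f [n] y \<longleftrightarrow> y = (if n \<in> A then 1 else 0))"

definition rat_code :: "rat \<Rightarrow> nat" where
  "rat_code q = prod_encode (int_encode (fst (quotient_of q)), nat (snd (quotient_of q)))"

definition re_rat_set :: "rat set \<Rightarrow> bool" where
  "re_rat_set S \<longleftrightarrow> re_set (rat_code ` S)"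

definition right_computable :: "real \<Rightarrow> bool" where
  "right_computable \<beta> \<longleftrightarrow> re_rat_set {x. \<beta> < of_rat x}"

definition computable_real :: "real \<Rightarrow> bool" where
  "computable_real \<beta> \<longleftrightarrow> re_rat_set {x. \<beta> < of_rat x} \<and> re_rat_set {x. \<beta> > of_rat x}"

definition closed_connected_manifold :: "nat \<Rightarrow> 'a topology \<Rightarrow> bool" where
  "closed_connected_manifold d M \<longleftrightarrow>
     Hausdorff_space M \<and> second_countable M \<and> compact_space M \<and> connected_space M \<and>
     topspace M \<noteq> {} \<and>
     (\<forall>x\<in>topspace M. \<exists>U. openin M U \<and> x \<in> U \<and>
         subtopology M U homeomorphic_space Euclidean_space d)"

text \<open>An (integral) fundamental class: a class in H_d(M;Z) whose image in
  H_d(M, M - {x}; Z) is a generator for every x. An oriented closed connected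
  manifold is such a manifold together with a fundamental class.\<close>
definition fundamental_class :: "nat \<Rightarrow> 'a topology \<Rightarrow> 'a chain set \<Rightarrow> bool" where
  "fundamental_class d M \<mu> \<longleftrightarrow>
     \<mu> \<in> carrier (homology_group (int d) M) \<and>
     (\<forall>x\<in>topspace M.
        generate (relative_homology_group (int d) M (topspace M - {x}))
          {hom_induced (int d) M {} M (topspace M - {x}) id \<mu>}
        = carrier (relative_homology_group (int d) M (topspace M - {x})))"

type_synonym 'a rchain = "((nat \<Rightarrow> real) \<Rightarrow> 'a) \<Rightarrow> real"

definition rsupp :: "'a rchain \<Rightarrow> ((nat \<Rightarrow> real) \<Rightarrow> 'a) set" where
  "rsupp c = {\<sigma>. c \<sigma> \<noteq> 0}"

definition real_chain :: "nat \<Rightarrow> 'a topology \<Rightarrow> 'a rchain \<Rightarrow> bool" where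
  "real_chain p X c \<longleftrightarrow> finite (rsupp c) \<and> (\<forall>\<sigma>\<in>rsupp c. singular_simplex p X \<sigma>)"

definition real_boundary_op :: "nat \<Rightarrow> 'a rchain \<Rightarrow> 'a rchain" where
  "real_boundary_op p c = (\<lambda>\<tau>. if p = 0 then 0 else
     (\<Sum>\<sigma>\<in>rsupp c. \<Sum>k\<le>p. if singular_face p k \<sigma> = \<tau> then (-1) ^ k * c \<sigma> else 0))"

definition real_cycle :: "nat \<Rightarrow> 'a topology \<Rightarrow> 'a rchain \<Rightarrow> bool" where
  "real_cycle p X c \<longleftrightarrow> real_chain p X c \<and> real_boundary_op p c = (\<lambda>_. 0)"

definition real_boundary :: "nat \<Rightarrow> 'a topology \<Rightarrow> 'a rchain \<Rightarrow> bool" where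
  "real_boundary p X c \<longleftrightarrow> (\<exists>b. real_chain (Suc p) X b \<and> real_boundary_op (Suc p) b = c)"

definition real_of_chain :: "'a chain \<Rightarrow> 'a rchain" where
  "real_of_chain z = (\<lambda>\<sigma>. of_int (poly_mapping.lookup z \<sigma>))"

definition l1_norm :: "'a rchain \<Rightarrow> real" where
  "l1_norm c = (\<Sum>\<sigma>\<in>rsupp c. \<bar>c \<sigma>\<bar>)"

text \<open>Simplicial volume of M with respect to the (integral) fundamental class mu:
  infimum of l1 norms of real cycles representing the real fundamental class,
  i.e. real cycles homologous (over R) to an integral cycle in the class mu.\<close>
definition simplicial_volume :: "nat \<Rightarrow> 'a topology \<Rightarrow> 'a chain set \<Rightarrow> real" where
  "simplicial_volume d M \<mu> =
     Inf {l1_norm c | c. real_cycle d M c \<and>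
            (\<exists>z\<in>\<mu>. real_boundary d M (\<lambda>\<sigma>. c \<sigma> - real_of_chain z \<sigma>))}"

end

theory Submission
  imports Defs
begin

text \<open>
  The real \<open>\<alpha>\<close> is the limit of a computable increasing sequence, and good upper bounds for \<open>\<alpha>\<close>
  certify that a number is not in \<open>A\<close>; hence the set of rationals above \<open>\<alpha>\<close> is not recursively
  enumerable. For an algebraic number this set is decidable, so \<open>\<alpha>\<close> is transcendental. If
  \<open>c * \<alpha>\<close> were a simplicial volume with \<open>c > 0\<close> computable, the set would be enumerable,
  because simplicial volumes are right-computable.

  To see the latter, write \<open>\<parallel>M\<parallel>\<close> as the infimum of \<open>|q z + \<partial>b| / q\<close> over integral chains \<open>b\<close>
  and \<open>q > 0\<close>, for a fixed fundamental cycle \<open>z\<close>. A closed manifold is a retract of an open set in a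
  normed space, hence a homotopy retract of a finite flag complex, to which \<open>z\<close> can be moved
  without changing the infimum. Singular simplices of the complex are then replaced by finite
  tables of vertices, sampled at lattice points of the simplex, and conversely tables are
  realized by piecewise affine singular simplices. Sampling and realization are compatible with
  faces, do not increase \<open>\<ell>\<^sup>1\<close>-norms, and their composition is homologous to the identity on
  cycles, so that \<open>\<parallel>M\<parallel> < x\<close> becomes an existential statement about finite tables.
\<close>

subsection \<open>Recursive functions and recursively enumerable predicates\<close>

text \<open>The obstacle is the l1-norm. Subdivision would replace one simplex by many, and the norm
  would grow. Each singular simplex therefore has to become exactly one combinatorial object,
  determined by that simplex alone, so that equal simplices stay equal and their coefficients still
  cancel. Compatibility with faces makes the replacement commute with boundaries. Flag complexes are
  used because membership is a condition on pairs of vertices: whether a table has a realization in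
  the complex is then a finite check on pairs of lattice points. The enumeration is not uniform in
  M. The complex, one cycle and a few bounds are finite data coded into fixed numbers, and their
  mere existence suffices. The cycle is first replaced by one built from realized tables, because
  those can be resampled at every finer level by integer arithmetic, which arbitrary continuous
  simplices do not offer.\<close>

inductive_cases reval_ZrE: "reval Zr xs y"
inductive_cases reval_ScE: "reval Sc xs y"
inductive_cases reval_ProjE: "reval (Proj i) xs y"
inductive_cases reval_CompE: "reval (Comp f gs) xs y"
inductive_cases reval_PrecE: "reval (Prec f g) xs y"
inductive_cases reval_Prec0E: "reval (Prec f g) (0 # xs) y"
inductive_cases reval_PrecSE: "reval (Prec f g) (Suc n # xs) y"
inductive_cases reval_MnE: "reval (Mn f) xs y"

lemma reval_Zr_iff: "reval Zr xs y \<longleftrightarrow> y = 0"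
  by (auto elim: reval_ZrE intro: reval.intros)

lemma reval_Sc_iff: "reval Sc xs y \<longleftrightarrow> xs \<noteq> [] \<and> y = Suc (hd xs)"
  by (cases xs) (auto elim: reval_ScE intro: reval.intros)

lemma reval_Proj_iff: "reval (Proj i) xs y \<longleftrightarrow> i < length xs \<and> y = xs ! i"
  by (auto elim: reval_ProjE intro: reval.intros)

lemma reval_Comp_iff:
  "reval (Comp f gs) xs z \<longleftrightarrow> (\<exists>ys. list_all2 (\<lambda>g y. reval g xs y) gs ys \<and> reval f ys z)"
  by (auto elim: reval_CompE intro: reval.intros)

lemma reval_Prec_0_iff: "reval (Prec f g) (0 # xs) y \<longleftrightarrow> reval f xs y"
  by (auto elim: reval_Prec0E intro: reval.intros)

lemma reval_Prec_Suc_iff: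
  "reval (Prec f g) (Suc n # xs) z \<longleftrightarrow> (\<exists>y. reval (Prec f g) (n # xs) y \<and> reval g (n # y # xs) z)"
  by (auto elim: reval_PrecSE intro: reval.intros)

lemma reval_Prec_Nil: "\<not> reval (Prec f g) [] y"
  by (auto elim: reval_PrecE)

lemma reval_Mn_iff:
  "reval (Mn f) xs n \<longleftrightarrow> reval f (n # xs) 0 \<and> (\<forall>m<n. \<exists>y. reval f (m # xs) (Suc y))"
  by (auto elim: reval_MnE intro: reval.intros)

text \<open>The equivalence contains uniqueness of the output. Determinism of \<open>reval\<close>
  is thus established together with each function that is built, not for arbitrary programs.\<close>

definition implements :: "recf \<Rightarrow> nat \<Rightarrow> (nat list \<Rightarrow> nat) \<Rightarrow> bool" where
  "implements r k f \<longleftrightarrow> (\<forall>xs. length xs = k \<longrightarrow> (\<forall>y. reval r xs y \<longleftrightarrow> y = f xs))"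

definition recursive_fun :: "nat \<Rightarrow> (nat list \<Rightarrow> nat) \<Rightarrow> bool" where
  "recursive_fun k f \<longleftrightarrow> (\<exists>r. implements r k f)"

lemma recursive_fun_cong:
  assumes "recursive_fun k f" "\<And>xs. length xs = k \<Longrightarrow> f xs = g xs"
  shows "recursive_fun k g"
  using assms by (auto simp: recursive_fun_def implements_def)

lemma recursive_fun_Sc: "recursive_fun 1 (\<lambda>xs. Suc (xs ! 0))"
  unfolding recursive_fun_def implements_def
  by (rule exI[of _ Sc]) (auto simp: reval_Sc_iff length_Suc_conv)

lemma recursive_fun_Zr: "recursive_fun k (\<lambda>xs. 0)"
  unfolding recursive_fun_def implements_def
  by (rule exI[of _ Zr]) (auto simp: reval_Zr_iff)

lemma recursive_fun_Proj: "i < k \<Longrightarrow> recursive_fun k (\<lambda>xs. xs ! i)"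
  unfolding recursive_fun_def implements_def
  by (rule exI[of _ "Proj i"]) (auto simp: reval_Proj_iff)

lemma recursive_fun_Comp:
  assumes f: "recursive_fun (length Gs) F" and g: "\<And>G. G \<in> set Gs \<Longrightarrow> recursive_fun k G"
  shows "recursive_fun k (\<lambda>xs. F (map (\<lambda>G. G xs) Gs))"
proof -
  obtain rf where rf: "implements rf (length Gs) F" using f by (auto simp: recursive_fun_def)
  have "\<forall>G\<in>set Gs. \<exists>r. implements r k G" using g by (auto simp: recursive_fun_def)
  then obtain c where c: "\<And>G. G \<in> set Gs \<Longrightarrow> implements (c G) k G" by metis
  have *: "list_all2 (\<lambda>g y. reval g xs y) (map c Gs) ys \<longleftrightarrow> ys = map (\<lambda>G. G xs) Gs"
    if "length xs = k" for xs ys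
    using c that unfolding implements_def list_all2_conv_all_nth
    by (auto simp: list_eq_iff_nth_eq)
  show ?thesis
    unfolding recursive_fun_def
    by (rule exI[of _ "Comp rf (map c Gs)"])
       (use rf in \<open>auto simp: implements_def reval_Comp_iff *\<close>)
qed

lemma recursive_fun_Comp1:
  "recursive_fun 1 F \<Longrightarrow> recursive_fun k G \<Longrightarrow> recursive_fun k (\<lambda>xs. F [G xs])"
  using recursive_fun_Comp[of "[G]" F k] by simp

lemma recursive_fun_Comp2:
  "recursive_fun 2 F \<Longrightarrow> recursive_fun k G \<Longrightarrow> recursive_fun k H \<Longrightarrow> recursive_fun k (\<lambda>xs. F [G xs, H xs])"
  using recursive_fun_Comp[of "[G, H]" F k] by (auto simp: numeral_2_eq_2)

lemma recursive_fun_Prec: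
  assumes "recursive_fun k F" "recursive_fun (Suc (Suc k)) G"
  shows "recursive_fun (Suc k) (\<lambda>xs. rec_nat (F (tl xs)) (\<lambda>n y. G (n # y # tl xs)) (hd xs))"
proof -
  obtain f g where f: "implements f k F" and g: "implements g (Suc (Suc k)) G"
    using assms by (auto simp: recursive_fun_def)
  have "reval (Prec f g) (n # xs) y \<longleftrightarrow> y = rec_nat (F xs) (\<lambda>n y. G (n # y # xs)) n"
    if "length xs = k" for n xs y
    using f g that
    by (induction n arbitrary: y) (auto simp: implements_def reval_Prec_0_iff reval_Prec_Suc_iff)
  then show ?thesis
    unfolding recursive_fun_def
    by (intro exI[of _ "Prec f g"]) (auto simp: implements_def length_Suc_conv)
qed

lemma recursive_fun_Mn:
  assumes "recursive_fun (Suc k) F" "\<And>xs. length xs = k \<Longrightarrow> \<exists>n. F (n # xs) = 0"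
  shows "recursive_fun k (\<lambda>xs. LEAST n. F (n # xs) = 0)"
proof -
  obtain f where f: "implements f (Suc k) F" using assms by (auto simp: recursive_fun_def)
  have "reval (Mn f) xs n \<longleftrightarrow> n = (LEAST n. F (n # xs) = 0)" if "length xs = k" for xs n
  proof -
    have *: "reval (Mn f) xs n \<longleftrightarrow> F (n # xs) = 0 \<and> (\<forall>m<n. F (m # xs) \<noteq> 0)"
    proof -
      have r: "reval f (m # xs) y \<longleftrightarrow> y = F (m # xs)" for m y
        using f that by (simp add: implements_def)
      show ?thesis
        unfolding reval_Mn_iff r by (metis Suc_not_Zero not0_implies_Suc)
    qed
    show ?thesis
    proof
      assume "reval (Mn f) xs n"
      then show "n = (LEAST n. F (n # xs) = 0)"
        unfolding * by (intro Least_equality[symmetric]) (use not_less in blast)+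
    next
      assume "n = (LEAST n. F (n # xs) = 0)"
      then show "reval (Mn f) xs n"
        unfolding * using assms(2)[OF that] by (metis (mono_tags, lifting) LeastI not_less_Least)
    qed
  qed
  then show ?thesis
    unfolding recursive_fun_def implements_def by blast
qed

lemma recursive_fun_add: "recursive_fun 2 (\<lambda>xs. xs ! 0 + xs ! 1)"
proof -
  have "recursive_fun (Suc (Suc 1)) (\<lambda>xs. Suc (xs ! 1))"
    using recursive_fun_Comp1[OF recursive_fun_Sc recursive_fun_Proj[of 1 3]]
    by (auto simp: numeral_3_eq_3 numeral_2_eq_2)
  from recursive_fun_Prec[OF recursive_fun_Proj[of 0 1] this]
  have "recursive_fun 2 (\<lambda>xs. rec_nat (tl xs ! 0) (\<lambda>n y. Suc y) (hd xs))"
    by (simp add: numeral_2_eq_2)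
  moreover have "rec_nat b (\<lambda>n y. Suc y) a = a + b" for a b :: nat
    by (induction a) auto
  ultimately show ?thesis
    by (elim recursive_fun_cong) (auto simp: length_Suc_conv numeral_2_eq_2)
qed

lemma recursive_fun_mult: "recursive_fun 2 (\<lambda>xs. xs ! 0 * xs ! 1)"
proof -
  have "recursive_fun (Suc (Suc 1)) (\<lambda>xs. xs ! 1 + xs ! 2)"
    using recursive_fun_Comp2[OF recursive_fun_add recursive_fun_Proj[of 1 3] recursive_fun_Proj[of 2 3]]
    by (auto simp: numeral_3_eq_3 numeral_2_eq_2)
  from recursive_fun_Prec[OF recursive_fun_Zr this]
  have "recursive_fun 2 (\<lambda>xs. rec_nat 0 (\<lambda>n y. y + tl xs ! 0) (hd xs))" 
    by (simp add: numeral_2_eq_2)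
  moreover have "rec_nat 0 (\<lambda>n y. y + b) a = a * b" for a b :: nat
    by (induction a) auto
  ultimately show ?thesis
    by (elim recursive_fun_cong) (auto simp: length_Suc_conv numeral_2_eq_2)
qed

lemma recursive_fun_pred: "recursive_fun 1 (\<lambda>xs. xs ! 0 - 1)"
proof -
  have "recursive_fun (Suc 0) (\<lambda>xs. rec_nat 0 (\<lambda>n y. n) (hd xs))"
    using recursive_fun_Prec[OF recursive_fun_Zr recursive_fun_Proj[of 0 "Suc (Suc 0)"]] by simp
  moreover have "rec_nat 0 (\<lambda>n y. n) a = a - 1" for a :: nat
    by (cases a) auto
  ultimately show ?thesis
    unfolding One_nat_def by (elim recursive_fun_cong) (auto simp: length_Suc_conv)
qed

lemma recursive_fun_diff: "recursive_fun 2 (\<lambda>xs. xs ! 0 - xs ! 1)"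
proof -
  have "recursive_fun (Suc (Suc 1)) (\<lambda>xs. xs ! 1 - 1)"
    using recursive_fun_Comp1[OF recursive_fun_pred recursive_fun_Proj[of 1 3]]
    by (auto simp: numeral_3_eq_3 numeral_2_eq_2)
  from recursive_fun_Prec[OF recursive_fun_Proj[of 0 1] this]
  have "recursive_fun 2 (\<lambda>xs. rec_nat (tl xs ! 0) (\<lambda>n y. y - 1) (hd xs))" 
    by (simp add: numeral_2_eq_2)
  moreover have "rec_nat b (\<lambda>n y. y - 1) a = b - a" for a b :: nat
    by (induction a) auto
  \<comment> \<open>Recursion runs on the first argument, so iterated predecessors yield the
    difference with its arguments exchanged; projections swap them back.\<close>
  ultimately have "recursive_fun 2 (\<lambda>xs. xs ! 1 - xs ! 0)"
    by (elim recursive_fun_cong) (auto simp: length_Suc_conv numeral_2_eq_2)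
  from recursive_fun_Comp2[OF this recursive_fun_Proj[of 1 2] recursive_fun_Proj[of 0 2]]
  show ?thesis by simp
qed

lemma recursive_fun_triangle: "recursive_fun 1 (\<lambda>xs. triangle (xs ! 0))"
proof -
  have "recursive_fun (Suc (Suc 0)) (\<lambda>xs. xs ! 1 + Suc (xs ! 0))"
    using recursive_fun_Comp2[OF recursive_fun_add recursive_fun_Proj[of 1 2] recursive_fun_Comp1[OF recursive_fun_Sc recursive_fun_Proj[of 0 2]]]
    by (auto simp: numeral_2_eq_2)
  from recursive_fun_Prec[OF recursive_fun_Zr this]
  have "recursive_fun 1 (\<lambda>xs. rec_nat 0 (\<lambda>n y. y + Suc n) (hd xs))" by simp
  moreover have "rec_nat 0 (\<lambda>n y. y + Suc n) a = triangle a" for a :: nat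
    by (induction a) auto
  ultimately show ?thesis
    by (elim recursive_fun_cong) (auto simp: length_Suc_conv)
qed

section \<open>Computable functions and decidable predicates of one number\<close>

definition computable_fun :: "(nat \<Rightarrow> nat) \<Rightarrow> bool" where
  "computable_fun f \<longleftrightarrow> recursive_fun 1 (\<lambda>xs. f (xs ! 0))"

lemma computable_id: "computable_fun (\<lambda>x. x)"
  unfolding computable_fun_def by (rule recursive_fun_Proj) simp

lemma computable_comp:
  assumes "computable_fun f" "computable_fun g" shows "computable_fun (\<lambda>x. f (g x))"
  using recursive_fun_Comp1[OF assms[unfolded computable_fun_def]]
  by (simp add: computable_fun_def)

lemma computable_Suc: "computable_fun f \<Longrightarrow> computable_fun (\<lambda>x. Suc (f x))"
  using recursive_fun_Comp1[OF recursive_fun_Sc] by (fastforce simp: computable_fun_def)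

lemma computable_const: "computable_fun (\<lambda>x. c)"
proof (induction c)
  case 0
  show ?case by (simp add: computable_fun_def recursive_fun_Zr)
next
  case (Suc c)
  then show ?case by (rule computable_Suc)
qed

lemma computable_binary:
  assumes "recursive_fun 2 (\<lambda>xs. h (xs ! 0) (xs ! 1))" "computable_fun f" "computable_fun g"
  shows "computable_fun (\<lambda>x. h (f x) (g x))"
  using recursive_fun_Comp2[OF assms[unfolded computable_fun_def]]
  by (simp add: computable_fun_def)

lemmas computable_add = computable_binary[OF recursive_fun_add]
lemmas computable_mult = computable_binary[OF recursive_fun_mult]
lemmas computable_diff = computable_binary[OF recursive_fun_diff]

lemma computable_triangle: "computable_fun f \<Longrightarrow> computable_fun (\<lambda>x. triangle (f x))"
  using recursive_fun_Comp1[OF recursive_fun_triangle] by (fastforce simp: computable_fun_def)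

abbreviation pair :: "nat \<Rightarrow> nat \<Rightarrow> nat" where "pair a b \<equiv> prod_encode (a, b)"

definition p1 :: "nat \<Rightarrow> nat" where "p1 z = fst (prod_decode z)"
definition p2 :: "nat \<Rightarrow> nat" where "p2 z = snd (prod_decode z)"

lemma p1_pair [simp]: "p1 (pair a b) = a" and p2_pair [simp]: "p2 (pair a b) = b"
  by (simp_all add: p1_def p2_def)

lemma pair_p [simp]: "pair (p1 z) (p2 z) = z"
  by (simp add: p1_def p2_def)

lemma computable_pair:
  "computable_fun f \<Longrightarrow> computable_fun g \<Longrightarrow> computable_fun (\<lambda>x. pair (f x) (g x))"
  unfolding prod_encode_def prod.case by (intro computable_add computable_triangle)

lemma triangle_mono: "a \<le> b \<Longrightarrow> triangle a \<le> triangle b"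
  by (induction b) (auto simp: le_Suc_eq)

text \<open>On the diagonal of index \<open>s\<close> the Cantor code runs from
  \<open>triangle s\<close> up to, but excluding, \<open>triangle (Suc s)\<close>. So the diagonal
  of \<open>z\<close> is the first \<open>s\<close> with \<open>z < triangle (Suc s)\<close>, and
  truncated subtraction states this as a zero to be found by minimization.\<close>

lemma p_sum: "p1 z + p2 z = (LEAST s. Suc z - triangle (Suc s) = 0)"
proof -
  have z: "z = triangle (p1 z + p2 z) + p1 z"
    using pair_p[of z] unfolding prod_encode_def by simp
  show ?thesis
  proof (rule Least_equality[symmetric])
    show "Suc z - triangle (Suc (p1 z + p2 z)) = 0"
      using z by (simp del: One_nat_def)
    fix s assume "Suc z - triangle (Suc s) = 0"
    then have "z < triangle (Suc s)" by simp
    then have "triangle (p1 z + p2 z) < triangle (Suc s)" using z by linarith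
    then have "p1 z + p2 z < Suc s" using triangle_mono[of "Suc s" "p1 z + p2 z"] by linarith
    then show "p1 z + p2 z \<le> s" by simp
  qed
qed

lemma computable_p_sum: "computable_fun (\<lambda>z. p1 z + p2 z)"
proof -
  have "recursive_fun (Suc 1) (\<lambda>xs. Suc (xs ! 1) - triangle (Suc (xs ! 0)))"
    using recursive_fun_Comp2[OF recursive_fun_diff
        recursive_fun_Comp1[OF recursive_fun_Sc recursive_fun_Proj[of 1 2]]
        recursive_fun_Comp1[OF recursive_fun_triangle recursive_fun_Comp1[OF recursive_fun_Sc recursive_fun_Proj[of 0 2]]]]
    by (simp add: numeral_2_eq_2)
  then have "recursive_fun 1 (\<lambda>xs. LEAST n. Suc ((n # xs) ! 1) - triangle (Suc ((n # xs) ! 0)) = 0)"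
  proof (rule recursive_fun_Mn)
    fix xs :: "nat list"
    have "Suc (xs ! 0) - triangle (Suc (Suc (xs ! 0))) = 0" by simp
    then show "\<exists>n. Suc ((n # xs) ! 1) - triangle (Suc ((n # xs) ! 0)) = 0"
      by (intro exI[of _ "Suc (xs ! 0)"]) simp
  qed
  then show ?thesis
    unfolding computable_fun_def p_sum by simp
qed

lemma computable_p1:
  assumes "computable_fun f" shows "computable_fun (\<lambda>x. p1 (f x))"
proof -
  have "z = triangle (p1 z + p2 z) + p1 z" for z
    using pair_p[of z] unfolding prod_encode_def by simp
  then have "p1 z = z - triangle (p1 z + p2 z)" for z
    by (metis add_diff_cancel_left')
  moreover have "computable_fun (\<lambda>z. z - triangle (p1 z + p2 z))"
    by (intro computable_diff computable_id computable_triangle computable_p_sum)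
  ultimately have "computable_fun (\<lambda>z. p1 z)" by presburger
  then show ?thesis using assms by (rule computable_comp)
qed

lemma computable_p2:
  assumes "computable_fun f" shows "computable_fun (\<lambda>x. p2 (f x))"
proof -
  have "computable_fun (\<lambda>z. (p1 z + p2 z) - p1 z)"
    by (intro computable_diff computable_p_sum computable_p1 computable_id)
  then show ?thesis using computable_comp[of p2 f, OF _ assms] by simp
qed

text \<open>The step function receives the parameter, the index and the accumulated value packed in
  this order into one number.\<close>

lemma computable_rec_nat:
  assumes a: "computable_fun a" and b: "computable_fun b"
    and g: "computable_fun (\<lambda>z. g (p1 z) (p1 (p2 z)) (p2 (p2 z)))"
  shows "computable_fun (\<lambda>n. rec_nat (a n) (\<lambda>i y. g n i y) (b n))"
proof -
  let ?g = "\<lambda>z. g (p1 z) (p1 (p2 z)) (p2 (p2 z))"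
  have pr: "recursive_fun 2 (\<lambda>xs. pair (xs ! 0) (xs ! 1))"
    using recursive_fun_Comp2[OF recursive_fun_add 
        recursive_fun_Comp1[OF recursive_fun_triangle recursive_fun_add] recursive_fun_Proj[of 0 2]]
    by (simp add: prod_encode_def)
  have "recursive_fun (Suc (Suc 1)) (\<lambda>xs. ?g (pair (xs ! 2) (pair (xs ! 0) (xs ! 1))))"
    using recursive_fun_Comp1[OF g[unfolded computable_fun_def] recursive_fun_Comp2[OF pr recursive_fun_Proj[of 2 3]
        recursive_fun_Comp2[OF pr recursive_fun_Proj[of 0 3] recursive_fun_Proj[of 1 3]]]]
    by (simp add: numeral_3_eq_3 numeral_2_eq_2)
  from recursive_fun_Prec[OF a[unfolded computable_fun_def] this]
  have "recursive_fun 2 (\<lambda>xs. rec_nat (a (tl xs ! 0)) (\<lambda>i y. g (tl xs ! 0) i y) (hd xs))"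
    by (simp add: numeral_2_eq_2)
  then have 1: "recursive_fun 2 (\<lambda>xs. rec_nat (a (xs ! 1)) (\<lambda>i y. g (xs ! 1) i y) (xs ! 0))"
    by (elim recursive_fun_cong) (auto simp: length_Suc_conv numeral_2_eq_2)
  show ?thesis
    using computable_binary[OF 1 b computable_id] .
qed

lemma computable_Least:
  assumes "computable_fun (\<lambda>z. g (p1 z) (p2 z))" "\<And>n. \<exists>t. g n t = 0"
  shows "computable_fun (\<lambda>n. LEAST t. g n t = 0)"
proof -
  have pr: "recursive_fun 2 (\<lambda>xs. pair (xs ! 1) (xs ! 0))"
    using recursive_fun_Comp2[OF recursive_fun_add 
        recursive_fun_Comp1[OF recursive_fun_triangle recursive_fun_add] recursive_fun_Proj[of 1 2]]
    by (simp add: prod_encode_def add.commute)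
  have "recursive_fun (Suc 1) (\<lambda>xs. g (xs ! 1) (xs ! 0))"
    using recursive_fun_Comp1[OF assms(1)[unfolded computable_fun_def] pr] by (simp add: numeral_2_eq_2)
  from recursive_fun_Mn[OF this] assms(2) show ?thesis
    by (simp add: computable_fun_def)
qed

definition decidable :: "(nat \<Rightarrow> bool) \<Rightarrow> bool" where
  "decidable P \<longleftrightarrow> computable_fun (\<lambda>n. if P n then 1 else 0)"

lemma computable_if:
  assumes "decidable P" "computable_fun f" "computable_fun g"
  shows "computable_fun (\<lambda>n. if P n then f n else g n)"
proof -
  have "computable_fun (\<lambda>n. (if P n then 1 else 0) * f n + (1 - (if P n then 1 else 0)) * g n)"
    by (intro computable_add computable_mult computable_diff computable_const assms assms(1)[unfolded decidable_def])
  moreover have "(\<lambda>n. (if P n then 1 else 0) * f n + (1 - (if P n then 1 else 0)) * g n) = (\<lambda>n. if P n then f n else g n)"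
    by auto
  ultimately show ?thesis by simp
qed

lemma decidable_0: "computable_fun f \<Longrightarrow> decidable (\<lambda>n. f n = 0)"
proof -
  assume "computable_fun f"
  then have "computable_fun (\<lambda>n. 1 - f n)" by (intro computable_diff computable_const)
  moreover have "(\<lambda>n. 1 - f n) = (\<lambda>n. if f n = 0 then 1 else 0)" by auto
  ultimately show ?thesis by (simp add: decidable_def)
qed

lemma decidable_const: "decidable (\<lambda>n. b)"
  by (simp add: decidable_def computable_const)

lemma decidable_not:
  assumes "decidable P" shows "decidable (\<lambda>n. \<not> P n)"
proof -
  have "decidable (\<lambda>n. (if P n then 1 else 0) = (0::nat))"
    using assms unfolding decidable_def[of P] by (rule decidable_0)
  moreover have "((if P n then 1 else 0) = (0::nat)) = (\<not> P n)" for n by simp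
  ultimately show ?thesis by simp
qed

lemma decidable_conj:
  assumes "decidable P" "decidable Q" shows "decidable (\<lambda>n. P n \<and> Q n)"
proof -
  have "computable_fun (\<lambda>n. if P n then if Q n then 1 else 0 else 0)"
    by (intro computable_if assms computable_const)
  moreover have "(if P n \<and> Q n then 1 else 0) = (if P n then if Q n then 1 else (0::nat) else 0)" for n
    by simp
  ultimately show ?thesis by (simp only: decidable_def)
qed

lemma decidable_disj:
  assumes "decidable P" "decidable Q" shows "decidable (\<lambda>n. P n \<or> Q n)"
proof -
  have "decidable (\<lambda>n. \<not> (\<not> P n \<and> \<not> Q n))"
    by (intro decidable_not decidable_conj assms)
  then show ?thesis by (simp only: de_Morgan_conj not_not)
qed

lemma decidable_imp:
  assumes "decidable P" "decidable Q" shows "decidable (\<lambda>n. P n \<longrightarrow> Q n)"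
  unfolding imp_conv_disj by (intro decidable_not decidable_disj assms)

lemma decidable_le:
  assumes "computable_fun f" "computable_fun g" shows "decidable (\<lambda>n. f n \<le> g n)"
  using decidable_0[OF computable_diff[OF assms]] by (simp only: diff_is_0_eq)

lemma decidable_less:
  assumes "computable_fun f" "computable_fun g" shows "decidable (\<lambda>n. f n < g n)"
  unfolding not_le[symmetric] by (intro decidable_not decidable_le assms)

lemma decidable_eq:
  assumes "computable_fun f" "computable_fun g" shows "decidable (\<lambda>n. f n = g n)"
  unfolding order_eq_iff by (intro decidable_conj decidable_le assms)

lemma decidable_comp: "decidable P \<Longrightarrow> computable_fun f \<Longrightarrow> decidable (\<lambda>n. P (f n))"
  unfolding decidable_def by (rule computable_comp)

lemma computable_sum:
  assumes "computable_fun (\<lambda>z. f (p1 z) (p2 z))" "computable_fun b"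
  shows "computable_fun (\<lambda>n. \<Sum>i<b n. f n i)"
proof -
  have "rec_nat 0 (\<lambda>i y. f n i + y) m = (\<Sum>i<m. f n i)" for n m
    by (induction m) auto
  moreover have "computable_fun (\<lambda>n. rec_nat 0 (\<lambda>i y. f n i + y) (b n))"
    by (intro computable_rec_nat computable_const assms computable_add computable_p2 computable_id)
       (use computable_comp[OF assms(1) computable_pair[OF computable_p1[OF computable_id] 
         computable_p1[OF computable_p2[OF computable_id]]]] in simp)
  ultimately show ?thesis by simp
qed

lemma decidable_ball:
  assumes "decidable (\<lambda>z. P (p1 z) (p2 z))" "computable_fun b"
  shows "decidable (\<lambda>n. \<forall>i<b n. P n i)"
proof -
  have "decidable (\<lambda>n. (\<Sum>i<b n. if P n i then 0 else 1) = (0::nat))"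
    by (intro decidable_0 computable_sum assms computable_if computable_const)
  moreover have "((\<Sum>i<b n. if P n i then 0 else 1) = (0::nat)) = (\<forall>i<b n. P n i)" for n
    by (auto split: if_splits)
  ultimately show ?thesis by simp
qed

lemma decidable_bex:
  assumes "decidable (\<lambda>z. P (p1 z) (p2 z))" "computable_fun b"
  shows "decidable (\<lambda>n. \<exists>i<b n. P n i)"
proof -
  have "decidable (\<lambda>n. \<not> (\<forall>i<b n. \<not> P n i))"
    by (intro decidable_not decidable_ball assms)
  then show ?thesis by simp
qed

lemma computable_power:
  assumes "computable_fun f" "computable_fun g" shows "computable_fun (\<lambda>n. f n ^ g n)"
proof -
  have "rec_nat 1 (\<lambda>i y. f n * y) m = f n ^ m" for n m
    by (induction m) auto
  moreover have "computable_fun (\<lambda>n. rec_nat 1 (\<lambda>i y. f n * y) (g n))"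
    by (intro computable_rec_nat computable_const assms computable_mult computable_p2 computable_id
        computable_comp[OF assms(1)] computable_p1)
  ultimately show ?thesis by simp
qed

text \<open>The quotient counts the positive multiples of \<open>y\<close> up to \<open>x\<close>;
  the guard \<open>0 < y\<close> reproduces the convention that division by zero gives zero.\<close>

lemma div_nat_eq_sum: "x div y = (\<Sum>i<x. if 0 < y \<and> Suc i * y \<le> x then 1 else 0)" for x y :: nat
proof (cases "y = 0")
  case False
  have "Suc i * y \<le> x \<longleftrightarrow> i < x div y" for i
    using False by (simp add: less_eq_div_iff_mult_less_eq Suc_le_eq[symmetric] del: mult_Suc)
  then have "{i \<in> {..<x}. 0 < y \<and> Suc i * y \<le> x} = {..<x div y}"
    using False div_le_dividend[of x y] by (auto intro: less_le_trans simp del: mult_Suc)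
  then show ?thesis
    by (simp add: sum.If_cases Int_def del: mult_Suc)
qed simp

lemma computable_div:
  assumes "computable_fun f" "computable_fun g" shows "computable_fun (\<lambda>n. f n div g n)"
  unfolding div_nat_eq_sum
  by (intro computable_sum computable_if decidable_conj decidable_less decidable_le computable_mult
      computable_Suc computable_const computable_p1 computable_p2 computable_id assms
      computable_comp[OF assms(1)] computable_comp[OF assms(2)])

lemma computable_mod:
  assumes "computable_fun f" "computable_fun g" shows "computable_fun (\<lambda>n. f n mod g n)"
  unfolding modulo_nat_def
  by (intro computable_diff computable_mult computable_div assms)

lemmas computable_intros = computable_id computable_const computable_Suc computable_add computable_mult
  computable_diff computable_pair computable_p1 computable_p2 computable_sum computable_power
  computable_div computable_mod computable_if decidable_const decidable_not decidable_conj decidable_disj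
  decidable_imp decidable_le decidable_less decidable_eq decidable_ball decidable_bex

lemma computable_LEAST:
  assumes "decidable (\<lambda>z. P (p1 z) (p2 z))" "\<And>n. \<exists>t. P n t"
  shows "computable_fun (\<lambda>n. LEAST t. P n t)"
proof -
  have "computable_fun (\<lambda>n. LEAST t. (if P n t then 0 else 1) = (0::nat))"
    by (rule computable_Least) (use assms in \<open>auto intro!: computable_intros\<close>)
  moreover have "((if P n t then 0 else 1) = (0::nat)) = P n t" for n t by simp
  ultimately show ?thesis by simp
qed

text \<open>Finite sequences are coded by digits in a large base.\<close>

definition entry :: "nat \<Rightarrow> nat \<Rightarrow> nat" where
  "entry s i = p2 s div p1 s ^ i mod p1 s"

lemma computable_entry: "computable_fun f \<Longrightarrow> computable_fun g \<Longrightarrow> computable_fun (\<lambda>n. entry (f n) (g n))"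
  unfolding entry_def by (intro computable_intros)

lemma digit_sum:
  fixes f :: "nat \<Rightarrow> nat"
  assumes "\<And>i. i < len \<Longrightarrow> f i < b" "j < len"
  shows "(\<Sum>i<len. f i * b ^ i) div b ^ j mod b = f j"
proof -
  have b: "b > 0" using assms by force
  show ?thesis using assms
  proof (induction len arbitrary: f j)
    case (Suc len)
    have eq: "(\<Sum>i<Suc len. f i * b ^ i) = f 0 + b * (\<Sum>i<len. f (Suc i) * b ^ i)"
      by (subst sum.lessThan_Suc_shift) (simp add: sum_distrib_left mult_ac)
    show ?case
    proof (cases j)
      case 0
      then show ?thesis unfolding eq using Suc.prems by simp
    next
      case (Suc j')
      have "(f 0 + b * (\<Sum>i<len. f (Suc i) * b ^ i)) div b = (\<Sum>i<len. f (Suc i) * b ^ i)"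
        using Suc.prems(1)[of 0] b by simp
      then show ?thesis
        unfolding eq Suc power_Suc div_mult2_eq
        using Suc.IH[of "\<lambda>i. f (Suc i)" j'] Suc.prems Suc by simp
    qed
  qed simp
qed

lemma digit_sum_less:
  fixes f :: "nat \<Rightarrow> nat"
  assumes "\<And>i. i < len \<Longrightarrow> f i < b"
  shows "(\<Sum>i<len. f i * b ^ i) < b ^ len"
  using assms
proof (induction len)
  case (Suc len)
  have "f len * b ^ len + b ^ len \<le> b * b ^ len"
    using mult_le_mono1[of "Suc (f len)" b "b ^ len"] Suc.prems[of len] by simp
  then show ?case using Suc by fastforce
qed simp

lemma entry_exists: "\<exists>s. \<forall>i<len. entry s i = f i"
proof -
  \<comment> \<open>A base above the sum of all values exceeds each of them, so no carries
    occur.\<close>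
  define b where "b = Suc (\<Sum>i<len. f i)"
  have "f i < b" if "i < len" for i
    unfolding b_def using that by (simp add: less_Suc_eq_le member_le_sum)
  then show ?thesis
    by (intro exI[of _ "pair b (\<Sum>i<len. f i * b ^ i)"]) (auto simp: entry_def digit_sum)
qed

section \<open>Enumerable predicates\<close>

text \<open>Projections of decidable predicates. In this form the closure properties need no
  manipulation of programs; \<open>re_set\<close> is only translated into it, and the way back to
  \<open>reval\<close> is taken once, for recursive sets.\<close>

definition enumerable :: "(nat \<Rightarrow> bool) \<Rightarrow> bool" where
  "enumerable P \<longleftrightarrow> (\<exists>Q. decidable Q \<and> (\<forall>n. P n \<longleftrightarrow> (\<exists>t. Q (pair n t))))"

lemma enumerable_decidable: "decidable P \<Longrightarrow> enumerable P"
  unfolding enumerable_def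
  by (rule exI[of _ "\<lambda>z. P (p1 z)"]) (auto intro!: decidable_comp[of P] computable_intros)

lemma enumerable_comp:
  assumes "enumerable P" "computable_fun f" shows "enumerable (\<lambda>n. P (f n))"
proof -
  obtain Q where Q: "decidable Q" "\<And>n. P n \<longleftrightarrow> (\<exists>t. Q (pair n t))"
    using assms(1) by (auto simp: enumerable_def)
  show ?thesis
    unfolding enumerable_def
    by (rule exI[of _ "\<lambda>z. Q (pair (f (p1 z)) (p2 z))"])
       (auto simp: Q(2) intro!: decidable_comp[OF Q(1)] computable_intros computable_comp[OF assms(2)])
qed

lemma enumerable_ex:
  assumes "enumerable (\<lambda>z. P (p1 z) (p2 z))" shows "enumerable (\<lambda>n. \<exists>t. P n t)"
proof -
  obtain Q where Q: "decidable Q" "\<And>n. P (p1 n) (p2 n) \<longleftrightarrow> (\<exists>t. Q (pair n t))"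
    using assms(1) by (auto simp: enumerable_def)
  have "P n t \<longleftrightarrow> (\<exists>s. Q (pair (pair n t) s))" for n t
    using Q(2)[of "pair n t"] by simp
  then show ?thesis
    unfolding enumerable_def
    by (intro exI[of _ "\<lambda>z. Q (pair (pair (p1 z) (p1 (p2 z))) (p2 (p2 z)))"])
       (auto intro!: decidable_comp[OF Q(1)] computable_intros, metis p1_pair p2_pair)
qed

lemma enumerable_conj:
  assumes "enumerable P" "enumerable P'" shows "enumerable (\<lambda>n. P n \<and> P' n)"
proof -
  obtain Q where Q: "decidable Q" "\<And>n. P n \<longleftrightarrow> (\<exists>t. Q (pair n t))"
    using assms(1) by (auto simp: enumerable_def)
  obtain Q' where Q': "decidable Q'" "\<And>n. P' n \<longleftrightarrow> (\<exists>t. Q' (pair n t))"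
    using assms(2) by (auto simp: enumerable_def)
  show ?thesis
    unfolding enumerable_def
    by (intro exI[of _ "\<lambda>z. Q (pair (p1 z) (p1 (p2 z))) \<and> Q' (pair (p1 z) (p2 (p2 z)))"])
       (auto simp: Q(2) Q'(2) intro!: decidable_conj decidable_comp[OF Q(1)] decidable_comp[OF Q'(1)] computable_intros,
         metis p1_pair p2_pair)
qed

lemma enumerable_disj:
  assumes "enumerable P" "enumerable P'" shows "enumerable (\<lambda>n. P n \<or> P' n)"
proof -
  obtain Q where Q: "decidable Q" "\<And>n. P n \<longleftrightarrow> (\<exists>t. Q (pair n t))"
    using assms(1) by (auto simp: enumerable_def)
  obtain Q' where Q': "decidable Q'" "\<And>n. P' n \<longleftrightarrow> (\<exists>t. Q' (pair n t))"
    using assms(2) by (auto simp: enumerable_def)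
  show ?thesis
    unfolding enumerable_def
    by (intro exI[of _ "\<lambda>z. Q z \<or> Q' z"]) (auto simp: Q Q' intro!: decidable_disj)
qed

text \<open>Finitely many witnesses have a common bound \<open>T\<close>, so a single unbounded
  search replaces one search for each \<open>i\<close>.\<close>

lemma enumerable_ball:
  assumes "enumerable (\<lambda>z. P (p1 z) (p2 z))" "computable_fun b" shows "enumerable (\<lambda>n. \<forall>i<b n. P n i)"
proof -
  obtain Q where Q: "decidable Q" "\<And>n. P (p1 n) (p2 n) \<longleftrightarrow> (\<exists>t. Q (pair n t))"
    using assms(1) by (auto simp: enumerable_def)
  have P: "P n i \<longleftrightarrow> (\<exists>s. Q (pair (pair n i) s))" for n i
    using Q(2)[of "pair n i"] by simp
  have "(\<forall>i<b n. P n i) \<longleftrightarrow> (\<exists>T. \<forall>i<b n. \<exists>t<T. Q (pair (pair n i) t))" for n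
  proof
    assume "\<forall>i<b n. P n i"
    then have "\<forall>i<b n. \<exists>s. Q (pair (pair n i) s)" by (simp add: P)
    then obtain s where s: "\<And>i. i < b n \<Longrightarrow> Q (pair (pair n i) (s i))" by metis
    have "s i < Suc (\<Sum>i<b n. s i)" if "i < b n" for i
      using that by (simp add: less_Suc_eq_le member_le_sum)
    with s show "\<exists>T. \<forall>i<b n. \<exists>t<T. Q (pair (pair n i) t)" by blast
  qed (auto simp: P)
  moreover have "decidable (\<lambda>z. \<forall>i<b (p1 z). \<exists>t<p2 z. Q (pair (pair (p1 z) i) t))"
    by (intro computable_intros decidable_comp[OF Q(1)] computable_comp[OF assms(2)])
  ultimately show ?thesis
    unfolding enumerable_def
    by (intro exI[of _ "\<lambda>z. \<forall>i<b (p1 z). \<exists>t<p2 z. Q (pair (pair (p1 z) i) t)"]) auto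
qed

lemma list_decode_rec:
  "list_decode c = (if c = 0 then [] else p1 (c - 1) # list_decode (p2 (c - 1)))"
  by (cases c) (auto simp: p1_def p2_def split: prod.splits)

lemma list_decode_Cons: "list_decode (Suc (pair x c)) = x # list_decode c"
  by simp

lemma list_all2_decode_Cons:
  "list_all2 R (g # gs) (list_decode c) \<longleftrightarrow>
     c \<noteq> 0 \<and> R g (p1 (c - 1)) \<and> list_all2 R gs (list_decode (p2 (c - 1)))"
  by (subst list_decode_rec) auto

text \<open>The whole course of values of the recursion is guessed as one coded sequence
  \<open>s\<close>; what remains to check is a bounded conjunction of local conditions.\<close>

lemma reval_Prec_iff:
  "reval (Prec f g) (n # xs) y \<longleftrightarrow>
     (\<exists>s. reval f xs (entry s 0) \<and> (\<forall>i<n. reval g (i # entry s i # xs) (entry s (Suc i))) \<and> entry s n = y)"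
proof -
  have "reval (Prec f g) (n # xs) y \<longleftrightarrow>
     (\<exists>h. reval f xs (h 0) \<and> (\<forall>i<n. reval g (i # h i # xs) (h (Suc i))) \<and> h n = y)"
  proof (induction n arbitrary: y)
    case 0
    show ?case unfolding reval_Prec_0_iff by (auto intro: exI[of _ "\<lambda>_. y"])
  next
    case (Suc n)
    show ?case
    proof
      assume "reval (Prec f g) (Suc n # xs) y"
      then obtain h where h: "reval f xs (h 0)" "\<forall>i<n. reval g (i # h i # xs) (h (Suc i))"
        "reval g (n # h n # xs) y"
        unfolding reval_Prec_Suc_iff Suc.IH by blast
      then show "\<exists>h. reval f xs (h 0) \<and> (\<forall>i<Suc n. reval g (i # h i # xs) (h (Suc i))) \<and> h (Suc n) = y"
        by (intro exI[of _ "h(Suc n := y)"]) (auto simp: less_Suc_eq)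
    next
      assume "\<exists>h. reval f xs (h 0) \<and> (\<forall>i<Suc n. reval g (i # h i # xs) (h (Suc i))) \<and> h (Suc n) = y"
      then show "reval (Prec f g) (Suc n # xs) y"
        unfolding reval_Prec_Suc_iff Suc.IH by (metis less_Suc_eq)
    qed
  qed
  also have "\<dots> \<longleftrightarrow> (\<exists>s. reval f xs (entry s 0) \<and> (\<forall>i<n. reval g (i # entry s i # xs) (entry s (Suc i))) \<and> entry s n = y)"
  proof
    assume "\<exists>h. reval f xs (h 0) \<and> (\<forall>i<n. reval g (i # h i # xs) (h (Suc i))) \<and> h n = y"
    then obtain h where h: "reval f xs (h 0)" "\<And>i. i < n \<Longrightarrow> reval g (i # h i # xs) (h (Suc i))" "h n = y"
      by blast
    obtain s where s: "\<And>i. i < Suc n \<Longrightarrow> entry s i = h i" using entry_exists by blast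
    show "\<exists>s. reval f xs (entry s 0) \<and> (\<forall>i<n. reval g (i # entry s i # xs) (entry s (Suc i))) \<and> entry s n = y"
      by (rule exI[of _ s]) (use h s in auto)
  qed blast
  finally show ?thesis .
qed

text \<open>Induction over the program, which stays fixed, so no universal machine is involved.
  Arguments are passed as a coded list because the arity changes from a program to its
  parts.\<close>

lemma enumerable_reval: "enumerable (\<lambda>z. reval r (list_decode (p1 z)) (p2 z))"
proof (induction r)
  case Zr
  show ?case
    unfolding reval_Zr_iff by (intro enumerable_decidable computable_intros)
next
  case Sc
  have "reval Sc (list_decode (p1 z)) (p2 z) \<longleftrightarrow> p1 z \<noteq> 0 \<and> p2 z = Suc (p1 (p1 z - 1))" for z
    unfolding reval_Sc_iff by (subst (1 2) list_decode_rec) auto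
  then show ?case
    by (simp only:) (intro enumerable_decidable computable_intros)
next
  case (Proj i)
  have "decidable (\<lambda>z. i < length (list_decode (f z)) \<and> g z = list_decode (f z) ! i)"
    if "computable_fun f" "computable_fun g" for f g
    using that
  proof (induction i arbitrary: f)
    case 0
    have "0 < length (list_decode (f z)) \<and> g z = list_decode (f z) ! 0 \<longleftrightarrow> f z \<noteq> 0 \<and> g z = p1 (f z - 1)" for z
      by (subst (1 2) list_decode_rec) auto
    then show ?case by (simp only:) (intro computable_intros 0)
  next
    case (Suc i)
    have "Suc i < length (list_decode (f z)) \<and> g z = list_decode (f z) ! Suc i \<longleftrightarrow>
       f z \<noteq> 0 \<and> (i < length (list_decode (p2 (f z - 1))) \<and> g z = list_decode (p2 (f z - 1)) ! i)" for z
      by (subst (1 2) list_decode_rec) auto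
    then show ?case by (simp only:) (intro computable_intros Suc)
  qed
  from this[OF computable_p1[OF computable_id] computable_p2[OF computable_id]] show ?case
    unfolding reval_Proj_iff by (rule enumerable_decidable)
next
  case (Comp f gs)
  \<comment> \<open>An inner induction over the list of argument programs; the subset condition
    keeps the outer induction hypotheses available for each of them.\<close>
  have "enumerable (\<lambda>z. list_all2 (\<lambda>g y. reval g (list_decode (p1 z)) y) gs' (list_decode (p2 z)))"
    if "set gs' \<subseteq> set gs" for gs'
    using that
  proof (induction gs')
    case Nil
    have "list_all2 (\<lambda>g y. reval g (list_decode (p1 z)) y) [] (list_decode (p2 z)) \<longleftrightarrow> p2 z = 0" for z
      by (subst (2) list_decode_rec) auto
    then show ?case by (simp only:) (intro enumerable_decidable computable_intros)
  next
    case (Cons g gs')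
    have "enumerable (\<lambda>z. reval g (list_decode (p1 (pair (p1 z) (p1 (p2 z - 1))))) (p2 (pair (p1 z) (p1 (p2 z - 1)))))"
      by (rule enumerable_comp[where P = "\<lambda>z. reval g (list_decode (p1 z)) (p2 z)"])
         (use Cons.prems in \<open>auto intro!: Comp.IH(2) computable_intros\<close>)
    moreover have "enumerable (\<lambda>z. list_all2 (\<lambda>g y. reval g (list_decode (p1 (pair (p1 z) (p2 (p2 z - 1))))) y) gs' 
        (list_decode (p2 (pair (p1 z) (p2 (p2 z - 1))))))"
      by (rule enumerable_comp[where P = "\<lambda>z. list_all2 (\<lambda>g y. reval g (list_decode (p1 z)) y) gs' (list_decode (p2 z))"])
         (use Cons in \<open>auto intro!: computable_intros\<close>)
    ultimately show ?case
      unfolding list_all2_decode_Cons p1_pair p2_pair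
      by (intro enumerable_conj) (auto intro!: enumerable_decidable computable_intros)
  qed
  from enumerable_comp[OF this[OF subset_refl], of "\<lambda>z. pair (p1 (p1 z)) (p2 z)"]
  have 1: "enumerable (\<lambda>z. list_all2 (\<lambda>g y. reval g (list_decode (p1 (p1 z))) y) gs (list_decode (p2 z)))"
    by (simp add: computable_intros)
  from enumerable_comp[OF Comp.IH(1), of "\<lambda>z. pair (p2 z) (p2 (p1 z))"]
  have 2: "enumerable (\<lambda>z. reval f (list_decode (p2 z)) (p2 (p1 z)))"
    by (simp add: computable_intros)
  have "reval (Comp f gs) (list_decode (p1 z)) (p2 z) \<longleftrightarrow>
      (\<exists>c. list_all2 (\<lambda>g y. reval g (list_decode (p1 z)) y) gs (list_decode c) \<and> reval f (list_decode c) (p2 z))" for z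
    unfolding reval_Comp_iff by (metis list_encode_inverse)
  then show ?case
    by (simp only:) (rule enumerable_ex, rule enumerable_conj[OF 1 2])
next
  case (Prec f g)
  have eq: "reval (Prec f g) (list_decode (p1 z)) (p2 z) \<longleftrightarrow>
      p1 z \<noteq> 0 \<and> (\<exists>s. (reval f (list_decode (p2 (p1 z - 1))) (entry s 0) \<and>
        (\<forall>i<p1 (p1 z - 1). reval g (list_decode (Suc (pair i (Suc (pair (entry s i) (p2 (p1 z - 1))))))) (entry s (Suc i)))) \<and>
        entry s (p1 (p1 z - 1)) = p2 z)" for z
    unfolding list_decode_Cons
    by (subst list_decode_rec) (auto simp: reval_Prec_iff reval_Prec_Nil)
  have 1: "enumerable (\<lambda>z. reval f (list_decode (p2 (p1 (p1 z) - 1))) (entry (p2 z) 0))"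
    using enumerable_comp[OF Prec.IH(1), of "\<lambda>z. pair (p2 (p1 (p1 z) - 1)) (entry (p2 z) 0)"]
    by (simp add: computable_intros computable_entry)
  have 2: "enumerable (\<lambda>z. reval g (list_decode (Suc (pair (p2 z) (Suc (pair (entry (p2 (p1 z)) (p2 z)) (p2 (p1 (p1 (p1 z)) - 1)))))))
      (entry (p2 (p1 z)) (Suc (p2 z))))"
    using enumerable_comp[OF Prec.IH(2), of "\<lambda>z. pair (Suc (pair (p2 z) (Suc (pair (entry (p2 (p1 z)) (p2 z)) (p2 (p1 (p1 (p1 z)) - 1))))))
      (entry (p2 (p1 z)) (Suc (p2 z)))"]
    unfolding p1_pair p2_pair
    by (simp only: computable_intros computable_entry)
  show ?case
    unfolding eq
    by (intro enumerable_conj enumerable_ex enumerable_ball 1 2)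
       (auto intro!: computable_intros enumerable_decidable computable_entry)
next
  case (Mn f)
  have 1: "enumerable (\<lambda>z. reval f (list_decode (Suc (pair (p2 z) (p1 z)))) 0)"
    using enumerable_comp[OF Mn.IH, of "\<lambda>z. pair (Suc (pair (p2 z) (p1 z))) 0"]
    unfolding p1_pair p2_pair by (simp only: computable_intros)
  have 2: "enumerable (\<lambda>z. reval f (list_decode (Suc (pair (p2 (p1 z)) (p1 (p1 (p1 z)))))) (Suc (p2 z)))"
    using enumerable_comp[OF Mn.IH, of "\<lambda>z. pair (Suc (pair (p2 (p1 z)) (p1 (p1 (p1 z))))) (Suc (p2 z))"]
    unfolding p1_pair p2_pair by (simp only: computable_intros)
  have "reval (Mn f) (list_decode (p1 z)) (p2 z) \<longleftrightarrow> reval f (list_decode (Suc (pair (p2 z) (p1 z)))) 0 \<and>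
     (\<forall>m<p2 z. \<exists>y. reval f (list_decode (Suc (pair m (p1 z)))) (Suc y))" for z
    unfolding reval_Mn_iff list_decode_Cons ..
  then show ?case
    by (simp only:) (intro enumerable_conj enumerable_ball enumerable_ex 1 2 computable_intros)
qed

lemma re_set_imp_enumerable:
  assumes "re_set A" shows "enumerable (\<lambda>n. n \<in> A)"
proof -
  obtain f where f: "\<And>n. n \<in> A \<longleftrightarrow> (\<exists>y. reval f [n] y)"
    using assms by (auto simp: re_set_def)
  have "enumerable (\<lambda>z. reval f (list_decode (Suc (pair (p1 z) 0))) (p2 z))"
    using enumerable_comp[OF enumerable_reval, of "\<lambda>z. pair (Suc (pair (p1 z) 0)) (p2 z)" f]
    unfolding p1_pair p2_pair by (simp only: computable_intros)
  from enumerable_ex[of "\<lambda>n y. reval f (list_decode (Suc (pair n 0))) y", OF this] show ?thesis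
    unfolding f by simp
qed

text \<open>Post's theorem: searching both enumerations in parallel always ends, and at the first
  hit \<open>T n\<close> only the correct side can have answered.\<close>

lemma enumerable_imp_recursive_set:
  assumes "enumerable (\<lambda>n. n \<in> A)" "enumerable (\<lambda>n. n \<notin> A)"
  shows "recursive_set A"
proof -
  obtain Q where Q: "decidable Q" "\<And>n. n \<in> A \<longleftrightarrow> (\<exists>t. Q (pair n t))"
    using assms(1) by (auto simp: enumerable_def)
  obtain R where R: "decidable R" "\<And>n. n \<notin> A \<longleftrightarrow> (\<exists>t. R (pair n t))"
    using assms(2) unfolding enumerable_def by metis
  define T where "T n = (LEAST t. Q (pair n t) \<or> R (pair n t))" for n
  have ex: "\<exists>t. Q (pair n t) \<or> R (pair n t)" for n
    using Q(2) R(2) by metis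
  have T: "computable_fun T"
    unfolding T_def
    by (rule computable_LEAST[OF _ ex]) (use Q(1) R(1) in \<open>simp add: decidable_disj\<close>)
  have "n \<in> A \<longleftrightarrow> Q (pair n (T n))" for n
    using LeastI_ex[OF ex[of n]] Q(2) R(2) unfolding T_def by blast
  moreover have "decidable (\<lambda>n. Q (pair n (T n)))"
    by (intro decidable_comp[OF Q(1)] computable_intros T)
  ultimately obtain r where "implements r 1 (\<lambda>xs. if xs ! 0 \<in> A then 1 else 0)"
    by (auto simp: decidable_def computable_fun_def recursive_fun_def)
  then show ?thesis
    unfolding recursive_set_def implements_def by (intro exI[of _ r]) auto
qed

subsection \<open>Binary expansions of enumerable sets\<close>

text \<open>Pairs of naturals code nonnegative fractions, not necessarily reduced. This avoids signs
  and normal forms and is enough for a positive \<alpha>.\<close>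

definition upper_cut :: "real \<Rightarrow> nat \<Rightarrow> bool" where
  "upper_cut x z \<longleftrightarrow> p2 z > 0 \<and> x < real (p1 z) / real (p2 z)"

definition binary_sum :: "nat set \<Rightarrow> real" where
  "binary_sum A = suminf (\<lambda>n. if n \<in> A then (1/2) ^ n else 0)"

lemma summable_binary: "summable (\<lambda>n. if n \<in> A then (1/2::real) ^ n else 0)"
  by (rule summable_comparison_test'[of "\<lambda>n. (1/2::real) ^ n" 0]) auto

text \<open>The tail from \<open>n + 2\<close> on is at most half of \<open>(1/2) ^ n\<close>.
  Cutting at \<open>n + 1\<close> would only give a weak inequality.\<close>

lemma binary_sum_less:
  assumes "n \<notin> A"
  shows "binary_sum A < (\<Sum>k<n+2. if k \<in> A then (1/2) ^ k else 0) + (1/2) ^ n"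
proof -
  let ?f = "\<lambda>n. if n \<in> A then (1/2::real) ^ n else 0"
  have "suminf (\<lambda>i. ?f (i + (n + 2))) \<le> suminf (\<lambda>i. (1/2) ^ (n + 2) * (1/2) ^ i)"
    using summable_ignore_initial_segment[OF summable_binary[of A], of "n + 2"]
    by (intro suminf_le summable_mult summable_geometric) (auto simp: power_add mult_ac)
  also have "\<dots> = (1/2) ^ (n + 2) * 2"
    by (subst suminf_mult) (auto simp: suminf_geometric)
  also have "\<dots> < (1/2) ^ n" by (simp add: power_add)
  finally show ?thesis
    unfolding binary_sum_def using suminf_split_initial_segment[OF summable_binary[of A], of "n + 2"] by simp
qed

text \<open>A finite part F of \<open>A\<close> without \<open>n\<close> whose sum plus
  \<open>(1/2) ^ n\<close> exceeds the full sum refutes \<open>n \<in> A\<close>, as otherwise F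
  together with \<open>n\<close> would contribute at least that much. If \<open>n\<close> is not in
  \<open>A\<close>, the elements of \<open>A\<close> below \<open>n + 2\<close> form such an F. The
  nonzero entries of \<open>s\<close> below \<open>m\<close> code F.\<close>

lemma enumerable_upper_cut_imp_recursive:
  assumes A: "enumerable (\<lambda>n. n \<in> A)" and cut: "enumerable (upper_cut (binary_sum A))"
  shows "recursive_set A"
proof (rule enumerable_imp_recursive_set[OF A])
  \<comment> \<open>Numerator of the sum over F plus \<open>(1/2) ^ n\<close> over the common
    denominator \<open>2 ^ (m + n)\<close>.\<close>
  define num where "num s m n = (\<Sum>k<m. if entry s k = 0 then 0 else 2 ^ (m - k)) * 2 ^ n + (2 ^ m :: nat)" for s m n
  have num: "real (num s m n) / real (2 ^ (m + n)) = (\<Sum>k<m. if entry s k = 0 then 0 else (1/2) ^ k) + (1/2) ^ n" for s m n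
  proof -
    have "(2::real) ^ (m - k) = 2 ^ m * (1 / 2) ^ k" if "k < m" for k
      using that by (simp add: power_diff power_one_over)
    then have "real (\<Sum>k<m. if entry s k = 0 then 0 else 2 ^ (m - k)) = 2 ^ m * (\<Sum>k<m. if entry s k = 0 then 0 else (1/2) ^ k)"
      unfolding of_nat_sum sum_distrib_left by (intro sum.cong) (auto simp del: power_one_over)
    then show ?thesis
      unfolding num_def by (simp add: field_simps power_add power_one_over)
  qed
  have "n \<notin> A \<longleftrightarrow> (\<exists>s. \<exists>m. (\<forall>k<m. entry s k = 0 \<or> k \<in> A) \<and> (m \<le> n \<or> entry s n = 0) \<and>
     upper_cut (binary_sum A) (pair (num s m n) (2 ^ (m + n))))" for n
  proof
    assume n: "n \<notin> A"
    obtain s where s: "\<And>k. k < n + 2 \<Longrightarrow> entry s k = (if k \<in> A then 1 else 0)"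
      using entry_exists[of "n + 2" "\<lambda>k. if k \<in> A then 1 else 0"] by blast
    have "(\<Sum>k<n+2. if k \<in> A then (1/2::real) ^ k else 0) = (\<Sum>k<n+2. if entry s k = 0 then 0 else (1/2) ^ k)"
      using s by (intro sum.cong) auto
    then have "upper_cut (binary_sum A) (pair (num s (n + 2) n) (2 ^ (n + 2 + n)))"
      using binary_sum_less[OF n] unfolding upper_cut_def p1_pair p2_pair num by simp
    then show "\<exists>s. \<exists>m. (\<forall>k<m. entry s k = 0 \<or> k \<in> A) \<and> (m \<le> n \<or> entry s n = 0) \<and>
     upper_cut (binary_sum A) (pair (num s m n) (2 ^ (m + n)))"
      using s n by (intro exI[of _ s] exI[of _ "n + 2"]) auto
  next
    assume "\<exists>s. \<exists>m. (\<forall>k<m. entry s k = 0 \<or> k \<in> A) \<and> (m \<le> n \<or> entry s n = 0) \<and>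
     upper_cut (binary_sum A) (pair (num s m n) (2 ^ (m + n)))"
    then obtain s m where sm: "\<And>k. k < m \<Longrightarrow> entry s k = 0 \<or> k \<in> A" "m \<le> n \<or> entry s n = 0"
      "binary_sum A < (\<Sum>k<m. if entry s k = 0 then 0 else (1/2) ^ k) + (1/2) ^ n"
      unfolding upper_cut_def p1_pair p2_pair num by blast
    show "n \<notin> A"
    proof
      assume n: "n \<in> A"
      define F where "F = {k. k < m \<and> entry s k \<noteq> 0}"
      have F: "F \<subseteq> A" "n \<notin> F" "finite F" using sm(1) sm(2) by (force simp: F_def)+
      have "(\<Sum>k<m. if entry s k = 0 then 0 else (1/2::real) ^ k) = (\<Sum>k\<in>F. (1/2) ^ k)"
        by (rule sum.mono_neutral_cong_right) (auto simp: F_def)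
      then have "(\<Sum>k<m. if entry s k = 0 then 0 else (1/2::real) ^ k) + (1/2) ^ n = (\<Sum>k\<in>insert n F. (1/2) ^ k)"
        using F by simp
      also have "\<dots> = (\<Sum>k\<in>insert n F. if k \<in> A then (1/2) ^ k else 0)"
        using F n by (intro sum.cong) auto
      also have "\<dots> \<le> binary_sum A"
        unfolding binary_sum_def by (rule sum_le_suminf) (use F summable_binary in auto)
      finally show False using sm(3) by linarith
    qed
  qed
  moreover have "enumerable (\<lambda>n. \<exists>s. \<exists>m. (\<forall>k<m. entry s k = 0 \<or> k \<in> A) \<and> (m \<le> n \<or> entry s n = 0) \<and>
     upper_cut (binary_sum A) (pair (num s m n) (2 ^ (m + n))))"
    unfolding num_def
    by (intro enumerable_ex enumerable_conj enumerable_ball enumerable_disj enumerable_comp[OF A] enumerable_comp[OF cut])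
       (intro computable_intros computable_entry enumerable_decidable)+
  ultimately show "enumerable (\<lambda>n. n \<notin> A)" by simp
qed

section \<open>Upper cuts of algebraic numbers\<close>

text \<open>Horner evaluation over a power of the denominator. \<open>F\<close> and \<open>G\<close>
  collect positive and negative contributions, since all computation is done with naturals.\<close>

lemma poly_fraction_computable:
  fixes p :: "real poly"
  assumes "\<And>i. poly.coeff p i \<in> \<int>"
  shows "\<exists>F G k. computable_fun F \<and> computable_fun G \<and>
    (\<forall>z. p2 z > 0 \<longrightarrow> poly p (real (p1 z) / real (p2 z)) = (real (F z) - real (G z)) / real (p2 z) ^ k)"
  using assms
proof (induction p)
  case 0
  show ?case
    by (rule exI[of _ "\<lambda>_. 0"], rule exI[of _ "\<lambda>_. 0"]) (auto intro: computable_const)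
next
  case (pCons c p)
  have "poly.coeff p i \<in> \<int>" for i using pCons.prems[of "Suc i"] by simp
  from pCons.IH[OF this] obtain F G k where FG: "computable_fun F" "computable_fun G"
    "\<And>z. p2 z > 0 \<Longrightarrow> poly p (real (p1 z) / real (p2 z)) = (real (F z) - real (G z)) / real (p2 z) ^ k"
    by blast
  have "c \<in> \<int>" using pCons.prems[of 0] by simp
  then obtain c' where c': "c = of_int c'" by (auto elim: Ints_cases)
  define a b where "a = nat c'" and "b = nat (- c')"
  have c: "c = real a - real b" unfolding c' a_def b_def by (cases "c' \<ge> 0") auto
  show ?case
  proof (rule exI[of _ "\<lambda>z. a * p2 z ^ Suc k + p1 z * F z"], rule exI[of _ "\<lambda>z. b * p2 z ^ Suc k + p1 z * G z"],
      rule exI[of _ "Suc k"], intro conjI allI impI)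
    show "computable_fun (\<lambda>z. a * p2 z ^ Suc k + p1 z * F z)" "computable_fun (\<lambda>z. b * p2 z ^ Suc k + p1 z * G z)"
      by (intro computable_intros FG)+
    fix z assume z: "0 < p2 z"
    show "poly (pCons c p) (real (p1 z) / real (p2 z)) = 
      (real (a * p2 z ^ Suc k + p1 z * F z) - real (b * p2 z ^ Suc k + p1 z * G z)) / real (p2 z) ^ Suc k"
      unfolding poly_pCons FG(3)[OF z] c using z by (simp add: field_simps)
  qed
qed

lemma decidable_poly_pos:
  fixes p :: "real poly"
  assumes "\<And>i. poly.coeff p i \<in> \<int>"
  shows "decidable (\<lambda>z. p2 z > 0 \<and> poly p (real (p1 z) / real (p2 z)) > 0)"
proof -
  obtain F G k where FG: "computable_fun F" "computable_fun G"
    "\<And>z. p2 z > 0 \<Longrightarrow> poly p (real (p1 z) / real (p2 z)) = (real (F z) - real (G z)) / real (p2 z) ^ k"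
    using poly_fraction_computable[OF assms] by blast
  have "p2 z > 0 \<and> poly p (real (p1 z) / real (p2 z)) > 0 \<longleftrightarrow> 0 < p2 z \<and> G z < F z" for z
    using FG(3)[of z] by (auto simp: zero_less_divide_iff)
  then show ?thesis by (simp only:) (intro computable_intros FG)
qed

text \<open>For an annihilating polynomial of least degree, the derivative has integer coefficients,
  is nonzero and has smaller degree, so it cannot vanish at \<open>x\<close>. A change of sign makes
  its value positive.\<close>

lemma algebraic_simple_root:
  fixes x :: real
  assumes "algebraic x"
  obtains p where "\<And>i. poly.coeff p i \<in> \<int>" "poly p x = 0" "poly (pderiv p) x > 0"
proof -
  define Z where "Z p \<longleftrightarrow> (\<forall>i. poly.coeff p i \<in> \<int>) \<and> p \<noteq> 0 \<and> poly p x = 0" for p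
  have "\<exists>p. Z p" using assms by (auto simp: algebraic_def Z_def)
  then obtain p where p: "Z p" and min: "\<And>q. Z q \<Longrightarrow> degree p \<le> degree q"
    using ex_has_least_nat[of Z _ degree] by blast
  have deg: "degree p > 0"
    using p by (auto simp: Z_def elim!: degree_eq_zeroE intro!: gr0I)
  have ints: "poly.coeff (pderiv p) i \<in> \<int>" for i
    using p by (simp add: Z_def coeff_pderiv del: of_nat_Suc)
  have "pderiv p \<noteq> 0" using deg by (simp add: pderiv_eq_0_iff)
  then have "poly (pderiv p) x \<noteq> 0"
    using min[of "pderiv p"] ints deg by (auto simp: Z_def degree_pderiv)
  then consider "poly (pderiv p) x > 0" | "poly (pderiv (- p)) x > 0"
    by (metis linorder_neqE_linordered_idom neg_0_less_iff_less pderiv_minus poly_minus)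
  then show ?thesis
  proof cases
    case 1
    then show ?thesis using that[of p] p by (auto simp: Z_def)
  next
    case 2
    then show ?thesis using that[of "- p"] p by (auto simp: Z_def)
  qed
qed

lemma rat_nat_between:
  fixes x y :: real
  assumes "0 \<le> x" "x < y"
  obtains a b :: nat where "b > 0" "x < real a / real b" "real a / real b < y"
proof -
  obtain q where q: "q \<in> \<rat>" "x < q" "q < y" using Rats_dense_in_real[OF assms(2)] by blast
  then obtain a b :: nat where "b \<noteq> 0" "\<bar>q\<bar> = real a / real b" by (elim Rats_abs_nat_div_natE)
  then show ?thesis using that[of b a] q assms by auto
qed

text \<open>Near a simple root the sign of \<open>p\<close> tells on which side of \<open>x\<close>
  a rational lies. Two fixed fractions enclosing \<open>x\<close> delimit this range; outside it,
  comparison with them decides.\<close>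

lemma algebraic_imp_enumerable_upper_cut:
  fixes x :: real
  assumes "algebraic x" "x > 0"
  shows "enumerable (upper_cut x)"
proof -
  obtain p where p: "\<And>i. poly.coeff p i \<in> \<int>" "poly p x = 0" "poly (pderiv p) x > 0"
    using algebraic_simple_root[OF assms(1)] by blast
  obtain d where d: "d > 0" "\<And>h. h > 0 \<Longrightarrow> h < d \<Longrightarrow> poly p x < poly p (x + h)"
    using DERIV_pos_inc_right[OF poly_DERIV p(3)] by blast
  obtain e where e: "e > 0" "\<And>h. h > 0 \<Longrightarrow> h < e \<Longrightarrow> poly p (x - h) < poly p x"
    using DERIV_pos_inc_left[OF poly_DERIV p(3)] by blast
  \<comment> \<open>The maximum with 0 is there because the lower fraction has to be a quotient of
    naturals.\<close>
  obtain a b :: nat where ab: "b > 0" "max 0 (x - e) < real a / real b" "real a / real b < x"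
    by (rule rat_nat_between[of "max 0 (x - e)" x]) (use assms(2) e(1) in auto)
  obtain a' b' :: nat where ab': "b' > 0" "x < real a' / real b'" "real a' / real b' < x + d"
    by (rule rat_nat_between[of x "x + d"]) (use assms(2) d(1) in auto)
  have "upper_cut x z \<longleftrightarrow> 0 < p2 z \<and> (a' * p2 z \<le> p1 z * b' \<or> a * p2 z < p1 z * b \<and> 
      (p2 z > 0 \<and> poly p (real (p1 z) / real (p2 z)) > 0))" for z
  proof (cases "p2 z > 0")
    case True
    define q where "q = real (p1 z) / real (p2 z)"
    have 1: "a' * p2 z \<le> p1 z * b' \<longleftrightarrow> real a' / real b' \<le> q"
      using True ab' unfolding q_def by (simp add: field_simps flip: of_nat_mult)
    have 2: "a * p2 z < p1 z * b \<longleftrightarrow> real a / real b < q"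
      using True ab unfolding q_def by (simp add: field_simps flip: of_nat_mult)
    have "x < q \<longleftrightarrow> real a' / real b' \<le> q \<or> real a / real b < q \<and> poly p q > 0"
    proof
      assume "x < q"
      then show "real a' / real b' \<le> q \<or> real a / real b < q \<and> poly p q > 0"
        using d(2)[of "q - x"] ab ab' p(2) by (cases "q - x < d") auto
    next
      assume "real a' / real b' \<le> q \<or> real a / real b < q \<and> poly p q > 0"
      moreover have "\<not> (q < x \<and> real a / real b < q \<and> poly p q > 0)"
        using e(2)[of "x - q"] ab p(2) by auto
      ultimately show "x < q" using ab' p(2) by (cases "x = q") auto
    qed
    then show ?thesis
      unfolding upper_cut_def 1 2 q_def[symmetric] using True by simp
  qed (simp add: upper_cut_def)
  then have "upper_cut x = (\<lambda>z. 0 < p2 z \<and> (a' * p2 z \<le> p1 z * b' \<or> a * p2 z < p1 z * b \<and> 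
      (p2 z > 0 \<and> poly p (real (p1 z) / real (p2 z)) > 0)))"
    by (intro ext)
  then show ?thesis
    by (simp only:) (intro enumerable_decidable computable_intros decidable_poly_pos p(1))
qed

subsection \<open>Integral and real chains\<close>

definition frag_norm :: "('a \<Rightarrow>\<^sub>0 int) \<Rightarrow> int" where
  "frag_norm c = (\<Sum>\<sigma>\<in>Poly_Mapping.keys c. \<bar>poly_mapping.lookup c \<sigma>\<bar>)"

text \<open>The l1-norm of the formal sum of the \<open>\<tau> j\<close> with coefficients
  \<open>w j\<close>, where coefficients of equal members are added before absolute values are
  taken. The members may have any type, so that simplices and tables can be compared.\<close>

definition family_norm :: "'i set \<Rightarrow> ('i \<Rightarrow> int) \<Rightarrow> ('i \<Rightarrow> 'a) \<Rightarrow> int" where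
  "family_norm J w \<tau> = (\<Sum>v\<in>\<tau> ` J. \<bar>\<Sum>j | j \<in> J \<and> \<tau> j = v. w j\<bar>)"

lemma lookup_sum_frag:
  "poly_mapping.lookup (\<Sum>j\<in>J. frag_cmul (w j) (frag_of (\<tau> j))) x = (\<Sum>j\<in>J. if \<tau> j = x then w j else 0)"
  by (auto simp: Poly_Mapping.lookup_sum intro!: sum.cong)

lemma frag_norm_superset:
  assumes "finite S" "Poly_Mapping.keys c \<subseteq> S"
  shows "frag_norm c = (\<Sum>\<sigma>\<in>S. \<bar>poly_mapping.lookup c \<sigma>\<bar>)"
  unfolding frag_norm_def using assms by (intro sum.mono_neutral_left) (auto simp: in_keys_iff)

lemma frag_norm_sum:
  assumes "finite J"
  shows "frag_norm (\<Sum>j\<in>J. frag_cmul (w j) (frag_of (\<tau> j))) = family_norm J w \<tau>"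
proof -
  let ?c = "\<Sum>j\<in>J. frag_cmul (w j) (frag_of (\<tau> j))"
  have "poly_mapping.lookup ?c x = 0" if "x \<notin> \<tau> ` J" for x
    using that unfolding lookup_sum_frag by (intro sum.neutral) auto
  then have "Poly_Mapping.keys ?c \<subseteq> \<tau> ` J"
    by (auto simp: in_keys_iff)
  then show ?thesis
    using assms unfolding family_norm_def
    by (subst frag_norm_superset[of "\<tau> ` J"])
       (auto simp: lookup_sum_frag sum.If_cases Int_def intro!: sum.cong)
qed

text \<open>A map can only identify members and thereby allow more cancellation: the triangle
  inequality on each fibre of \<open>g\<close>. Chain maps, sampling and realization all owe their
  norm bounds to this.\<close>

lemma family_norm_image:
  assumes "finite J"
  shows "family_norm J w (g \<circ> \<tau>) \<le> family_norm J w \<tau>"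
proof -
  have "\<bar>\<Sum>j | j \<in> J \<and> g (\<tau> j) = v. w j\<bar> \<le> (\<Sum>u | u \<in> \<tau> ` J \<and> g u = v. \<bar>\<Sum>j | j \<in> J \<and> \<tau> j = u. w j\<bar>)" for v
  proof -
    have "(\<Sum>j | j \<in> J \<and> g (\<tau> j) = v. w j) = (\<Sum>u | u \<in> \<tau> ` J \<and> g u = v. \<Sum>j | j \<in> {j \<in> J. g (\<tau> j) = v} \<and> \<tau> j = u. w j)"
      using assms by (intro sum.group[symmetric]) auto
    also have "\<dots> = (\<Sum>u | u \<in> \<tau> ` J \<and> g u = v. \<Sum>j | j \<in> J \<and> \<tau> j = u. w j)"
      by (intro sum.cong refl) auto
    finally show ?thesis by (simp add: sum_abs)
  qed
  then have "family_norm J w (g \<circ> \<tau>) \<le> (\<Sum>v\<in>g ` \<tau> ` J. \<Sum>u | u \<in> \<tau> ` J \<and> g u = v. \<bar>\<Sum>j | j \<in> J \<and> \<tau> j = u. w j\<bar>)"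
    unfolding family_norm_def image_comp[symmetric] by (intro sum_mono) (auto simp: comp_def)
  also have "\<dots> = family_norm J w \<tau>"
    unfolding family_norm_def using assms by (intro sum.group) auto
  finally show ?thesis .
qed

lemma family_norm_cong:
  assumes "\<And>j. j \<in> J \<Longrightarrow> \<tau> j = \<tau>' j" "\<And>j. j \<in> J \<Longrightarrow> w j = w' j"
  shows "family_norm J w \<tau> = family_norm J w' \<tau>'"
proof -
  have "\<tau> ` J = \<tau>' ` J" using assms by auto
  moreover have "(\<Sum>j | j \<in> J \<and> \<tau> j = v. w j) = (\<Sum>j | j \<in> J \<and> \<tau>' j = v. w' j)" for v
    using assms by (intro sum.cong) auto
  ultimately show ?thesis unfolding family_norm_def by simp
qed

lemma frag_as_sum:
  "c = (\<Sum>\<sigma>\<in>Poly_Mapping.keys c. frag_cmul (poly_mapping.lookup c \<sigma>) (frag_of \<sigma>))"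
  by (rule poly_mapping_eqI) (simp add: lookup_sum_frag sum.delta in_keys_iff)

lemma frag_norm_frag_extend_of:
  "frag_norm (frag_extend (frag_of \<circ> g) c) \<le> frag_norm c"
proof -
  have "frag_norm (frag_extend (frag_of \<circ> g) c) = family_norm (Poly_Mapping.keys c) (poly_mapping.lookup c) (g \<circ> id)"
    unfolding frag_extend_def using frag_norm_sum[of "Poly_Mapping.keys c" _ g] by simp
  also have "\<dots> \<le> family_norm (Poly_Mapping.keys c) (poly_mapping.lookup c) id"
    by (rule family_norm_image) simp
  also have "\<dots> = frag_norm c"
    by (subst (3) frag_as_sum, subst frag_norm_sum) (auto intro: family_norm_cong)
  finally show ?thesis .
qed

section \<open>Simplicial volume through integral chains\<close>

text \<open>Dividing by \<open>q\<close> gives a rational representative of the class of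
  \<open>z\<close>. With the denominator cleared, only integral data are quantified, which can be
  coded.\<close>

definition volume_below :: "nat \<Rightarrow> 'a topology \<Rightarrow> 'a chain \<Rightarrow> real \<Rightarrow> bool" where
  "volume_below d X z x \<longleftrightarrow> (\<exists>q b. q > 0 \<and> singular_chain (Suc d) X b \<and>
     real_of_int (frag_norm (frag_cmul (int q) z + chain_boundary (Suc d) b)) < real q * x)"

lemma volume_below_chain_map:
  assumes "continuous_map X Y f" "singular_chain d X z" "volume_below d X z x"
  shows "volume_below d Y (chain_map d f z) x"
proof -
  obtain q b where qb: "q > 0" "singular_chain (Suc d) X b"
    "real_of_int (frag_norm (frag_cmul (int q) z + chain_boundary (Suc d) b)) < real q * x"
    using assms(3) by (auto simp: volume_below_def)
  have "frag_cmul (int q) (chain_map d f z) + chain_boundary (Suc d) (chain_map (Suc d) f b) =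
      chain_map d f (frag_cmul (int q) z + chain_boundary (Suc d) b)"
    using chain_boundary_chain_map[OF qb(2), of f] by (simp add: chain_map_add)
  moreover have "frag_norm (chain_map d f c) \<le> frag_norm c" for c
    unfolding chain_map_def by (rule frag_norm_frag_extend_of)
  ultimately have "real_of_int (frag_norm (frag_cmul (int q) (chain_map d f z) + chain_boundary (Suc d) (chain_map (Suc d) f b))) < real q * x"
    using qb(3) by (metis of_int_le_iff order_le_less_trans)
  then show ?thesis
    unfolding volume_below_def using qb singular_chain_chain_map[OF qb(2) assms(1)] by blast
qed

lemma volume_below_homologous:
  assumes "homologous_rel d X {} z z'" "volume_below d X z x"
  shows "volume_below d X z' x"
proof -
  obtain q b where qb: "q > 0" "singular_chain (Suc d) X b"
    "real_of_int (frag_norm (frag_cmul (int q) z + chain_boundary (Suc d) b)) < real q * x"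
    using assms(2) by (auto simp: volume_below_def)
  obtain e where e: "singular_chain (Suc d) X e" "chain_boundary (Suc d) e = z - z'"
    using assms(1) unfolding homologous_rel_def singular_boundary by blast
  have "frag_cmul (int q) z' + chain_boundary (Suc d) (frag_cmul (int q) e + b) =
      frag_cmul (int q) z + chain_boundary (Suc d) b"
    unfolding chain_boundary_add chain_boundary_cmul e(2)
    by (rule poly_mapping_eqI) (simp add: lookup_add lookup_minus algebra_simps)
  then show ?thesis
    unfolding volume_below_def using qb e(1)
    by (intro exI[of _ q] exI[of _ "frag_cmul (int q) e + b"]) (auto intro: singular_chain_add singular_chain_cmul)
qed

section \<open>Real chains and their comparison with integral chains\<close>

lemma l1_norm_superset:
  assumes "finite S" "rsupp c \<subseteq> S" shows "l1_norm c = (\<Sum>\<sigma>\<in>S. \<bar>c \<sigma>\<bar>)"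
  unfolding l1_norm_def using assms by (intro sum.mono_neutral_left) (auto simp: rsupp_def)

lemma rsupp_real_of_chain: "rsupp (real_of_chain z) = Poly_Mapping.keys z"
  by (auto simp: rsupp_def real_of_chain_def in_keys_iff)

lemma l1_norm_real_of_chain: "l1_norm (real_of_chain z) = real_of_int (frag_norm z)"
  unfolding l1_norm_def rsupp_real_of_chain frag_norm_def by (simp add: real_of_chain_def)

lemma real_chain_real_of_chain: "real_chain p X (real_of_chain z) \<longleftrightarrow> singular_chain p X z"
  by (auto simp: real_chain_def rsupp_real_of_chain singular_chain_def)

lemma real_boundary_op_superset:
  assumes "finite S" "rsupp c \<subseteq> S"
  shows "real_boundary_op p c \<tau> = (if p = 0 then 0 else
     (\<Sum>\<sigma>\<in>S. c \<sigma> * (\<Sum>k\<le>p. if singular_face p k \<sigma> = \<tau> then (-1) ^ k else 0)))"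
proof -
  have "(\<Sum>\<sigma>\<in>rsupp c. c \<sigma> * (\<Sum>k\<le>p. if singular_face p k \<sigma> = \<tau> then (-1) ^ k else 0)) =
    (\<Sum>\<sigma>\<in>S. c \<sigma> * (\<Sum>k\<le>p. if singular_face p k \<sigma> = \<tau> then (-1) ^ k else 0))"
    using assms by (intro sum.mono_neutral_left) (auto simp: rsupp_def)
  then show ?thesis
    unfolding real_boundary_op_def by (auto simp: sum_distrib_left if_distrib mult.commute cong: if_cong)
qed

lemma real_boundary_op_real_of_chain:
  "real_boundary_op p (real_of_chain z) = real_of_chain (chain_boundary p z)"
proof
  fix \<tau>
  show "real_boundary_op p (real_of_chain z) \<tau> = real_of_chain (chain_boundary p z) \<tau>"
    unfolding real_boundary_op_superset[OF finite_keys[of z] eq_refl[OF rsupp_real_of_chain]]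
    by (auto simp: real_of_chain_def chain_boundary_def frag_extend_def Poly_Mapping.lookup_sum intro!: sum.cong)
qed

lemma real_boundary_op_linear:
  assumes "finite (rsupp a)" "finite (rsupp b)"
  shows "real_boundary_op p (\<lambda>\<sigma>. r * a \<sigma> + s * b \<sigma>) = (\<lambda>\<tau>. r * real_boundary_op p a \<tau> + s * real_boundary_op p b \<tau>)"
proof
  fix \<tau>
  let ?S = "rsupp a \<union> rsupp b"
  have S: "finite ?S" "rsupp (\<lambda>\<sigma>. r * a \<sigma> + s * b \<sigma>) \<subseteq> ?S" "rsupp a \<subseteq> ?S" "rsupp b \<subseteq> ?S"
    using assms by (auto simp: rsupp_def)
  show "real_boundary_op p (\<lambda>\<sigma>. r * a \<sigma> + s * b \<sigma>) \<tau> = r * real_boundary_op p a \<tau> + s * real_boundary_op p b \<tau>"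
    unfolding real_boundary_op_superset[OF S(1) S(2)] real_boundary_op_superset[OF S(1) S(3)] real_boundary_op_superset[OF S(1) S(4)]
    by (auto simp: sum_distrib_left sum.distrib algebra_simps)
qed

lemma finite_rsupp_boundary:
  assumes "finite (rsupp c)"
  shows "rsupp (real_boundary_op p c) \<subseteq> (\<Union>\<sigma>\<in>rsupp c. (\<lambda>k. singular_face p k \<sigma>) ` {..p})"
    and "finite (rsupp (real_boundary_op p c))"
proof -
  show *: "rsupp (real_boundary_op p c) \<subseteq> (\<Union>\<sigma>\<in>rsupp c. (\<lambda>k. singular_face p k \<sigma>) ` {..p})"
  proof (rule subsetI, rule ccontr)
    fix \<tau> assume "\<tau> \<in> rsupp (real_boundary_op p c)" "\<tau> \<notin> (\<Union>\<sigma>\<in>rsupp c. (\<lambda>k. singular_face p k \<sigma>) ` {..p})"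
    note a = this
    have ne: "real_boundary_op p c \<tau> \<noteq> 0" using a(1) by (simp add: rsupp_def)
    have no: "singular_face p k \<sigma> \<noteq> \<tau>" if "\<sigma> \<in> rsupp c" "k \<le> p" for \<sigma> k
      using a(2) that by blast
    have "(\<Sum>\<sigma>\<in>rsupp c. \<Sum>k\<le>p. if singular_face p k \<sigma> = \<tau> then (- 1) ^ k * c \<sigma> else 0) = 0"
      by (rule sum.neutral, rule ballI, rule sum.neutral, rule ballI) (simp add: no)
    then have "real_boundary_op p c \<tau> = 0"
      unfolding real_boundary_op_def by (simp only: if_cancel)
    with ne show False by contradiction
  qed
  show "finite (rsupp (real_boundary_op p c))"
    by (rule finite_subset[OF *]) (use assms in auto)
qed

lemma l1_norm_boundary:
  assumes "finite (rsupp c)"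
  shows "l1_norm (real_boundary_op p c) \<le> real (Suc p) * l1_norm c"
proof -
  define T where "T = (\<Union>\<sigma>\<in>rsupp c. (\<lambda>k. singular_face p k \<sigma>) ` {..p})"
  have T: "finite T" using assms by (auto simp: T_def)
  have "l1_norm (real_boundary_op p c) = (\<Sum>\<tau>\<in>T. \<bar>real_boundary_op p c \<tau>\<bar>)"
    by (rule l1_norm_superset[OF T]) (use finite_rsupp_boundary[OF assms] in \<open>auto simp: T_def\<close>)
  also have "\<dots> \<le> (\<Sum>\<tau>\<in>T. \<Sum>\<sigma>\<in>rsupp c. \<Sum>k\<le>p. if singular_face p k \<sigma> = \<tau> then \<bar>c \<sigma>\<bar> else 0)"
  proof (rule sum_mono)
    fix \<tau>
    have "\<bar>\<Sum>\<sigma>\<in>rsupp c. \<Sum>k\<le>p. if singular_face p k \<sigma> = \<tau> then (-1) ^ k * c \<sigma> else 0\<bar>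
      \<le> (\<Sum>\<sigma>\<in>rsupp c. \<Sum>k\<le>p. \<bar>if singular_face p k \<sigma> = \<tau> then (-1) ^ k * c \<sigma> else 0\<bar>)"
      by (intro order_trans[OF sum_abs] sum_mono) auto
    also have "\<dots> = (\<Sum>\<sigma>\<in>rsupp c. \<Sum>k\<le>p. if singular_face p k \<sigma> = \<tau> then \<bar>c \<sigma>\<bar> else 0)"
      by (intro sum.cong refl) (auto simp: abs_mult power_abs)
    finally show "\<bar>real_boundary_op p c \<tau>\<bar> \<le> (\<Sum>\<sigma>\<in>rsupp c. \<Sum>k\<le>p. if singular_face p k \<sigma> = \<tau> then \<bar>c \<sigma>\<bar> else 0)"
      unfolding real_boundary_op_def by (auto intro: sum_nonneg)
  qed
  also have "\<dots> = (\<Sum>\<sigma>\<in>rsupp c. \<Sum>k\<le>p. \<Sum>\<tau>\<in>T. if singular_face p k \<sigma> = \<tau> then \<bar>c \<sigma>\<bar> else 0)"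
    by (subst sum.swap, intro sum.cong refl, subst sum.swap) auto
  also have "\<dots> \<le> (\<Sum>\<sigma>\<in>rsupp c. \<Sum>k\<le>p. \<bar>c \<sigma>\<bar>)"
    by (intro sum_mono) (use T in \<open>auto simp: sum.delta\<close>)
  also have "\<dots> = real (Suc p) * l1_norm c"
    by (simp add: l1_norm_def sum_distrib_left)
  finally show ?thesis .
qed

lemma l1_norm_add:
  assumes "finite (rsupp a)" "finite (rsupp b)"
  shows "l1_norm (\<lambda>\<sigma>. a \<sigma> + b \<sigma>) \<le> l1_norm a + l1_norm b"
proof -
  let ?S = "rsupp a \<union> rsupp b"
  have S: "finite ?S" using assms by simp
  have "rsupp (\<lambda>\<sigma>. a \<sigma> + b \<sigma>) \<subseteq> ?S" by (auto simp: rsupp_def)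
  then have "l1_norm (\<lambda>\<sigma>. a \<sigma> + b \<sigma>) = (\<Sum>\<sigma>\<in>?S. \<bar>a \<sigma> + b \<sigma>\<bar>)"
    by (rule l1_norm_superset[OF S])
  also have "\<dots> \<le> (\<Sum>\<sigma>\<in>?S. \<bar>a \<sigma>\<bar> + \<bar>b \<sigma>\<bar>)" by (intro sum_mono abs_triangle_ineq)
  also have "\<dots> = l1_norm a + l1_norm b"
    using l1_norm_superset[OF S, of a] l1_norm_superset[OF S, of b] by (simp add: sum.distrib)
  finally show ?thesis .
qed

lemma l1_norm_mult: "l1_norm (\<lambda>\<sigma>. r * a \<sigma>) = \<bar>r\<bar> * l1_norm a"
proof (cases "r = 0")
  case False
  then have "rsupp (\<lambda>\<sigma>. r * a \<sigma>) = rsupp a" by (auto simp: rsupp_def)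
  then show ?thesis by (simp add: l1_norm_def abs_mult sum_distrib_left)
qed (simp add: l1_norm_def)

lemma rsupp_mult_add: "rsupp (\<lambda>\<sigma>. r * (a \<sigma> + b \<sigma>)) \<subseteq> rsupp a \<union> rsupp b"
  by (auto simp: rsupp_def)

lemma l1_norm_nonneg: "0 \<le> l1_norm c"
  by (simp add: l1_norm_def sum_nonneg)

text \<open>Truncating the coefficients of \<open>q * b\<close> to integers changes the \<open>\<ell>\<^sup>1\<close>-norm of
  the boundary by an amount that does not depend on \<open>q\<close>.\<close>

lemma real_filling_imp_volume_below:
  assumes z: "singular_chain d X z" and b: "real_chain (Suc d) X b"
    and less: "l1_norm (\<lambda>\<sigma>. real_of_chain z \<sigma> + real_boundary_op (Suc d) b \<sigma>) < x"
  shows "volume_below d X z x"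
proof -
  let ?l = "l1_norm (\<lambda>\<sigma>. real_of_chain z \<sigma> + real_boundary_op (Suc d) b \<sigma>)"
  \<comment> \<open>A simplex of dimension \<open>Suc d\<close> has \<open>d + 2\<close> faces, and
    each coefficient of \<open>b\<close> contributes a rounding error of at most 1.\<close>
  define C where "C = real (Suc (Suc d)) * real (card (rsupp b))"
  have fin: "finite (rsupp b)" using b by (simp add: real_chain_def)
  \<comment> \<open>The gap to \<open>x\<close> grows linearly in \<open>q\<close> while the error
    \<open>C\<close> stays fixed.\<close>
  obtain q :: nat where q: "C < real q * (x - ?l)"
    using less ex_less_of_nat_mult[of "x - ?l" C] by auto
  have "C \<ge> 0" by (simp add: C_def)
  then have q0: "q > 0" using q by (intro gr0I) auto
  define B where "B = (\<Sum>\<sigma>\<in>rsupp b. frag_cmul \<lfloor>real q * b \<sigma>\<rfloor> (frag_of \<sigma>))"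
  have B: "real_of_chain B \<sigma> = real_of_int \<lfloor>real q * b \<sigma>\<rfloor>" for \<sigma>
    unfolding B_def real_of_chain_def lookup_sum_frag using fin by (auto simp: sum.delta rsupp_def)
  have chB: "singular_chain (Suc d) X B"
    unfolding B_def using b by (intro singular_chain_sum singular_chain_cmul) (auto simp: real_chain_def singular_chain_of)
  define e where "e = (\<lambda>\<sigma>. 1 * real_of_chain B \<sigma> + (- real q) * b \<sigma>)"
  have rB: "finite (rsupp (real_of_chain B))" by (simp add: rsupp_real_of_chain)
  have re: "rsupp e \<subseteq> rsupp b" by (auto simp: e_def B rsupp_def)
  have fine: "finite (rsupp e)" using re fin finite_subset by blast
  have "l1_norm e \<le> real (card (rsupp b))"
  proof -
    have "\<bar>e \<sigma>\<bar> \<le> 1" for \<sigma> unfolding e_def B by linarith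
    then show ?thesis
      unfolding l1_norm_superset[OF fin re] using sum_mono[of "rsupp b" "\<lambda>\<sigma>. \<bar>e \<sigma>\<bar>" "\<lambda>_. 1"] by simp
  qed
  then have le: "l1_norm (real_boundary_op (Suc d) e) \<le> C"
    unfolding C_def by (intro order_trans[OF l1_norm_boundary[OF fine]] mult_left_mono) auto
  have "real_boundary_op (Suc d) e = (\<lambda>\<tau>. 1 * real_boundary_op (Suc d) (real_of_chain B) \<tau> + (- real q) * real_boundary_op (Suc d) b \<tau>)"
    unfolding e_def by (rule real_boundary_op_linear[OF rB fin])
  then have "real_of_chain (frag_cmul (int q) z + chain_boundary (Suc d) B) =
    (\<lambda>\<sigma>. real q * (real_of_chain z \<sigma> + real_boundary_op (Suc d) b \<sigma>) + real_boundary_op (Suc d) e \<sigma>)"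
    unfolding real_boundary_op_real_of_chain
    by (auto simp: real_of_chain_def lookup_add algebra_simps)
  then have "real_of_int (frag_norm (frag_cmul (int q) z + chain_boundary (Suc d) B)) =
     l1_norm (\<lambda>\<sigma>. real q * (real_of_chain z \<sigma> + real_boundary_op (Suc d) b \<sigma>) + real_boundary_op (Suc d) e \<sigma>)"
    by (simp flip: l1_norm_real_of_chain)
  also have "\<dots> \<le> real q * ?l + C"
  proof -
    have "rsupp (\<lambda>\<sigma>. real q * (real_of_chain z \<sigma> + real_boundary_op (Suc d) b \<sigma>))
        \<subseteq> rsupp (real_of_chain z) \<union> rsupp (real_boundary_op (Suc d) b)"
      by (rule rsupp_mult_add)
    moreover have "finite (rsupp (real_of_chain z) \<union> rsupp (real_boundary_op (Suc d) b))"
      using finite_rsupp_boundary(2)[OF fin] by (simp add: rsupp_real_of_chain)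
    ultimately have "finite (rsupp (\<lambda>\<sigma>. real q * (real_of_chain z \<sigma> + real_boundary_op (Suc d) b \<sigma>)))"
      by (rule finite_subset)
    from l1_norm_add[OF this finite_rsupp_boundary(2)[OF fine, of "Suc d"]]
    have "l1_norm (\<lambda>\<sigma>. real q * (real_of_chain z \<sigma> + real_boundary_op (Suc d) b \<sigma>) + real_boundary_op (Suc d) e \<sigma>)
        \<le> real q * ?l + l1_norm (real_boundary_op (Suc d) e)"
      by (simp only: l1_norm_mult abs_of_nat)
    from order_trans[OF this add_left_mono[OF le]] show ?thesis .
  qed
  also have "\<dots> < real q * x" using q by (simp add: algebra_simps)
  finally show ?thesis
    unfolding volume_below_def using q0 chB by blast
qed

text \<open>A strict bound on an infimum is witnessed by a single real cycle, whose filling can be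
  rounded to an integral one after scaling; conversely, an integral witness divided by
  \<open>q\<close> is a real representative.\<close>

lemma simplicial_volume_less_iff:
  assumes z: "singular_relcycle d X {} z" and \<mu>: "\<mu> = homologous_rel_set d X {} z"
  shows "simplicial_volume d X \<mu> < x \<longleftrightarrow> volume_below d X z x"
proof -
  let ?S = "{l1_norm c | c. real_cycle d X c \<and> (\<exists>z\<in>\<mu>. real_boundary d X (\<lambda>\<sigma>. c \<sigma> - real_of_chain z \<sigma>))}"
  have chz: "singular_chain d X z" and bz: "chain_boundary d z = 0"
    using z by (auto simp: singular_cycle)
  have z\<mu>: "z \<in> \<mu>" by (simp add: \<mu>)
  have cyc: "real_cycle d X (\<lambda>\<sigma>. r * real_of_chain c \<sigma>)" if "singular_chain d X c" "chain_boundary d c = 0" for r c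
  proof -
    have "rsupp (\<lambda>\<sigma>. r * real_of_chain c \<sigma>) \<subseteq> rsupp (real_of_chain c)" by (auto simp: rsupp_def)
    moreover have rc: "real_chain d X (real_of_chain c)" using that by (simp add: real_chain_real_of_chain)
    ultimately have "real_chain d X (\<lambda>\<sigma>. r * real_of_chain c \<sigma>)"
      unfolding real_chain_def using finite_subset by blast
    moreover have "finite (rsupp (real_of_chain c))" using rc by (simp add: real_chain_def)
    from real_boundary_op_linear[OF this this, of d r 0]
    have "real_boundary_op d (\<lambda>\<sigma>. r * real_of_chain c \<sigma>) = (\<lambda>_. 0)"
      unfolding real_boundary_op_real_of_chain that by (simp add: real_of_chain_def)
    ultimately show ?thesis by (simp add: real_cycle_def)
  qed
  \<comment> \<open>The infimum of reals is only controlled for a nonempty set bounded below;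
    \<open>z\<close> itself provides a member.\<close>
  have "l1_norm (real_of_chain z) \<in> ?S"
  proof -
    have "real_boundary d X (\<lambda>\<sigma>. real_of_chain z \<sigma> - real_of_chain z \<sigma>)"
      unfolding real_boundary_def
      by (rule exI[of _ "\<lambda>_. 0"]) (auto simp: real_chain_def rsupp_def real_boundary_op_def)
    with cyc[OF chz bz, of 1] z\<mu> show ?thesis
      by (intro CollectI exI[of _ "real_of_chain z"]) (auto intro!: bexI[of _ z])
  qed
  then have ne: "?S \<noteq> {}" by blast
  have bdd: "bdd_below ?S" by (rule bdd_belowI[of _ 0]) (auto simp: l1_norm_nonneg)
  show ?thesis
  proof
    assume "simplicial_volume d X \<mu> < x"
    then obtain y where y: "y \<in> ?S" "y < x"
      unfolding simplicial_volume_def using cInf_lessD[OF ne] by blast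
    then obtain c z' b where c: "l1_norm c < x" and z': "z' \<in> \<mu>" and b: "real_chain (Suc d) X b"
      "real_boundary_op (Suc d) b = (\<lambda>\<sigma>. c \<sigma> - real_of_chain z' \<sigma>)"
      unfolding real_boundary_def by auto
    \<comment> \<open>The filling refers to some representative \<open>z'\<close> of the class;
      subtracting a chain between \<open>z\<close> and \<open>z'\<close> makes it refer to
      \<open>z\<close>.\<close>
    obtain e where e: "singular_chain (Suc d) X e" "chain_boundary (Suc d) e = z - z'"
      using z' unfolding \<mu> mem_Collect_eq homologous_rel_def singular_boundary by blast
    have fin: "finite (rsupp b)" "finite (rsupp (real_of_chain e))"
      using b by (auto simp: real_chain_def rsupp_real_of_chain)
    define B where "B = (\<lambda>\<sigma>. 1 * b \<sigma> + (- 1) * real_of_chain e \<sigma>)"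
    have "rsupp B \<subseteq> rsupp b \<union> rsupp (real_of_chain e)" by (auto simp: B_def rsupp_def)
    then have "real_chain (Suc d) X B"
      using b(1) e(1)[folded real_chain_real_of_chain] unfolding real_chain_def
      by (meson Un_iff finite_UnI finite_subset subsetD)
    moreover have "real_boundary_op (Suc d) B \<sigma> = c \<sigma> - real_of_chain z \<sigma>" for \<sigma>
      unfolding B_def real_boundary_op_linear[OF fin] real_boundary_op_real_of_chain b(2) e(2)
      by (simp add: real_of_chain_def lookup_minus)
    ultimately show "volume_below d X z x"
      using c by (intro real_filling_imp_volume_below[OF chz, of B]) auto
  next
    assume "volume_below d X z x"
    then obtain q b where qb: "q > 0" "singular_chain (Suc d) X b"
      "real_of_int (frag_norm (frag_cmul (int q) z + chain_boundary (Suc d) b)) < real q * x"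
      by (auto simp: volume_below_def)
    define c where "c = frag_cmul (int q) z + chain_boundary (Suc d) b"
    have ch: "singular_chain d X c"
      unfolding c_def using chz singular_chain_boundary[OF qb(2)] by (simp add: singular_chain_add singular_chain_cmul)
    have "chain_boundary d c = 0"
      unfolding c_def using bz chain_boundary_boundary[OF qb(2)]
      by (simp add: chain_boundary_add chain_boundary_cmul)
    from cyc[OF ch this, of "1 / real q"]
    have "real_cycle d X (\<lambda>\<sigma>. (1 / real q) * real_of_chain c \<sigma>)" .
    moreover have "real_boundary d X (\<lambda>\<sigma>. (1 / real q) * real_of_chain c \<sigma> - real_of_chain z \<sigma>)"
      unfolding real_boundary_def
    proof (intro exI conjI)
      have rc: "real_chain (Suc d) X (real_of_chain b)" using qb(2) by (simp add: real_chain_real_of_chain)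
      \<comment> \<open>The summand with coefficient 0 gives the chain the shape expected by
        \<open>real_boundary_op_linear\<close>.\<close>
      have "rsupp (\<lambda>\<sigma>. (1 / real q) * real_of_chain b \<sigma> + 0 * real_of_chain b \<sigma>) \<subseteq> rsupp (real_of_chain b)"
        by (auto simp: rsupp_def)
      then show "real_chain (Suc d) X (\<lambda>\<sigma>. (1 / real q) * real_of_chain b \<sigma> + 0 * real_of_chain b \<sigma>)"
        using rc unfolding real_chain_def using finite_subset by blast
      have f: "finite (rsupp (real_of_chain b))" by (simp add: rsupp_real_of_chain)
      show "real_boundary_op (Suc d) (\<lambda>\<sigma>. (1 / real q) * real_of_chain b \<sigma> + 0 * real_of_chain b \<sigma>) = 
          (\<lambda>\<sigma>. (1 / real q) * real_of_chain c \<sigma> - real_of_chain z \<sigma>)"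
        unfolding real_boundary_op_linear[OF f f] real_boundary_op_real_of_chain
        using qb(1) by (auto simp: c_def real_of_chain_def lookup_add field_simps)
    qed
    ultimately have "l1_norm (\<lambda>\<sigma>. (1 / real q) * real_of_chain c \<sigma>) \<in> ?S"
      using z\<mu> by blast
    then have "simplicial_volume d X \<mu> \<le> l1_norm (\<lambda>\<sigma>. (1 / real q) * real_of_chain c \<sigma>)"
      unfolding simplicial_volume_def by (rule cInf_lower[OF _ bdd])
    also have "\<dots> < x"
      unfolding l1_norm_mult l1_norm_real_of_chain using qb(1,3) by (simp add: c_def field_simps)
    finally show "simplicial_volume d X \<mu> < x" .
  qed
qed

subsection \<open>Closed manifolds are neighbourhood retracts\<close>

text \<open>The dimension of the embedding depends on the number of charts, which a type cannot.
  Bounded sequences form one normed space that contains coordinate spaces of all finite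
  dimensions.\<close>

type_synonym ambient = "nat \<Rightarrow>\<^sub>C real"

definition axis_vector :: "nat \<Rightarrow> ambient" where
  "axis_vector j = Bcontfun (\<lambda>i. if i = j then 1 else 0)"

lemma apply_axis_vector: "apply_bcontfun (axis_vector j) i = (if i = j then 1 else 0)"
  unfolding axis_vector_def
  by (subst Bcontfun_inverse) (auto intro!: bcontfun_normI[of _ 1])

lemma apply_sum_axis_vector:
  "apply_bcontfun (\<Sum>j<N. c j *\<^sub>R axis_vector j) i = (if i < N then c i else 0)"
  by (induction N) (auto simp: apply_axis_vector less_Suc_eq)

lemma continuous_on_apply_ambient: "continuous_on S (\<lambda>y::ambient. apply_bcontfun y i)"
  unfolding continuous_on_iff by (meson dist_bounded order_le_less_trans)

lemma continuous_map_sum_axis_vector: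
  assumes "\<And>j. j < N \<Longrightarrow> continuous_map X euclideanreal (\<lambda>x. c x j)"
  shows "continuous_map X euclidean (\<lambda>x. \<Sum>j<N. c x j *\<^sub>R axis_vector j)"
proof -
  have "continuous_map euclideanreal euclidean (\<lambda>t::real. t *\<^sub>R axis_vector j)" for j
    by (simp add: continuous_map_iff_continuous2 continuous_intros)
  from continuous_map_compose[OF assms this] show ?thesis
    by (intro continuous_map_sum) (auto simp: o_def)
qed

lemma continuous_map_Euclidean_coord:
  assumes "continuous_map X (Euclidean_space d) f"
  shows "continuous_map X euclideanreal (\<lambda>x. f x k)"
proof -
  have "continuous_map X (powertop_real UNIV) f"
    using assms by (simp add: Euclidean_space_def continuous_map_in_subtopology)
  then show ?thesis by (simp add: continuous_map_componentwise_UNIV)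
qed

lemma continuous_map_into_Euclidean:
  assumes "\<And>k. k < d \<Longrightarrow> continuous_map X euclideanreal (\<lambda>x. f x k)" "\<And>x k. x \<in> topspace X \<Longrightarrow> k \<ge> d \<Longrightarrow> f x k = 0"
  shows "continuous_map X (Euclidean_space d) f"
proof -
  have "continuous_map X (Euclidean_space d) (\<lambda>x k. if k < d then f x k else 0)"
    using assms by (simp add: continuous_map_componentwise_Euclidean_space)
  then show ?thesis
    by (rule continuous_map_eq) (use assms(2) in \<open>auto simp: fun_eq_iff\<close>)
qed

text \<open>\<open>V\<close> and the complement of \<open>C\<close> are open and cover the space,
  and both definitions give 0 where they overlap.\<close>

lemma continuous_map_extend_zero:
  assumes "openin M V" "closedin M C" "C \<subseteq> V" "continuous_map (subtopology M V) euclideanreal \<psi>"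
    and "\<And>x. x \<in> V \<Longrightarrow> x \<notin> C \<Longrightarrow> \<psi> x = 0"
  shows "continuous_map M euclideanreal (\<lambda>x. if x \<in> V then \<psi> x else 0)"
proof (rule pasting_lemma[where I = "{True, False}" and T = "\<lambda>b. if b then V else topspace M - C"
      and f = "\<lambda>b. if b then \<psi> else (\<lambda>_. 0)"])
  show "\<exists>j. j \<in> {True, False} \<and> x \<in> (if j then V else topspace M - C) \<and>
      (if x \<in> V then \<psi> x else 0) = (if j then \<psi> else (\<lambda>_. 0)) x" if "x \<in> topspace M" for x
    using that assms(3) by (cases "x \<in> V") auto
qed (use assms in \<open>auto split: if_splits\<close>)

text \<open>Three nested zones around \<open>K\<close>: \<open>t\<close> vanishes on the first and
  is 1 beyond the second, while the third still lies in \<open>W\<close>. So every point with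
  \<open>t\<close> below 1 is in \<open>W\<close>, where the old retraction is defined.\<close>

lemma clamp_infdist:
  fixes K :: "'b::metric_space set"
  assumes "compact K" "open W" "K \<subseteq> W" "K \<noteq> {}"
  obtains \<delta> t where "\<delta> > 0" "\<And>y. infdist y K < 3 * \<delta> \<Longrightarrow> y \<in> W" "continuous_on UNIV t"
    "\<And>y. infdist y K < \<delta> \<Longrightarrow> t y = (0::real)" "\<And>y. infdist y K > 2 * \<delta> \<Longrightarrow> t y = 1"
proof -
  obtain e where e: "e > 0" "(\<Union>x\<in>K. ball x e) \<subseteq> W"
    using compact_subset_open_imp_ball_epsilon_subset assms by metis
  show ?thesis
  proof (rule that[of "e / 3" "\<lambda>y. min 1 (max 0 (infdist y K / (e / 3) - 1))"])
    fix y assume "infdist y K < 3 * (e / 3)"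
    then have "infdist y K < e" by simp
    then obtain a where "a \<in> K" "dist y a < e"
      unfolding infdist_notempty[OF assms(4)] using assms(4) by (subst (asm) cINF_less_iff) auto
    then have "y \<in> ball a e" by (simp add: dist_commute)
    then show "y \<in> W" using e(2) \<open>a \<in> K\<close> by blast
  next
    show "continuous_on UNIV (\<lambda>y. min 1 (max 0 (infdist y K / (e / 3) - 1)))"
      using e by (intro continuous_intros) auto
  qed (use e in \<open>auto simp: field_simps min_def max_def\<close>)
qed

text \<open>On the overlap the two partial retractions are interpolated affinely in the chart.\<close>

lemma extend_retraction_over_chart:
  fixes e :: "'a \<Rightarrow> ambient"
  assumes e: "continuous_map M euclidean e"
    and D: "compactin M D" and W: "open W" "e ` D \<subseteq> W"
    and r: "continuous_map (top_of_set W) M r" "\<And>x. x \<in> topspace M \<Longrightarrow> e x \<in> W \<Longrightarrow> r (e x) = x"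
    and V: "openin M V" and hg: "homeomorphic_maps (subtopology M V) (Euclidean_space d) h g"
    and B: "open B" and f: "continuous_map (top_of_set B) (Euclidean_space d) f"
    and fe: "\<And>x. x \<in> topspace M \<Longrightarrow> e x \<in> B \<Longrightarrow> x \<in> V \<and> f (e x) = h x"
  obtains W' r' where "open W'" "e ` D \<subseteq> W'" "\<And>x. x \<in> topspace M \<Longrightarrow> e x \<in> B \<Longrightarrow> e x \<in> W'"
    "continuous_map (top_of_set W') M r'" "\<And>x. x \<in> topspace M \<Longrightarrow> e x \<in> W' \<Longrightarrow> r' (e x) = x"
proof -
  have h: "continuous_map (subtopology M V) (Euclidean_space d) h"
    and g: "continuous_map (Euclidean_space d) M g"
    and gh: "\<And>x. x \<in> topspace M \<Longrightarrow> x \<in> V \<Longrightarrow> g (h x) = x"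
    using hg by (auto simp: homeomorphic_maps_def continuous_map_in_subtopology)
  have VM: "V \<subseteq> topspace M" using V openin_subset by blast
  have gf: "continuous_map (top_of_set B) M (\<lambda>y. g (f y))"
    using continuous_map_compose[OF f g] by (simp add: o_def)
  have gfe: "g (f (e x)) = x" if "x \<in> topspace M" "e x \<in> B" for x
    using fe[OF that] gh that by simp
  show ?thesis
  proof (cases "D = {}")
    \<comment> \<open>With no set to preserve, the chart alone gives the retraction; distances to an
      empty set are avoided.\<close>
    case True
    show ?thesis
      by (rule that[of B "\<lambda>y. g (f y)"]) (use True B gf gfe in auto)
  next
    case False
    define K where "K = e ` D"
    have "compactin euclidean K" unfolding K_def using image_compactin[OF D e] .
    then have K: "compact K" "K \<noteq> {}" "K \<subseteq> W" using False W by (auto simp: K_def)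
    from clamp_infdist[OF K(1) W(1) K(3) K(2)] obtain \<delta> t where \<delta>: "\<delta> > 0"
      "\<And>y. infdist y K < 3 * \<delta> \<Longrightarrow> y \<in> W" and t: "continuous_on UNIV t"
      "\<And>y. infdist y K < \<delta> \<Longrightarrow> t y = (0::real)" "\<And>y. infdist y K > 2 * \<delta> \<Longrightarrow> t y = 1" by metis
    \<comment> \<open>Near \<open>K\<close>, where \<open>t\<close> is 0, this is the old
      retraction, and far away the chart retraction. On points of the embedded manifold both ends of
      the segment agree, so these stay fixed.\<close>
    define m where "m y = g (\<lambda>k. (1 - t y) * h (r y) k + t y * f y k)" for y
    \<comment> \<open>\<open>W1\<close> is where the old retraction is kept, \<open>W2\<close> where
      both are available in the chart, \<open>W3\<close> where only the new one is used.
      \<open>W1\<close> and \<open>W3\<close> are disjoint, so agreement on the two overlaps with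
      \<open>W2\<close> is enough.\<close>
    define W1 where "W1 = {y. infdist y K < \<delta>}"
    define W2 where "W2 = {y \<in> B \<inter> W. r y \<in> V}"
    define W3 where "W3 = B \<inter> {y. infdist y K > 2 * \<delta>}"
    have ope: "open W1" "open W3"
      unfolding W1_def W3_def using B
      by (auto intro!: open_Int open_Collect_less continuous_intros)
    have "openin (top_of_set W) {y \<in> W. r y \<in> V}"
      using openin_continuous_map_preimage[OF r(1) V] by simp
    then have "open {y \<in> W. r y \<in> V}" using W(1) openin_open_trans by blast
    moreover have "W2 = B \<inter> {y \<in> W. r y \<in> V}" by (auto simp: W2_def)
    ultimately have W2: "open W2" using B by auto
    have W1W: "W1 \<subseteq> W" using \<delta> by (auto simp: W1_def)
    have cm: "continuous_map (top_of_set W2) M m"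
    proof -
      have tc: "continuous_map (top_of_set W2) euclideanreal t"
        using continuous_on_subset[OF t(1)] by (simp add: continuous_map_iff_continuous)
      have rc: "continuous_map (top_of_set W2) (subtopology M V) r"
        unfolding continuous_map_in_subtopology
        using continuous_map_from_subtopology_mono[OF r(1), of W2] by (auto simp: W2_def)
      have hc: "continuous_map (top_of_set W2) (Euclidean_space d) (\<lambda>y. h (r y))"
        using continuous_map_compose[OF rc h] by (simp add: o_def)
      have fc: "continuous_map (top_of_set W2) (Euclidean_space d) f"
        by (rule continuous_map_from_subtopology_mono[OF f]) (auto simp: W2_def)
      have z: "F y k = 0" if "continuous_map (top_of_set W2) (Euclidean_space d) F" "y \<in> W2" "k \<ge> d" for F y k
        using continuous_map_image_subset_topspace[OF that(1)] that by (auto simp: topspace_Euclidean_space)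
      have "continuous_map (top_of_set W2) (Euclidean_space d) (\<lambda>y k. (1 - t y) * h (r y) k + t y * f y k)"
      proof (rule continuous_map_into_Euclidean)
        show "continuous_map (top_of_set W2) euclideanreal (\<lambda>y. (1 - t y) * h (r y) k + t y * f y k)" for k
          by (intro continuous_map_add continuous_map_real_mult continuous_map_diff continuous_map_canonical_const tc
              continuous_map_Euclidean_coord[OF hc] continuous_map_Euclidean_coord[OF fc])
        show "(1 - t y) * h (r y) k + t y * f y k = 0" if "y \<in> topspace (top_of_set W2)" "k \<ge> d" for y k
          using that z[OF hc] z[OF fc] by simp
      qed
      from continuous_map_compose[OF this g] show ?thesis by (simp add: o_def m_def[abs_def])
    qed
    have eq12: "m y = r y" if "y \<in> W1" "y \<in> W2" for y
      using that t(2)[of y] gh[of "r y"] VM by (auto simp: m_def W1_def W2_def)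
    have eq23: "m y = g (f y)" if "y \<in> W2" "y \<in> W3" for y
      using that t(3)[of y] by (simp add: m_def W3_def)
    have eq13: "y \<notin> W3" if "y \<in> W1" for y
      using that \<delta>(1) by (auto simp: W1_def W3_def)
    define r' where "r' y = (if y \<in> W1 then r y else if y \<in> W2 then m y else g (f y))" for y
    let ?W' = "W1 \<union> W2 \<union> W3"
    have r'3: "r' y = g (f y)" if "y \<in> W3" for y
      using that eq23 eq13 by (auto simp: r'_def)
    have r'2: "r' y = m y" if "y \<in> W2" for y
      using that eq12 by (auto simp: r'_def)
    have c1: "continuous_map (top_of_set W1) M r'"
      by (rule continuous_map_eq[OF continuous_map_from_subtopology_mono[OF r(1) W1W]]) (simp add: r'_def)
    have c2: "continuous_map (top_of_set W2) M r'"
      by (rule continuous_map_eq[OF cm]) (simp add: r'2)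
    have "W3 \<subseteq> B" by (auto simp: W3_def)
    then have c3: "continuous_map (top_of_set W3) M r'"
      by (intro continuous_map_eq[OF continuous_map_from_subtopology_mono[OF gf]]) (simp_all add: r'3)
    have "continuous_map (top_of_set ?W') M r'"
    proof (rule pasting_lemma[where I = "{W1, W2, W3}" and T = id and f = "\<lambda>_. r'"])
      show "openin (top_of_set ?W') (id i)" if "i \<in> {W1, W2, W3}" for i
        using that ope W2 by (auto intro!: open_subset)
      show "continuous_map (subtopology (top_of_set ?W') (id i)) M r'" if "i \<in> {W1, W2, W3}" for i
      proof -
        have "?W' \<inter> i = i" using that by auto
        then show ?thesis using that c1 c2 c3 by (auto simp: subtopology_subtopology)
      qed
    qed auto
    moreover have "e ` D \<subseteq> ?W'"
      using \<delta>(1) by (auto simp: W1_def K_def)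
    moreover have "e x \<in> ?W'" if x: "x \<in> topspace M" "e x \<in> B" for x
    proof (cases "infdist (e x) K > 2 * \<delta>")
      case False
      \<comment> \<open>Within distance \<open>2 * \<delta>\<close> the old retraction exists and
        fixes \<open>e x\<close>, so \<open>e x\<close> lands in \<open>W2\<close>.\<close>
      then have "e x \<in> W" using \<delta> by (intro \<delta>(2)) auto
      then show ?thesis using x r(2) fe by (auto simp: W2_def)
    qed (use x in \<open>auto simp: W3_def\<close>)
    moreover have "r' (e x) = x" if x: "x \<in> topspace M" "e x \<in> ?W'" for x
    proof -
      consider "e x \<in> W1" | "e x \<in> W2" | "e x \<in> W3" using x by blast
      then show ?thesis
      proof cases
        case 1
        then show ?thesis using r(2)[OF x(1)] W1W by (auto simp: r'_def)
      next
        case 2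
        then have "e x \<in> B" "r (e x) = x" using r(2)[OF x(1)] by (auto simp: W2_def)
        then have "m (e x) = g (h x)"
          using fe[OF x(1)] by (simp add: m_def algebra_simps)
        then show ?thesis using r'2[OF 2] fe[OF x(1) \<open>e x \<in> B\<close>] gh[OF x(1)] by simp
      next
        case 3
        then show ?thesis using r'3[OF 3] gfe[OF x(1)] by (simp add: W3_def)
      qed
    qed
    ultimately show ?thesis
      using that[of ?W' r'] ope W2 by blast
  qed
qed

lemma compactin_Euclidean_l1_ball:
  "compactin (Euclidean_space d) {v \<in> topspace (Euclidean_space d). (\<Sum>k<d. \<bar>v k\<bar>) \<le> R}"
proof -
  let ?S = "{v \<in> topspace (Euclidean_space d). (\<Sum>k<d. \<bar>v k\<bar>) \<le> R}"
  have "compactin (powertop_real UNIV) (UNIV \<rightarrow>\<^sub>E {-\<bar>R\<bar>..\<bar>R\<bar>})"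
    by (simp add: compactin_PiE)
  moreover have "?S \<subseteq> UNIV \<rightarrow>\<^sub>E {-\<bar>R\<bar>..\<bar>R\<bar>}"
  proof
    fix v assume v: "v \<in> ?S"
    have "v i \<in> {-\<bar>R\<bar>..\<bar>R\<bar>}" for i
    proof (cases "i < d")
      case True
      then have "\<bar>v i\<bar> \<le> (\<Sum>k<d. \<bar>v k\<bar>)" by (intro member_le_sum) auto
      then show ?thesis using v by auto
    qed (use v in \<open>auto simp: topspace_Euclidean_space\<close>)
    then show "v \<in> UNIV \<rightarrow>\<^sub>E {-\<bar>R\<bar>..\<bar>R\<bar>}" by auto
  qed
  moreover have "closedin (powertop_real UNIV) ?S"
  proof -
    have "closed {v::nat \<Rightarrow> real. (\<Sum>k<d. \<bar>v k\<bar>) \<le> R}"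
      by (intro closed_Collect_le continuous_intros) simp_all
    then have "closedin (powertop_real UNIV) {v::nat \<Rightarrow> real. (\<Sum>k<d. \<bar>v k\<bar>) \<le> R}"
      by (simp add: euclidean_product_topology)
    moreover have "?S = topspace (Euclidean_space d) \<inter> {v. (\<Sum>k<d. \<bar>v k\<bar>) \<le> R}" by blast
    ultimately show ?thesis using closedin_Int[OF closedin_Euclidean_space] by metis
  qed
  ultimately have "compactin (powertop_real UNIV) ?S" by (rule closed_compactin)
  moreover have "?S \<subseteq> {x. \<forall>i\<ge>d. x i = 0}" by (auto simp: topspace_Euclidean_space)
  ultimately show ?thesis
    using compactin_subtopology[of "powertop_real UNIV" "{x. \<forall>i\<ge>d. x i = 0}" ?S, folded Euclidean_space_def]
    by blast
qed

text \<open>The bump vanishes off the image of a compact ball under the inverse chart. That image is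
  closed because \<open>M\<close> is Hausdorff, so the bump and its products with the chart
  coordinates extend by zero.\<close>

lemma manifold_bump:
  assumes M: "Hausdorff_space M" and V: "openin M V"
    and hg: "homeomorphic_maps (subtopology M V) (Euclidean_space d) h g"
    and R: "R > 0"
  defines "bump \<equiv> (\<lambda>x. if x \<in> V then max 0 (R - (\<Sum>k<d. \<bar>h x k\<bar>)) else 0)"
  shows "continuous_map M euclideanreal bump" "continuous_map M euclideanreal (\<lambda>x. bump x * h x k)"
proof -
  have h: "continuous_map (subtopology M V) (Euclidean_space d) h"
    and g: "continuous_map (Euclidean_space d) (subtopology M V) g"
    and gh: "\<And>x. x \<in> topspace M \<Longrightarrow> x \<in> V \<Longrightarrow> g (h x) = x"
    using hg by (auto simp: homeomorphic_maps_def)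
  have VM: "V \<subseteq> topspace M" using V openin_subset by blast
  let ?S = "{v \<in> topspace (Euclidean_space d). (\<Sum>k<d. \<bar>v k\<bar>) \<le> R}"
  let ?C = "g ` ?S"
  have "compactin (subtopology M V) ?C"
    by (rule image_compactin[OF compactin_Euclidean_l1_ball g])
  then have C: "closedin M ?C" "?C \<subseteq> V"
    using compactin_imp_closedin[OF M] by (auto simp: compactin_subtopology)
  have hc: "continuous_map (subtopology M V) euclideanreal (\<lambda>x. h x k)" for k
    by (rule continuous_map_Euclidean_coord[OF h])
  have \<psi>: "continuous_map (subtopology M V) euclideanreal (\<lambda>x. max 0 (R - (\<Sum>k<d. \<bar>h x k\<bar>)))"
    by (intro continuous_intros hc) auto
  have out: "max 0 (R - (\<Sum>k<d. \<bar>h x k\<bar>)) = 0" if "x \<in> V" "x \<notin> ?C" for x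
  proof -
    have "h x \<in> topspace (Euclidean_space d)"
      using continuous_map_image_subset_topspace[OF h] that VM by auto
    moreover have "x = g (h x)" using gh that VM by auto
    ultimately have "\<not> (\<Sum>k<d. \<bar>h x k\<bar>) \<le> R" using that by blast
    then show ?thesis by simp
  qed
  show "continuous_map M euclideanreal bump"
    unfolding bump_def by (rule continuous_map_extend_zero[OF V C \<psi> out])
  have "continuous_map M euclideanreal (\<lambda>x. if x \<in> V then max 0 (R - (\<Sum>k<d. \<bar>h x k\<bar>)) * h x k else 0)"
    by (rule continuous_map_extend_zero[OF V C]) (use out in \<open>auto intro!: continuous_map_real_mult \<psi> hc\<close>)
  moreover have "(\<lambda>x. if x \<in> V then max 0 (R - (\<Sum>k<d. \<bar>h x k\<bar>)) * h x k else 0) = (\<lambda>x. bump x * h x k)"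
    by (auto simp: bump_def)
  ultimately show "continuous_map M euclideanreal (\<lambda>x. bump x * h x k)" by simp
qed

text \<open>Each chart of a finite cover contributes \<open>d + 1\<close> coordinates to
  \<open>e\<close>: a bump and its products with the chart coordinates. Where the bump is positive,
  quotients recover the chart on an open subset of the ambient space. The retraction is enlarged by
  one chart at a time.\<close>

lemma closed_manifold_neighbourhood_retract:
  fixes M :: "'a topology"
  assumes "closed_connected_manifold d M"
  obtains e :: "'a \<Rightarrow> ambient" and U r where "continuous_map M euclidean e" "open U" "e ` topspace M \<subseteq> U"
    "continuous_map (top_of_set U) M r" "\<And>x. x \<in> topspace M \<Longrightarrow> r (e x) = x"
proof -
  have M: "Hausdorff_space M" "compact_space M"
    and chart: "\<And>x. x \<in> topspace M \<Longrightarrow> \<exists>V. openin M V \<and> x \<in> V \<and> subtopology M V homeomorphic_space Euclidean_space d"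
    using assms by (auto simp: closed_connected_manifold_def)
  have "\<forall>x\<in>topspace M. \<exists>V h g. openin M V \<and> x \<in> V \<and> homeomorphic_maps (subtopology M V) (Euclidean_space d) h g"
    using chart by (fastforce simp: homeomorphic_space_def)
  then obtain V h g where V: "\<And>x. x \<in> topspace M \<Longrightarrow> openin M (V x)" "\<And>x. x \<in> topspace M \<Longrightarrow> x \<in> V x"
    "\<And>x. x \<in> topspace M \<Longrightarrow> homeomorphic_maps (subtopology M (V x)) (Euclidean_space d) (h x) (g x)"
    by metis
  \<comment> \<open>The radius makes the bump of the chart at \<open>x\<close> equal to 1 at
    \<open>x\<close> itself.\<close>
  define R where "R x = 1 + (\<Sum>k<d. \<bar>h x x k\<bar>)" for x
  have R: "R x > 0" for x unfolding R_def by (simp add: add_pos_nonneg sum_nonneg)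
  define l where "l x y = (if y \<in> V x then max 0 (R x - (\<Sum>k<d. \<bar>h x y k\<bar>)) else 0)" for x y
  have l: "continuous_map M euclideanreal (l x)" "continuous_map M euclideanreal (\<lambda>y. l x y * h x y k)"
    if "x \<in> topspace M" for x k
    using manifold_bump[OF M(1) V(1)[OF that] V(3)[OF that] R] unfolding l_def[abs_def] by auto
  \<comment> \<open>Values strictly above 1/2 give an open cover; the corresponding sets
    \<open>C\<close> with the weak inequality are compact and still cover.\<close>
  define O' where "O' x = {y \<in> topspace M. l x y \<in> {1/2<..}}" for x
  have "openin M (O' x)" if "x \<in> topspace M" for x
    unfolding O'_def by (rule openin_continuous_map_preimage[OF l(1)[OF that]]) auto
  moreover have "x \<in> O' x" if "x \<in> topspace M" for x
    using that V(2) by (auto simp: O'_def l_def R_def)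
  ultimately have "\<exists>F. finite F \<and> F \<subseteq> topspace M \<and> topspace M \<subseteq> \<Union> (O' ` F)"
    using M(2) unfolding compact_space_alt
    by (smt (verit, ccfv_threshold) UN_iff finite_subset_image image_iff subset_iff)
  then obtain F where F: "finite F" "F \<subseteq> topspace M" "topspace M \<subseteq> \<Union> (O' ` F)" by blast
  obtain xs where xs: "set xs = F" using F(1) finite_list by blast
  let ?n = "length xs"
  have xsM: "xs ! i \<in> topspace M" if "i < ?n" for i using that xs F nth_mem by blast
  \<comment> \<open>Position \<open>i * (d + 1)\<close> holds the bump of chart \<open>i\<close>,
    and position \<open>i * (d + 1) + k + 1\<close> its product with chart coordinate
    \<open>k\<close>.\<close>
  define c where "c y j = l (xs ! (j div Suc d)) y * (if j mod Suc d = 0 then 1 else h (xs ! (j div Suc d)) y (j mod Suc d - 1))" for y j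
  define e where "e y = (\<Sum>j<?n * Suc d. c y j *\<^sub>R axis_vector j)" for y
  have e: "continuous_map M euclidean e"
    unfolding e_def
  proof (rule continuous_map_sum_axis_vector)
    fix j assume "j < ?n * Suc d"
    then have "j div Suc d < ?n" using less_mult_imp_div_less by blast
    from l[OF xsM[OF this]] show "continuous_map M euclideanreal (\<lambda>x. c x j)"
      unfolding c_def by (cases "j mod Suc d = 0") auto
  qed
  have idx: "i * Suc d + k < ?n * Suc d" if "i < ?n" "k \<le> d" for i k
  proof -
    have "Suc i * Suc d \<le> ?n * Suc d" using that by (intro mult_le_mono1) simp
    then show ?thesis using that by simp
  qed
  have e0: "apply_bcontfun (e y) (i * Suc d) = l (xs ! i) y" if "i < ?n" for i y
  proof -
    have "i * Suc d div Suc d = i" "i * Suc d mod Suc d = 0" by (simp_all only: nonzero_mult_div_cancel_right mod_mult_self2_is_0)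
    then show ?thesis
      using idx[OF that, of 0] unfolding e_def apply_sum_axis_vector c_def by (simp del: mult_Suc_right)
  qed
  have ek: "apply_bcontfun (e y) (i * Suc d + Suc k) = l (xs ! i) y * h (xs ! i) y k" if "i < ?n" "k < d" for i k y
  proof -
    have "(i * Suc d + Suc k) div Suc d = i" "(i * Suc d + Suc k) mod Suc d = Suc k"
      using that div_mult_self3[of "Suc d" i "Suc k"] mod_mult_self3[of i "Suc d" "Suc k"]
      by (simp_all only: div_less mod_less Suc_less_eq add_0_right nat.distinct(1) not_False_eq_True simp_thms)
    then show ?thesis
      using idx[OF that(1), of "Suc k"] that unfolding e_def apply_sum_axis_vector c_def by simp
  qed
  define C where "C i = {y \<in> topspace M. l (xs ! i) y \<in> {1/2..}}" for i
  have C: "compactin M (C i)" if "i < ?n" for i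
  proof -
    have "closedin M (C i)"
      unfolding C_def by (rule closedin_continuous_map_preimage[OF l(1)[OF xsM[OF that]]]) auto
    then show ?thesis using M(2) closedin_compact_space by blast
  qed
  have "\<exists>W r. open W \<and> e ` (\<Union>i<m. C i) \<subseteq> W \<and> continuous_map (top_of_set W) M r \<and>
      (\<forall>x\<in>topspace M. e x \<in> W \<longrightarrow> r (e x) = x)" if "m \<le> ?n" for m
    using that
  proof (induction m)
    case 0
    show ?case by (rule exI[of _ "{}"]) auto
  next
    case (Suc m)
    then obtain W r where W: "open W" "e ` (\<Union>i<m. C i) \<subseteq> W" "continuous_map (top_of_set W) M r"
      "\<And>x. x \<in> topspace M \<Longrightarrow> e x \<in> W \<Longrightarrow> r (e x) = x" by auto
    have m: "m < ?n" using Suc by simp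
    let ?x = "xs ! m"
    \<comment> \<open>The open set where the bump coordinate of chart \<open>m\<close> is positive;
      \<open>?f\<close> divides by it to recover the chart.\<close>
    let ?B = "{y::ambient. apply_bcontfun y (m * Suc d) > 0}"
    let ?f = "\<lambda>(y::ambient) k. if k < d then apply_bcontfun y (m * Suc d + Suc k) / apply_bcontfun y (m * Suc d) else 0"
    have B: "open ?B" by (intro open_Collect_less continuous_on_apply_ambient continuous_on_const)
    have f: "continuous_map (top_of_set ?B) (Euclidean_space d) ?f"
      unfolding continuous_map_componentwise_Euclidean_space continuous_map_iff_continuous
      by (auto intro!: continuous_on_divide continuous_on_apply_ambient)
    have fe: "x \<in> V ?x \<and> ?f (e x) = h ?x x" if x: "x \<in> topspace M" "e x \<in> ?B" for x
    proof -
      have lp: "l ?x x > 0" using x e0[OF m] by simp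
      then have xV: "x \<in> V ?x" by (auto simp: l_def split: if_splits)
      have "h ?x \<in> topspace (subtopology M (V ?x)) \<rightarrow> topspace (Euclidean_space d)"
        using V(3)[OF xsM[OF m]] by (simp add: homeomorphic_maps_def continuous_map_def)
      then have "h ?x x k = 0" if "k \<ge> d" for k
        using that x xV by (auto simp: topspace_Euclidean_space Pi_def)
      then show ?thesis using xV lp by (auto simp: e0[OF m] ek[OF m] fun_eq_iff simp del: mult_Suc_right add_Suc_right)
    qed
    have D: "compactin M (\<Union>i<m. C i)" using C m by (intro compactin_Union) auto
    obtain W' r' where W': "open W'" "e ` (\<Union>i<m. C i) \<subseteq> W'" "\<And>x. x \<in> topspace M \<Longrightarrow> e x \<in> ?B \<Longrightarrow> e x \<in> W'"
       "continuous_map (top_of_set W') M r'" "\<And>x. x \<in> topspace M \<Longrightarrow> e x \<in> W' \<Longrightarrow> r' (e x) = x"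
      using extend_retraction_over_chart[OF e D W V(1)[OF xsM[OF m]] V(3)[OF xsM[OF m]] B f fe] by blast
    have "e x \<in> W'" if "x \<in> C m" for x
      using that W'(3)[of x] e0[OF m, of x] by (auto simp: C_def)
    moreover have "(\<Union>i<Suc m. C i) = (\<Union>i<m. C i) \<union> C m" by (auto simp: less_Suc_eq)
    ultimately have sub: "e ` (\<Union>i<Suc m. C i) \<subseteq> W'" using W'(2) by blast
    show ?case
    proof (intro exI conjI ballI impI)
      show "r' (e x) = x" if "x \<in> topspace M" "e x \<in> W'" for x by (rule W'(5)[OF that])
    qed (fact W'(1) sub W'(4))+
  qed
  from this[of ?n] obtain W r where W: "open W" "e ` (\<Union>i<?n. C i) \<subseteq> W" "continuous_map (top_of_set W) M r"
      "\<And>x. x \<in> topspace M \<Longrightarrow> e x \<in> W \<Longrightarrow> r (e x) = x" by auto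
  have "topspace M \<subseteq> (\<Union>i<?n. C i)"
  proof
    fix y assume y: "y \<in> topspace M"
    then obtain x where "x \<in> set xs" "y \<in> O' x" using F(3) xs by blast
    then obtain i where "i < ?n" "xs ! i = x" by (auto simp: in_set_conv_nth)
    then show "y \<in> (\<Union>i<?n. C i)"
      using \<open>y \<in> O' x\<close> by (intro UN_I[of i]) (auto simp: O'_def C_def)
  qed
  then have "e ` topspace M \<subseteq> W" using W(2) by blast
  then show ?thesis using that[OF e W(1) _ W(3)] W(4) by blast
qed

subsection \<open>Flag complexes\<close>

text \<open>Barycentric coordinates on the complex whose simplices are the cliques of
  \<open>A\<close>. The case \<open>i = j\<close> requires \<open>A i i\<close> of every vertex in
  use.\<close>

definition flag_complex :: "nat \<Rightarrow> (nat \<Rightarrow> nat \<Rightarrow> bool) \<Rightarrow> (nat \<Rightarrow> real) set" where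
  "flag_complex m A = {y. (\<forall>i. 0 \<le> y i) \<and> (\<forall>i\<ge>m. y i = 0) \<and> (\<Sum>i<m. y i) = 1 \<and>
     (\<forall>i j. 0 < y i \<longrightarrow> 0 < y j \<longrightarrow> A i j)}"

lemma convex_combination_in_ball:
  fixes p :: "nat \<Rightarrow> 'a::real_normed_vector"
  assumes "\<And>i. 0 \<le> y i" "(\<Sum>i<m. y i) = 1" "\<And>i. i < m \<Longrightarrow> 0 < y i \<Longrightarrow> p i \<in> ball c \<epsilon>"
  shows "(\<Sum>i<m. y i *\<^sub>R p i) \<in> ball c \<epsilon>"
proof -
  let ?I = "{i. i < m \<and> 0 < y i}"
  have eq: "(\<Sum>i<m. y i *\<^sub>R p i) = (\<Sum>i\<in>?I. y i *\<^sub>R p i)" "(\<Sum>i<m. y i) = (\<Sum>i\<in>?I. y i)"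
    using assms(1) by (intro sum.mono_neutral_right; force simp: less_eq_real_def)+
  show ?thesis
    unfolding eq(1) using assms eq(2) by (intro convex_sum convex_ball) auto
qed

text \<open>The vertices are a finite net of the embedded space. \<open>\<phi>\<close> is a
  partition of unity and \<open>\<Psi>\<close> sends vertices affinely to net points. Vertices of a
  clique are so close that the affine image stays in \<open>U\<close>, and the segment from
  \<open>\<Psi> (\<phi> x)\<close> to \<open>e x\<close>, retracted by \<open>r\<close>, is the
  homotopy.\<close>

lemma dominated_by_flag_complex:
  fixes M :: "'a topology" and e :: "'a \<Rightarrow> 'b::real_normed_vector"
  assumes M: "compact_space M" "topspace M \<noteq> {}" and e: "continuous_map M euclidean e"
    and U: "open U" "e ` topspace M \<subseteq> U" and r: "continuous_map (top_of_set U) M r"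
    and re: "\<And>x. x \<in> topspace M \<Longrightarrow> r (e x) = x"
  obtains m A \<phi> G where "m > 0" "\<And>i j. A i j \<Longrightarrow> i < m \<and> j < m"
    "continuous_map M (top_of_set (flag_complex m A)) \<phi>"
    "continuous_map (top_of_set (flag_complex m A)) M G"
    "homotopic_with (\<lambda>_. True) M M (G \<circ> \<phi>) id"
proof -
  define K where "K = e ` topspace M"
  have "compactin euclidean K"
    unfolding K_def using image_compactin[OF _ e] M(1) compact_space_def by blast
  then have K: "compact K" "K \<noteq> {}" "K \<subseteq> U" using M(2) U(2) by (auto simp: K_def)
  obtain \<epsilon>' where \<epsilon>': "\<epsilon>' > 0" "(\<Union>x\<in>K. ball x \<epsilon>') \<subseteq> U"
    using compact_subset_open_imp_ball_epsilon_subset[OF K(1) U(1) K(3)] by metis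
  \<comment> \<open>Half the radius: two net points close to a common point are then
    adjacent.\<close>
  define \<epsilon> where "\<epsilon> = \<epsilon>' / 2"
  have \<epsilon>: "\<epsilon> > 0" "2 * \<epsilon> = \<epsilon>'" using \<epsilon>' by (auto simp: \<epsilon>_def)
  obtain F where F: "finite F" "F \<subseteq> K" "K \<subseteq> (\<Union>x\<in>F. ball x \<epsilon>)"
    using compactE_image[OF K(1), of K "\<lambda>x. ball x \<epsilon>"] \<epsilon>(1) by (metis UN_I centre_in_ball open_ball subsetI)
  obtain ps where ps: "set ps = F" using F(1) finite_list by blast
  define p where "p i = ps ! i" for i
  define m where "m = length ps"
  have pK: "p i \<in> K" if "i < m" for i using that ps F by (auto simp: p_def m_def)
  have net: "\<exists>i<m. dist x (p i) < \<epsilon>" if "x \<in> K" for x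
  proof -
    obtain q where "q \<in> set ps" "dist q x < \<epsilon>" using F(3) \<open>x \<in> K\<close> ps by auto
    then show ?thesis by (metis dist_commute in_set_conv_nth m_def p_def)
  qed
  have m: "m > 0" using net K(2) by fastforce
  define A where "A i j \<longleftrightarrow> i < m \<and> j < m \<and> dist (p i) (p j) < \<epsilon>'" for i j
  let ?X = "flag_complex m A"
  define w where "w x i = max 0 (\<epsilon> - dist (e x) (p i))" for x i
  define \<phi> where "\<phi> x = (\<lambda>i. if i < m then w x i / (\<Sum>j<m. w x j) else 0)" for x
  have wpos: "(\<Sum>j<m. w x j) > 0" if "x \<in> topspace M" for x
  proof -
    obtain i where "i < m" "dist (e x) (p i) < \<epsilon>" using net[of "e x"] \<open>x \<in> topspace M\<close> by (auto simp: K_def)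
    then show ?thesis by (intro sum_pos2[of _ i]) (auto simp: w_def)
  qed
  have \<phi>near: "dist (e x) (p i) < \<epsilon>" if "i < m" "\<phi> x i > 0" for x i
  proof (rule ccontr)
    assume "\<not> ?thesis"
    then have "w x i = 0" by (simp add: w_def)
    then show False using that by (simp add: \<phi>_def)
  qed
  have \<phi>0: "\<phi> x i \<ge> 0" for x i by (auto simp: \<phi>_def w_def intro!: divide_nonneg_nonneg sum_nonneg)
  have \<phi>1: "(\<Sum>i<m. \<phi> x i) = 1" if "x \<in> topspace M" for x
    using wpos[OF that] by (simp add: \<phi>_def flip: sum_divide_distrib)
  have \<phi>X: "\<phi> x \<in> ?X" if x: "x \<in> topspace M" for x
  proof -
    have "A i j" if "0 < \<phi> x i" "0 < \<phi> x j" for i j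
    proof -
      have ij: "i < m" "j < m" using that by (auto simp: \<phi>_def split: if_splits)
      have "dist (p i) (p j) \<le> dist (e x) (p i) + dist (e x) (p j)" by (rule dist_triangle3)
      then show ?thesis using \<phi>near[OF ij(1) that(1)] \<phi>near[OF ij(2) that(2)] ij \<epsilon> by (simp add: A_def)
    qed
    then show ?thesis using \<phi>0 \<phi>1[OF x] by (auto simp: flag_complex_def) (simp add: \<phi>_def)
  qed
  have wc: "continuous_map M euclideanreal (\<lambda>x. w x i)" for i
  proof -
    have "continuous_map euclidean euclideanreal (\<lambda>y. max 0 (\<epsilon> - dist y (p i)))"
      by (simp add: continuous_map_iff_continuous2) (intro continuous_intros)
    from continuous_map_compose[OF e this] show ?thesis by (simp add: o_def w_def)
  qed
  have wne: "(\<Sum>j<m. w x j) \<noteq> 0" if "x \<in> topspace M" for x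
    using wpos[OF that] by simp
  have "continuous_map M euclideanreal (\<lambda>x. w x i / (\<Sum>j<m. w x j))" for i
    by (intro continuous_map_real_divide continuous_map_sum wc wne) auto
  then have "continuous_map M euclideanreal (\<lambda>x. \<phi> x i)" for i
    unfolding \<phi>_def by (cases "i < m") auto
  then have "continuous_map M euclidean \<phi>"
    by (simp add: continuous_map_componentwise_UNIV flip: euclidean_product_topology)
  then have \<phi>c: "continuous_map M (top_of_set ?X) \<phi>"
    using \<phi>X by (auto simp: continuous_map_in_subtopology)
  define \<Psi> where "\<Psi> y = (\<Sum>i<m. y i *\<^sub>R p i)" for y :: "nat \<Rightarrow> real"
  have \<Psi>c: "continuous_on S \<Psi>" for S
    unfolding \<Psi>_def by (intro continuous_on_sum continuous_on_scaleR continuous_on_const)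
      (auto intro: continuous_on_subset[OF continuous_on_product_coordinates])
  have \<Psi>U: "\<Psi> y \<in> U" if "y \<in> ?X" for y
  proof -
    have y: "\<And>i. 0 \<le> y i" "(\<Sum>i<m. y i) = 1" "\<And>i j. 0 < y i \<Longrightarrow> 0 < y j \<Longrightarrow> A i j"
      using that by (auto simp: flag_complex_def)
    obtain i where i: "i < m" "y i > 0"
      using y(1,2) by (metis lessThan_iff less_eq_real_def sum.neutral zero_neq_one)
    \<comment> \<open>Any vertex of the support serves as centre, since all others are adjacent to
      it.\<close>
    have "\<Psi> y \<in> ball (p i) \<epsilon>'"
      unfolding \<Psi>_def
      by (rule convex_combination_in_ball) (use y i in \<open>auto simp: A_def\<close>)
    then show ?thesis using \<epsilon>'(2) pK[OF i(1)] by blast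
  qed
  define G where "G y = r (\<Psi> y)" for y
  have "continuous_map (top_of_set ?X) (top_of_set U) \<Psi>"
    using \<Psi>c \<Psi>U by (auto simp: continuous_map_in_subtopology continuous_map_iff_continuous)
  from continuous_map_compose[OF this r] have Gc: "continuous_map (top_of_set ?X) M G"
    by (simp add: o_def G_def[abs_def])
  have "homotopic_with (\<lambda>_. True) M M (G \<circ> \<phi>) id"
  proof (subst homotopic_with, simp, intro exI conjI ballI)
    let ?h = "\<lambda>(t::real, x). (1 - t) *\<^sub>R \<Psi> (\<phi> x) + t *\<^sub>R e x"
    let ?P = "prod_topology (top_of_set {0..1::real}) M"
    have t: "continuous_map ?P euclideanreal fst"
      using continuous_map_fst[of "top_of_set {0..1::real}" M] by (simp add: continuous_map_in_subtopology)
    have x: "continuous_map ?P euclidean (\<lambda>z. e (snd z))"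
      using continuous_map_compose[OF continuous_map_snd e] by (simp add: o_def)
    have "continuous_map M euclidean (\<lambda>x. \<Psi> (\<phi> x))"
      using continuous_map_compose[OF \<open>continuous_map M euclidean \<phi>\<close>, of euclidean \<Psi>] \<Psi>c
      by (simp add: o_def continuous_map_iff_continuous2)
    from continuous_map_compose[OF continuous_map_snd this]
    have y: "continuous_map ?P euclidean (\<lambda>z. \<Psi> (\<phi> (snd z)))"
      by (simp add: o_def)
    have tri: "continuous_map ?P (prod_topology euclidean (prod_topology euclidean euclidean)) (\<lambda>z. (fst z, \<Psi> (\<phi> (snd z)), e (snd z)))"
      by (intro continuous_map_pairedI t x y)
    have "continuous_on UNIV (\<lambda>z::real \<times> 'b \<times> 'b. (1 - fst z) *\<^sub>R fst (snd z) + fst z *\<^sub>R snd (snd z))"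
      by (intro continuous_intros)
    then have "continuous_map (prod_topology euclidean (prod_topology euclidean euclidean)) euclidean
       (\<lambda>z::real \<times> 'b \<times> 'b. (1 - fst z) *\<^sub>R fst (snd z) + fst z *\<^sub>R snd (snd z))"
      by (simp add: continuous_map_iff_continuous2)
    from continuous_map_compose[OF tri this] have hc: "continuous_map ?P euclidean ?h"
      by (simp add: o_def case_prod_unfold)
    have "?h z \<in> U" if "z \<in> topspace ?P" for z
    proof -
      obtain t x where zeq: "z = (t, x)" by (cases z)
      with that have z: "z = (t, x)" "t \<in> {0..1}" "x \<in> topspace M" by simp_all
      \<comment> \<open>Only net points near \<open>e x\<close> have positive weight, so one convex
        ball inside \<open>U\<close> contains the whole segment.\<close>
      have "\<Psi> (\<phi> x) \<in> ball (e x) \<epsilon>'"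
        unfolding \<Psi>_def
        by (rule convex_combination_in_ball) (use \<phi>0 \<phi>1 z \<phi>near \<epsilon> in \<open>force+\<close>)
      moreover have "e x \<in> ball (e x) \<epsilon>'" using \<epsilon>'(1) by simp
      ultimately have "?h z \<in> ball (e x) \<epsilon>'"
        unfolding z using z(2) convex_ball[of "e x" \<epsilon>'] by (simp add: convex_alt)
      moreover have "e x \<in> K" using z(3) by (simp add: K_def)
      ultimately show ?thesis using \<epsilon>'(2) by blast
    qed
    then have "continuous_map ?P (top_of_set U) ?h"
      using hc by (auto simp: continuous_map_in_subtopology)
    from continuous_map_compose[OF this r] show "continuous_map ?P M (\<lambda>z. r (?h z))"
      by (simp add: o_def)
  qed (auto simp: G_def re)
  then show ?thesis using that[OF m _ \<phi>c Gc] by (auto simp: A_def)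
qed

subsection \<open>Tables and their realizations\<close>

text \<open>A table of level \<open>n\<close> assigns vertices to the lattice points \<open>k\<close> of the \<open>n\<close>-fold
  dilated simplex.  The point \<open>t\<close> of the simplex is rounded to a lattice point by adding a
  common shift \<open>u \<in> [0, 1)\<close> to all partial sums of \<open>n t\<close> and truncating; averaging over \<open>u\<close>
  gives a continuous extension of the table that is compatible with faces.\<close>

definition lattice :: "nat \<Rightarrow> nat \<Rightarrow> (nat \<Rightarrow> nat) set" where
  "lattice p n = {k. (\<forall>i>p. k i = 0) \<and> (\<Sum>i\<le>p. k i) = n}"

text \<open>The relation between two roundings of one point under different shifts: every partial
  sum changes by at most one.\<close>

definition neighbours :: "(nat \<Rightarrow> nat) \<Rightarrow> (nat \<Rightarrow> nat) \<Rightarrow> bool" where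
  "neighbours k k' \<longleftrightarrow> (\<forall>j. sum k {..<j} \<le> sum k' {..<j} + 1 \<and> sum k' {..<j} \<le> sum k {..<j} + 1)"

text \<open>The finite condition that makes the realization land in the flag complex. Because a
  point is a neighbour of itself, it also bounds the vertices used.\<close>

definition admissible :: "(nat \<Rightarrow> nat \<Rightarrow> bool) \<Rightarrow> nat \<Rightarrow> nat \<Rightarrow> ((nat \<Rightarrow> nat) \<Rightarrow> nat) \<Rightarrow> bool" where
  "admissible A p n f \<longleftrightarrow> (\<forall>k\<in>lattice p n. \<forall>k'\<in>lattice p n. neighbours k k' \<longrightarrow> A (f k) (f k'))"

definition shift_round :: "nat \<Rightarrow> (nat \<Rightarrow> real) \<Rightarrow> real \<Rightarrow> nat \<Rightarrow> nat" where
  "shift_round n t u i = nat (\<lfloor>real n * sum t {..<Suc i} + u\<rfloor> - \<lfloor>real n * sum t {..<i} + u\<rfloor>)"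

definition level_set :: "nat \<Rightarrow> ((nat \<Rightarrow> nat) \<Rightarrow> nat) \<Rightarrow> (nat \<Rightarrow> real) \<Rightarrow> nat \<Rightarrow> real set" where
  "level_set n f t i = {u \<in> {0..<1}. f (shift_round n t u) = i}"

definition realize :: "nat \<Rightarrow> nat \<Rightarrow> ((nat \<Rightarrow> nat) \<Rightarrow> nat) \<Rightarrow> (nat \<Rightarrow> real) \<Rightarrow> nat \<Rightarrow> real" where
  "realize p n f = restrict (\<lambda>t i. measure lborel (level_set n f t i)) (standard_simplex p)"

lemma finite_lattice: "finite (lattice p n)"
proof -
  have "k i \<le> n" if "k \<in> lattice p n" for k i
    using that member_le_sum[of i "{..p}" k] by (cases "i \<le> p") (auto simp: lattice_def)
  then have "lattice p n \<subseteq> {k. \<forall>i. (i \<in> {..p} \<longrightarrow> k i \<in> {..n}) \<and> (i \<notin> {..p} \<longrightarrow> k i = 0)}"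
    by (auto simp: lattice_def)
  then show ?thesis
    using finite_set_of_finite_funs[of "{..p}" "{..n}" 0] finite_subset by blast
qed

lemma neighbours_refl [simp]: "neighbours k k"
  by (simp add: neighbours_def)

text \<open>Inserting a zero merely repeats one partial sum. A rounding that treats each partial sum
  separately therefore commutes with faces.\<close>

lemma sum_simplical_face:
  fixes x :: "nat \<Rightarrow> 'a::comm_monoid_add"
  shows "sum (simplical_face k x) {..<j} = (if j \<le> k then sum x {..<j} else sum x {..<j - 1})"
proof (induction j)
  case (Suc j)
  then show ?case
    by (cases "j < k"; cases "j = k"; cases j) (auto simp: simplical_face_def)
qed simp

lemma simplical_face_lattice:
  assumes "x \<in> lattice p n" "k \<le> Suc p"
  shows "simplical_face k x \<in> lattice (Suc p) n"
proof -
  have "sum (simplical_face k x) {..<Suc (Suc p)} = sum x {..<Suc p}"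
    using assms(2) by (simp add: sum_simplical_face del: sum.lessThan_Suc)
  then show ?thesis
    using assms by (auto simp: lattice_def simplical_face_def lessThan_Suc_atMost)
qed

lemma simplex_sum_mono:
  assumes "t \<in> standard_simplex p" "i \<le> j" shows "sum t {..<i} \<le> sum t {..<j}"
  using assms by (intro sum_mono2) (auto simp: standard_simplex_def)

lemma simplex_sum_eq_1:
  assumes "t \<in> standard_simplex p" "p < j" shows "sum t {..<j} = 1"
proof -
  have "sum t {..<j} = sum t {..p}"
    using assms by (intro sum.mono_neutral_right) (auto simp: standard_simplex_def)
  then show ?thesis using assms by (simp add: standard_simplex_def)
qed

text \<open>The differences of floors telescope, starting from 0 because the shift is in [0, 1).
  Monotonicity of the partial sums ensures that conversion to naturals loses nothing.\<close>

lemma sum_shift_round: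
  assumes t: "t \<in> standard_simplex p" and u: "0 \<le> u" "u < 1"
  shows "int (sum (shift_round n t u) {..<j}) = \<lfloor>real n * sum t {..<j} + u\<rfloor>"
proof (induction j)
  case 0
  show ?case using u by (simp add: floor_eq_iff)
next
  case (Suc j)
  have "real n * sum t {..<j} \<le> real n * sum t {..<Suc j}"
    using simplex_sum_mono[OF t, of j "Suc j"] by (intro mult_left_mono) auto
  then have "\<lfloor>real n * sum t {..<j} + u\<rfloor> \<le> \<lfloor>real n * sum t {..<Suc j} + u\<rfloor>"
    by (intro floor_mono) simp
  then show ?case using Suc unfolding sum.lessThan_Suc[of "shift_round n t u"] by (simp add: shift_round_def)
qed

lemma shift_round_lattice:
  assumes t: "t \<in> standard_simplex p" and u: "0 \<le> u" "u < 1"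
  shows "shift_round n t u \<in> lattice p n"
proof -
  have "shift_round n t u i = 0" if "i > p" for i
    using simplex_sum_eq_1[OF t that] simplex_sum_eq_1[OF t, of "Suc i"] that
    unfolding shift_round_def by (simp del: sum.lessThan_Suc)
  moreover
  have "int (sum (shift_round n t u) {..<Suc p}) = int n"
    unfolding sum_shift_round[OF assms] simplex_sum_eq_1[OF t lessI] using u by (simp add: floor_eq_iff)
  then have "sum (shift_round n t u) {..<Suc p} = n" by (simp only: of_nat_eq_iff)
  ultimately show ?thesis by (simp add: lattice_def lessThan_Suc_atMost)
qed

lemma shift_round_neighbours:
  assumes "t \<in> standard_simplex p" "0 \<le> u" "u < 1" "0 \<le> v" "v < 1"
  shows "neighbours (shift_round n t u) (shift_round n t v)"
proof -
  have "\<lfloor>x + u\<rfloor> \<le> \<lfloor>x + v\<rfloor> + 1" "\<lfloor>x + v\<rfloor> \<le> \<lfloor>x + u\<rfloor> + 1" for x :: real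
    using assms(2-5) by linarith+
  note this[of "real n * sum t {..<j}" for j]
  then have "int (sum (shift_round n t u) {..<j}) \<le> int (sum (shift_round n t v) {..<j} + 1)"
       "int (sum (shift_round n t v) {..<j}) \<le> int (sum (shift_round n t u) {..<j} + 1)" for j
    unfolding of_nat_add sum_shift_round[OF assms(1-3)] sum_shift_round[OF assms(1,4,5)] by simp_all
  then show ?thesis unfolding neighbours_def using of_nat_le_iff by blast
qed

lemma shift_round_face:
  "shift_round n (simplical_face k t) u = simplical_face k (shift_round n t u)"
proof
  fix i
  show "shift_round n (simplical_face k t) u i = simplical_face k (shift_round n t u) i"
    unfolding shift_round_def sum_simplical_face
    by (cases "i < k"; cases "i = k"; cases i) (auto simp: simplical_face_def shift_round_def simp del: sum.lessThan_Suc)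
qed

lemma sets_shift_round: "{u \<in> {0..<1}. shift_round n t u = k} \<in> sets borel" if "t \<in> standard_simplex p"
proof -
  have z: "shift_round n t u i = 0" if "i > p" "0 \<le> u" "u < 1" for u i
    using shift_round_lattice[OF \<open>t \<in> standard_simplex p\<close> that(2,3)] that(1) by (simp add: lattice_def)
  have m: "{u. shift_round n t u i = k i} \<in> sets borel" for i
    unfolding shift_round_def by measurable
  show ?thesis
  proof (cases "\<forall>i>p. k i = 0")
    case True
    have "shift_round n t u = k" if "0 \<le> u" "u < 1" "\<forall>i\<le>p. shift_round n t u i = k i" for u
    proof
      fix i show "shift_round n t u i = k i"
        by (cases "i \<le> p") (use that z[of i u] True in auto)
    qed
    then have "{u \<in> {0..<1}. shift_round n t u = k} = {0..<1} \<inter> (\<Inter>i\<in>{..p}. {u. shift_round n t u i = k i})"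
      by auto
    also have "\<dots> \<in> sets borel" by (intro sets.Int sets.finite_INT m) auto
    finally show ?thesis .
  next
    case False
    then obtain i where "i > p" "k i \<noteq> 0" by blast
    then have "{u \<in> {0..<1}. shift_round n t u = k} = {}" using z[of i] by fastforce
    then show ?thesis by (simp only: sets.empty_sets)
  qed
qed

lemma sets_level_set:
  assumes "t \<in> standard_simplex p" shows "level_set n f t i \<in> sets borel"
proof -
  have "level_set n f t i = (\<Union>k\<in>{k \<in> lattice p n. f k = i}. {u \<in> {0..<1}. shift_round n t u = k})"
    using shift_round_lattice[OF assms] by (auto simp: level_set_def)
  then show ?thesis
    using sets_shift_round[OF assms] finite_lattice[of p n] by (auto intro!: sets.finite_UN)
qed

lemma emeasure_unit_subset:
  assumes "S \<subseteq> {0..<1::real}" "S \<in> sets borel" shows "emeasure lborel S \<noteq> \<infinity>"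
proof -
  have "emeasure lborel S \<le> emeasure lborel {0..<1::real}"
    using assms by (intro emeasure_mono) auto
  also have "\<dots> < \<infinity>" by simp
  finally show ?thesis by auto
qed

text \<open>The level sets partition [0, 1), which gives total weight 1. Two vertices of positive
  weight come from two roundings of the same \<open>t\<close>; these are neighbours, so
  admissibility supplies the edge.\<close>

lemma realize_simplex:
  assumes A: "\<And>i j. A i j \<Longrightarrow> i < m \<and> j < m" and f: "admissible A p n f" and t: "t \<in> standard_simplex p"
  shows "realize p n f t \<in> flag_complex m A"
proof -
  let ?L = "level_set n f t"
  have R: "realize p n f t = (\<lambda>i. measure lborel (?L i))" using t by (simp add: realize_def)
  have Am: "f (shift_round n t u) < m" if "0 \<le> u" "u < 1" for u
    using f shift_round_lattice[OF t that] neighbours_refl A unfolding admissible_def by blast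
  have s: "?L i \<in> sets borel" for i using sets_level_set[OF t] .
  have L01: "?L i \<subseteq> {0..<1}" for i by (auto simp: level_set_def)
  have "measure lborel (?L i) = 0" if "i \<ge> m" for i
  proof -
    have "?L i = {}" using Am that by (fastforce simp: level_set_def)
    then show ?thesis by simp
  qed
  moreover have "(\<Sum>i<m. measure lborel (?L i)) = 1"
  proof -
    have "(\<Union>i\<in>{..<m}. ?L i) = {0..<1}" using Am by (auto simp: level_set_def)
    moreover have "measure lborel (\<Union>i\<in>{..<m}. ?L i) = (\<Sum>i\<in>{..<m}. measure lborel (?L i))"
      by (rule measure_finite_Union)
         (use s emeasure_unit_subset[OF L01 s] in \<open>auto simp: disjoint_family_on_def level_set_def\<close>)
    ultimately show ?thesis by simp
  qed
  moreover have "A i j" if "0 < measure lborel (?L i)" "0 < measure lborel (?L j)" for i j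
  proof -
    have "?L i \<noteq> {}" "?L j \<noteq> {}" using that by auto
    then obtain u v where "u \<in> ?L i" "v \<in> ?L j" by blast
    then have uv: "0 \<le> u" "u < 1" "0 \<le> v" "v < 1" "f (shift_round n t u) = i" "f (shift_round n t v) = j"
      by (auto simp: level_set_def)
    show ?thesis
      using f shift_round_neighbours[OF t uv(1-4), of n] shift_round_lattice[OF t] uv
      unfolding admissible_def by blast
  qed
  ultimately show ?thesis unfolding R flag_complex_def by (auto simp: zero_less_measure_iff)
qed

text \<open>The floors differ only if an integer is crossed between \<open>a + u\<close> and
  \<open>b + u\<close>. For distance below 1, at most two integers are candidates as
  \<open>u\<close> runs through [0, 1), each for a set of shifts of length at most the distance;
  otherwise the bound is trivial.\<close>

lemma measure_floor_ne:
  fixes a b :: real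
  shows "{u \<in> {0..<1}. \<lfloor>a + u\<rfloor> \<noteq> \<lfloor>b + u\<rfloor>} \<in> sets borel"
    and "measure lborel {u \<in> {0..<1}. \<lfloor>a + u\<rfloor> \<noteq> \<lfloor>b + u\<rfloor>} \<le> 2 * \<bar>a - b\<bar>"
proof -
  have s: "{u \<in> {0..<1}. \<lfloor>a + u\<rfloor> \<noteq> \<lfloor>b + u\<rfloor>} \<in> sets borel" for a b :: real by measurable
  then show "{u \<in> {0..<1}. \<lfloor>a + u\<rfloor> \<noteq> \<lfloor>b + u\<rfloor>} \<in> sets borel" .
  have le: "measure lborel {u \<in> {0..<1}. \<lfloor>a + u\<rfloor> \<noteq> \<lfloor>b + u\<rfloor>} \<le> 2 * (b - a)" if "a \<le> b" for a b :: real
  proof (cases "b - a < 1")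
    case True
    \<comment> \<open>The first integer above \<open>a\<close>; only \<open>k\<close> and
      \<open>k + 1\<close> can be crossed.\<close>
    define k where "k = real_of_int (\<lfloor>a\<rfloor> + 1)"
    have k: "a < k" "k \<le> a + 1" unfolding k_def by linarith+
    have "{u \<in> {0..<1}. \<lfloor>a + u\<rfloor> \<noteq> \<lfloor>b + u\<rfloor>} \<subseteq> {k - b..k - a} \<union> {k + 1 - b..k + 1 - a}"
    proof
      fix u assume u: "u \<in> {u \<in> {0..<1}. \<lfloor>a + u\<rfloor> \<noteq> \<lfloor>b + u\<rfloor>}"
      define l where "l = \<lfloor>b + u\<rfloor>"
      have l: "a + u < real_of_int l" "real_of_int l \<le> b + u"
        using u \<open>a \<le> b\<close> unfolding l_def by (auto simp: not_less[symmetric] le_floor_iff) (metis floor_mono add_right_mono le_floor_iff not_less order_antisym of_int_floor_le)+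
      then have "real_of_int \<lfloor>a\<rfloor> < real_of_int l" "real_of_int l < real_of_int \<lfloor>a\<rfloor> + 3"
        using u True by auto linarith+
      then have "l = \<lfloor>a\<rfloor> + 1 \<or> l = \<lfloor>a\<rfloor> + 2" by linarith
      then show "u \<in> {k - b..k - a} \<union> {k + 1 - b..k + 1 - a}"
        using l by (auto simp: k_def)
    qed
    then have "measure lborel {u \<in> {0..<1}. \<lfloor>a + u\<rfloor> \<noteq> \<lfloor>b + u\<rfloor>} \<le> measure lborel ({k - b..k - a} \<union> {k + 1 - b..k + 1 - a})"
      by (rule measure_mono_fmeasurable[OF _ _ fmeasurable.Un]) (use s in \<open>auto intro!: fmeasurableI simp: emeasure_lborel_Icc_eq\<close>)
    also have "\<dots> \<le> measure lborel {k - b..k - a} + measure lborel {k + 1 - b..k + 1 - a}"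
      by (rule measure_Un_le) auto
    also have "\<dots> = 2 * (b - a)" using \<open>a \<le> b\<close> by simp
    finally show ?thesis .
  next
    case False
    have "measure lborel {u \<in> {0..<1}. \<lfloor>a + u\<rfloor> \<noteq> \<lfloor>b + u\<rfloor>} \<le> measure lborel {0..<1::real}"
      by (rule measure_mono_fmeasurable) (use s in \<open>auto intro!: fmeasurableI\<close>)
    then show ?thesis using False by simp
  qed
  show "measure lborel {u \<in> {0..<1}. \<lfloor>a + u\<rfloor> \<noteq> \<lfloor>b + u\<rfloor>} \<le> 2 * \<bar>a - b\<bar>"
    using le[of a b] le[of b a] by (cases "a \<le> b") (auto simp: eq_commute)
qed

text \<open>Shifts outside all \<open>D j\<close> round both points identically, whatever the table.
  The barycentric coordinates therefore vary continuously with the partial sums, although each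
  single rounding jumps.\<close>

lemma level_set_diff:
  assumes t: "t \<in> standard_simplex p" "t' \<in> standard_simplex p"
  shows "measure lborel (level_set n f t i) \<le> measure lborel (level_set n f t' i) +
    (\<Sum>j\<le>Suc p. 2 * (real n * \<bar>sum t {..<j} - sum t' {..<j}\<bar>))"
proof -
  define D where "D j = {u \<in> {0..<1}. \<lfloor>real n * sum t {..<j} + u\<rfloor> \<noteq> \<lfloor>real n * sum t' {..<j} + u\<rfloor>}" for j
  have D: "D j \<in> sets borel" "measure lborel (D j) \<le> 2 * (real n * \<bar>sum t {..<j} - sum t' {..<j}\<bar>)" for j
    using measure_floor_ne[of "real n * sum t {..<j}" "real n * sum t' {..<j}"] unfolding D_def
    by (simp_all add: abs_mult flip: right_diff_distrib)
  have fm: "S \<in> fmeasurable lborel" if "S \<subseteq> {0..<1}" "S \<in> sets borel" for S :: "real set"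
    using emeasure_unit_subset[OF that] that by (intro fmeasurableI) (auto simp: less_top)
  have fD: "D j \<in> fmeasurable lborel" for j by (rule fm[OF _ D(1)]) (auto simp: D_def)
  have fL: "level_set n f t i \<in> fmeasurable lborel" "level_set n f t' i \<in> fmeasurable lborel"
    by (rule fm[OF _ sets_level_set[OF t(1)]] fm[OF _ sets_level_set[OF t(2)]]; auto simp: level_set_def)+
  have fU: "(\<Union>j\<le>Suc p. D j) \<in> fmeasurable lborel"
    by (intro fmeasurable.finite_UN) (auto simp: fD)
  have "level_set n f t i \<subseteq> level_set n f t' i \<union> (\<Union>j\<le>Suc p. D j)"
  proof
    fix u assume u: "u \<in> level_set n f t i"
    then have u01: "0 \<le> u" "u < 1" by (auto simp: level_set_def)
    show "u \<in> level_set n f t' i \<union> (\<Union>j\<le>Suc p. D j)"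
    proof (cases "u \<in> (\<Union>j\<le>Suc p. D j)")
      case False
      then have eq: "\<lfloor>real n * sum t {..<j} + u\<rfloor> = \<lfloor>real n * sum t' {..<j} + u\<rfloor>" if "j \<le> Suc p" for j
        using u01 that by (auto simp: D_def)
      have "shift_round n t u = shift_round n t' u"
      proof
        fix j show "shift_round n t u j = shift_round n t' u j"
        proof (cases "j \<le> p")
          case True
          then show ?thesis unfolding shift_round_def using eq[of j] eq[of "Suc j"] by (simp del: sum.lessThan_Suc)
        next
          case False
          then show ?thesis
            using shift_round_lattice[OF t(1) u01] shift_round_lattice[OF t(2) u01] by (auto simp: lattice_def)
        qed
      qed
      then show ?thesis using u by (auto simp: level_set_def)
    qed blast
  qed
  then have "measure lborel (level_set n f t i) \<le> measure lborel (level_set n f t' i \<union> (\<Union>j\<le>Suc p. D j))"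
    by (rule measure_mono_fmeasurable) (use fL fU in \<open>auto intro: fmeasurable.Un\<close>)
  also have "\<dots> \<le> measure lborel (level_set n f t' i) + measure lborel (\<Union>j\<le>Suc p. D j)"
    by (rule measure_Un_le) (use fL fU in auto)
  also have "measure lborel (\<Union>j\<le>Suc p. D j) \<le> (\<Sum>j\<le>Suc p. measure lborel (D j))"
    by (rule measure_UNION_le) (auto simp: D(1))
  also have "\<dots> \<le> (\<Sum>j\<le>Suc p. 2 * (real n * \<bar>sum t {..<j} - sum t' {..<j}\<bar>))"
    by (intro sum_mono D(2))
  finally show ?thesis by simp
qed

lemma continuous_on_level_measure:
  "continuous_on (standard_simplex p) (\<lambda>t. measure lborel (level_set n f t i))"
  unfolding continuous_on_def
proof
  fix t assume t: "t \<in> standard_simplex p"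
  let ?F = "\<lambda>t. measure lborel (level_set n f t i)"
  let ?g = "\<lambda>t'. \<Sum>j\<le>Suc p. 2 * (real n * \<bar>sum t' {..<j} - sum t {..<j}\<bar>)"
  have "continuous_on UNIV ?g"
    by (intro continuous_intros continuous_on_product_coordinates)
  then have "(?g \<longlongrightarrow> ?g t) (at t within standard_simplex p)"
    by (meson UNIV_I continuous_on_def subset_UNIV tendsto_within_subset)
  then have g: "(?g \<longlongrightarrow> 0) (at t within standard_simplex p)" by simp
  have "((\<lambda>t'. ?F t' - ?F t) \<longlongrightarrow> 0) (at t within standard_simplex p)"
  proof (rule Lim_null_comparison[OF _ g])
    show "\<forall>\<^sub>F t' in at t within standard_simplex p. norm (?F t' - ?F t) \<le> ?g t'"
      unfolding eventually_at_filter
    proof (rule always_eventually, intro allI impI)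
      fix t' assume t': "t' \<in> standard_simplex p"
      show "norm (?F t' - ?F t) \<le> ?g t'"
        using level_set_diff[OF t t', of n f i] level_set_diff[OF t' t, of n f i]
        by (simp add: abs_minus_commute abs_le_iff del: sum.atMost_Suc)
    qed
  qed
  then show "(?F \<longlongrightarrow> ?F t) (at t within standard_simplex p)" by (rule LIM_zero_cancel)
qed

lemma singular_simplex_euclidean:
  "singular_simplex p (top_of_set X) f \<longleftrightarrow>
     continuous_on (standard_simplex p) f \<and> f ` standard_simplex p \<subseteq> X \<and> f \<in> extensional (standard_simplex p)"
  by (auto simp: singular_simplex_def euclidean_product_topology continuous_map_in_subtopology continuous_map_iff_continuous)

lemma singular_simplex_realize:
  assumes "\<And>i j. A i j \<Longrightarrow> i < m \<and> j < m" "admissible A p n f"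
  shows "singular_simplex p (top_of_set (flag_complex m A)) (realize p n f)"
  unfolding singular_simplex_euclidean
proof (intro conjI)
  show "realize p n f ` standard_simplex p \<subseteq> flag_complex m A"
    using realize_simplex[OF assms] by auto
  have "continuous_on (standard_simplex p) (\<lambda>t i. measure lborel (level_set n f t i))"
    by (intro continuous_on_coordinatewise_then_product continuous_on_level_measure)
  then show "continuous_on (standard_simplex p) (realize p n f)"
    by (rule continuous_on_eq) (simp add: realize_def)
qed (simp add: realize_def)

lemma singular_face_realize:
  assumes "1 \<le> p" "k \<le> p"
  shows "singular_face p k (realize p n f) = realize (p - 1) n (f \<circ> simplical_face k)"
proof
  fix t
  show "singular_face p k (realize p n f) t = realize (p - 1) n (f \<circ> simplical_face k) t"
  proof (cases "t \<in> standard_simplex (p - 1)")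
    case True
    then have "simplical_face k t \<in> standard_simplex p"
      using simplical_face_in_standard_simplex[OF assms] by simp
    moreover have "level_set n f (simplical_face k t) i = level_set n (f \<circ> simplical_face k) t i" for i
      by (simp add: level_set_def shift_round_face)
    ultimately show ?thesis using True by (simp add: singular_face_def realize_def)
  qed (simp add: singular_face_def realize_def)
qed

lemma realize_cong:
  assumes "\<And>k. k \<in> lattice p n \<Longrightarrow> f k = g k"
  shows "realize p n f = realize p n g"
proof
  fix t
  show "realize p n f t = realize p n g t"
  proof (cases "t \<in> standard_simplex p")
    case True
    have "level_set n f t i = level_set n g t i" for i
      using assms shift_round_lattice[OF True] by (auto simp: level_set_def)
    then show ?thesis using True by (simp add: realize_def)
  qed (simp add: realize_def)
qed

section \<open>Sampling singular simplices\<close>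

text \<open>Of \<open>m\<close> coordinates with sum 1 some is at least \<open>1 / m\<close>. The
  fixed threshold leaves a margin that survives small moves of the point, and the least index makes
  the choice depend on the point alone.\<close>

definition top_vertex :: "nat \<Rightarrow> (nat \<Rightarrow> real) \<Rightarrow> nat" where
  "top_vertex m y = (LEAST i. 1 / real m \<le> y i)"

definition sample :: "nat \<Rightarrow> nat \<Rightarrow> ((nat \<Rightarrow> real) \<Rightarrow> nat \<Rightarrow> real) \<Rightarrow> (nat \<Rightarrow> nat) \<Rightarrow> nat" where
  "sample m n \<sigma> k = top_vertex m (\<sigma> (\<lambda>i. real (k i) / real n))"

lemma top_vertex:
  assumes "y \<in> flag_complex m A" "m > 0"
  shows "1 / real m \<le> y (top_vertex m y)" "top_vertex m y < m"
proof -
  have y: "\<And>i. 0 \<le> y i" "\<And>i. i \<ge> m \<Longrightarrow> y i = 0" "(\<Sum>i<m. y i) = 1" using assms by (auto simp: flag_complex_def)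
  have "\<exists>i. 1 / real m \<le> y i"
  proof (rule ccontr)
    assume "\<not> ?thesis"
    then have "(\<Sum>i<m. y i) < (\<Sum>i<m. 1 / real m)"
      using assms(2) by (intro sum_strict_mono) (auto simp: not_le)
    then show False using y assms(2) by simp
  qed
  from LeastI_ex[OF this] show *: "1 / real m \<le> y (top_vertex m y)" by (simp add: top_vertex_def)
  show "top_vertex m y < m"
    using * y(2)[of "top_vertex m y"] assms(2) by (metis divide_pos_pos not_le of_nat_0_less_iff zero_less_one)
qed

lemma lattice_point_simplex:
  assumes "k \<in> lattice p n" "n > 0" shows "(\<lambda>i. real (k i) / real n) \<in> standard_simplex p"
proof -
  have s: "(\<Sum>i\<le>p. k i) = n" and z: "\<And>i. i > p \<Longrightarrow> k i = 0" using assms by (auto simp: lattice_def)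
  have "k i \<le> n" for i
    using member_le_sum[of i "{..p}" k] s z[of i] by (cases "i \<le> p") auto
  moreover have "(\<Sum>i\<le>p. real (k i) / real n) = 1"
    using assms(2) s by (simp flip: sum_divide_distrib of_nat_sum)
  ultimately show ?thesis using assms(2) z by (auto simp: standard_simplex_def)
qed

lemma sample_face:
  assumes "k \<in> lattice (p - 1) n" "n > 0" "1 \<le> p"
  shows "sample m n (singular_face p j \<sigma>) k = sample m n \<sigma> (simplical_face j k)"
proof -
  have "simplical_face j (\<lambda>i. real (k i) / real n) = (\<lambda>i. real (simplical_face j k i) / real n)"
    by (auto simp: simplical_face_def)
  then show ?thesis
    using lattice_point_simplex[OF assms(1,2)] by (simp add: sample_def singular_face_def)
qed

lemma dist_fun_le:
  fixes x y :: "nat \<Rightarrow> real"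
  assumes "\<And>i. \<bar>x i - y i\<bar> \<le> c"
  shows "dist x y \<le> 2 * c"
proof -
  let ?a = "\<lambda>n. (1/2) ^ n * min (dist (x (from_nat n)) (y (from_nat n))) (1::real)"
  have s: "summable (\<lambda>n. (1/2::real) ^ n * c)"
    by (intro summable_mult2 summable_geometric) auto
  have "dist x y = suminf ?a"
    by (simp add: dist_fun_def)
  also have "\<dots> \<le> suminf (\<lambda>n. (1/2::real) ^ n * c)"
  proof (rule suminf_le[OF _ _ s])
    show "?a n \<le> (1/2::real) ^ n * c" for n
      using assms[of "from_nat n"] by (intro mult_left_mono) (auto simp: dist_real_def)
    show "summable ?a"
      by (rule summable_comparison_test'[of "\<lambda>n. (1/2::real) ^ n" 0]) auto
  qed
  also have "\<dots> = 2 * c" by (subst suminf_mult2[symmetric]) (auto simp: suminf_geometric)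
  finally show ?thesis .
qed

lemma compact_standard_simplex: "compact (standard_simplex p)"
  using compactin_standard_simplex[of p] by (simp add: euclidean_product_topology)

text \<open>Uniform continuity of the first \<open>m\<close> coordinates. The bound
  \<open>2 / n\<close> is the coordinate distance between neighbouring lattice points, and between a
  point and its roundings, at level \<open>n\<close>.\<close>

lemma singular_simplex_uniform:
  fixes \<sigma> :: "(nat \<Rightarrow> real) \<Rightarrow> nat \<Rightarrow> real" and m :: nat
  assumes "singular_simplex p (top_of_set X) \<sigma>" "\<epsilon> > 0"
  shows "\<exists>N. \<forall>n\<ge>N. \<forall>t\<in>standard_simplex p. \<forall>t'\<in>standard_simplex p.
    (\<forall>i. \<bar>t i - t' i\<bar> \<le> 2 / real n) \<longrightarrow> (\<forall>i<m. \<bar>\<sigma> t i - \<sigma> t' i\<bar> < \<epsilon>)"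
proof (induction m)
  case (Suc m)
  then obtain N where N: "\<And>n t t' i. n \<ge> N \<Longrightarrow> t \<in> standard_simplex p \<Longrightarrow> t' \<in> standard_simplex p \<Longrightarrow> 
    (\<forall>i. \<bar>t i - t' i\<bar> \<le> 2 / real n) \<Longrightarrow> i < m \<Longrightarrow> \<bar>\<sigma> t i - \<sigma> t' i\<bar> < \<epsilon>" by blast
  have "continuous_on (standard_simplex p) (\<lambda>t. \<sigma> t m)"
    using assms(1) by (auto simp: singular_simplex_euclidean intro: continuous_on_product_then_coordinatewise)
  then have "uniformly_continuous_on (standard_simplex p) (\<lambda>t. \<sigma> t m)"
    using compact_uniformly_continuous compact_standard_simplex by blast
  then obtain \<delta> where \<delta>: "\<delta> > 0" "\<And>t t'. t \<in> standard_simplex p \<Longrightarrow> t' \<in> standard_simplex p \<Longrightarrow> dist t' t < \<delta> \<Longrightarrow>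
     \<bar>\<sigma> t m - \<sigma> t' m\<bar> < \<epsilon>"
    unfolding uniformly_continuous_on_def dist_real_def using assms(2) by (metis abs_minus_commute)
  \<comment> \<open>The weights of the product metric add up to 2, so the coordinate bound
    \<open>2 / n\<close> yields distance at most \<open>4 / n\<close>.\<close>
  obtain N' where N': "real N' > 4 / \<delta>" using reals_Archimedean2 by blast
  show ?case
  proof (intro exI[of _ "max N N'"] allI impI ballI)
    fix n t t' i assume *: "max N N' \<le> n" "t \<in> standard_simplex p" "t' \<in> standard_simplex p"
      "\<forall>i. \<bar>t i - t' i\<bar> \<le> 2 / real n" "i < Suc m"
    have "dist t' t \<le> 2 * (2 / real n)"
      by (rule dist_fun_le) (use *(4) in \<open>simp add: abs_minus_commute\<close>)
    also have "\<dots> < \<delta>"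
    proof -
      have "4 / \<delta> < real n" using N' *(1) by linarith
      moreover have "0 < 4 / \<delta>" using \<delta>(1) by simp
      ultimately have "0 < real n" by linarith
      then show ?thesis using \<open>4 / \<delta> < real n\<close> \<delta>(1) by (simp add: field_simps)
    qed
    finally show "\<bar>\<sigma> t i - \<sigma> t' i\<bar> < \<epsilon>"
      using \<delta>(2)[OF *(2,3)] N[of n t t' i] * by (cases "i = m") auto
  qed
qed simp

lemma neighbours_coord:
  assumes "neighbours k k'" shows "\<bar>real (k i) - real (k' i)\<bar> \<le> 2"
proof -
  have "sum k {..<i} \<le> sum k' {..<i} + 1" "sum k' {..<i} \<le> sum k {..<i} + 1"
    "sum k {..<i} + k i \<le> sum k' {..<i} + k' i + 1" "sum k' {..<i} + k' i \<le> sum k {..<i} + k i + 1"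
    using assms[unfolded neighbours_def, rule_format, of i] assms[unfolded neighbours_def, rule_format, of "Suc i"] by auto
  then show ?thesis by linarith
qed

lemma shift_round_close:
  assumes "t \<in> standard_simplex p" "0 \<le> u" "u < 1"
  shows "\<bar>real (shift_round n t u i) - real n * t i\<bar> \<le> 2"
proof -
  have "real n * sum t {..<Suc i} = real n * sum t {..<i} + real n * t i" by (simp add: algebra_simps)
  moreover have "int (shift_round n t u i) = \<lfloor>real n * sum t {..<Suc i} + u\<rfloor> - \<lfloor>real n * sum t {..<i} + u\<rfloor>"
    using sum_shift_round[OF assms, of n i] sum_shift_round[OF assms, of n "Suc i"] by simp
  ultimately show ?thesis by linarith
qed

text \<open>The last clause keeps the discretized point in the closed face carrying the original
  one, so that the segment between them stays in the complex.\<close>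

definition fine_level :: "nat \<Rightarrow> (nat \<Rightarrow> nat \<Rightarrow> bool) \<Rightarrow> nat \<Rightarrow> nat \<Rightarrow> ((nat \<Rightarrow> real) \<Rightarrow> nat \<Rightarrow> real) \<Rightarrow> bool" where
  "fine_level m A p n \<sigma> \<longleftrightarrow> n > 0 \<and> admissible A p n (sample m n \<sigma>) \<and>
     (\<forall>t\<in>standard_simplex p. \<forall>i. 0 < realize p n (sample m n \<sigma>) t i \<longrightarrow> 0 < \<sigma> t i)"

text \<open>Once coordinates change by less than \<open>1 / m\<close> over distance
  \<open>2 / n\<close>, the top vertex at one point still has positive weight at every nearby point.
  Labels of neighbours thus lie in the support of a common point and are adjacent, and all labels
  occurring in the realization at \<open>t\<close> have positive weight in
  \<open>\<sigma> t\<close>.\<close>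

lemma eventually_fine:
  assumes A: "\<And>i j. A i j \<Longrightarrow> i < m \<and> j < m" and m: "m > 0"
    and \<sigma>: "singular_simplex p (top_of_set (flag_complex m A)) \<sigma>"
  shows "\<exists>N. \<forall>n\<ge>N. fine_level m A p n \<sigma>"
proof -
  let ?X = "flag_complex m A"
  have \<sigma>X: "\<sigma> t \<in> ?X" if "t \<in> standard_simplex p" for t
    using \<sigma> that by (auto simp: singular_simplex_euclidean)
  obtain N where N: "\<And>n t t' i. n \<ge> N \<Longrightarrow> t \<in> standard_simplex p \<Longrightarrow> t' \<in> standard_simplex p \<Longrightarrow> 
    (\<forall>i. \<bar>t i - t' i\<bar> \<le> 2 / real n) \<Longrightarrow> i < m \<Longrightarrow> \<bar>\<sigma> t i - \<sigma> t' i\<bar> < 1 / real m"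
    using singular_simplex_uniform[OF \<sigma>, of "1 / real m" m] m
    by (metis (no_types, lifting) divide_pos_pos of_nat_0_less_iff zero_less_one)
  have pos: "\<sigma> t (top_vertex m (\<sigma> t')) > 0"
    if "n \<ge> N" "t \<in> standard_simplex p" "t' \<in> standard_simplex p" "\<forall>i. \<bar>t i - t' i\<bar> \<le> 2 / real n" for n t t'
    using N[OF that top_vertex(2)[OF \<sigma>X[OF that(3)] m]] top_vertex(1)[OF \<sigma>X[OF that(3)] m] by linarith
  have "fine_level m A p n \<sigma>" if n: "n \<ge> max 1 N" for n
  proof -
    have n0: "n > 0" "n \<ge> N" using n by auto
    have "A (sample m n \<sigma> k) (sample m n \<sigma> k')"
      if k: "k \<in> lattice p n" "k' \<in> lattice p n" "neighbours k k'" for k k'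
    proof -
      let ?t = "\<lambda>i. real (k i) / real n" and ?t' = "\<lambda>i. real (k' i) / real n"
      have t: "?t \<in> standard_simplex p" "?t' \<in> standard_simplex p"
        using lattice_point_simplex k n0 by auto
      have "\<bar>?t i - ?t' i\<bar> \<le> 2 / real n" for i
        using neighbours_coord[OF k(3), of i] n0 by (simp add: divide_right_mono flip: diff_divide_distrib)
      then have "\<sigma> ?t (top_vertex m (\<sigma> ?t')) > 0" using pos[OF n0(2) t] by blast
      moreover have "\<sigma> ?t (top_vertex m (\<sigma> ?t)) > 0" using pos[OF n0(2) t(1) t(1)] by simp
      ultimately show ?thesis using \<sigma>X[OF t(1)] by (auto simp: flag_complex_def sample_def)
    qed
    moreover have "0 < \<sigma> t i" if t: "t \<in> standard_simplex p" and i: "0 < realize p n (sample m n \<sigma>) t i" for t i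
    proof -
      have "level_set n (sample m n \<sigma>) t i \<noteq> {}" using t i by (auto simp: realize_def)
      then obtain u where u: "0 \<le> u" "u < 1" "sample m n \<sigma> (shift_round n t u) = i"
        by (auto simp: level_set_def)
      let ?t' = "\<lambda>i. real (shift_round n t u i) / real n"
      have "\<bar>t i - ?t' i\<bar> \<le> 2 / real n" for i
      proof -
        have "t i - ?t' i = (real n * t i - real (shift_round n t u i)) / real n"
          using n0 by (simp add: field_simps)
        then show ?thesis
          using shift_round_close[OF t u(1,2), of n i] n0 by (simp add: abs_minus_commute divide_right_mono)
      qed
      then have "\<sigma> t (top_vertex m (\<sigma> ?t')) > 0"
        using pos[OF n0(2) t lattice_point_simplex[OF shift_round_lattice[OF t u(1,2)] n0(1)]] by blast
      then show ?thesis using u(3) by (simp add: sample_def)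
    qed
    ultimately show ?thesis using n0 by (auto simp: fine_level_def admissible_def)
  qed
  then show ?thesis by blast
qed

lemma frag_extend_extend: "frag_extend g (frag_extend f c) = frag_extend (\<lambda>x. frag_extend g (f x)) c"
  unfolding frag_extend_def[of f c] frag_extend_def[of "\<lambda>x. frag_extend g (f x)" c]
  by (simp add: frag_extend_sum frag_extend_cmul)

lemma frag_extend_of_compose:
  "frag_extend (frag_of \<circ> f) (frag_extend (frag_of \<circ> g) c) = frag_extend (frag_of \<circ> (f \<circ> g)) c"
  unfolding frag_extend_compose by (rule frag_extend_eq) simp

text \<open>The pairs \<open>(x, y)\<close> for which the support of \<open>y\<close> lies in that of \<open>x\<close> form a space on which
  the two projections are homotopic; a cycle and its discretization are the projections of
  a single cycle of pairs.\<close>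

lemma homologous_realize_sample:
  assumes A: "\<And>i j. A i j \<Longrightarrow> i < m \<and> j < m"
    and z: "singular_relcycle d (top_of_set (flag_complex m A)) {} z"
    and fl: "\<And>\<sigma>. \<sigma> \<in> Poly_Mapping.keys z \<Longrightarrow> fine_level m A d n \<sigma>"
  shows "homologous_rel d (top_of_set (flag_complex m A)) {} z
           (frag_extend (frag_of \<circ> (\<lambda>\<sigma>. realize d n (sample m n \<sigma>))) z)"
proof (cases "z = 0")
  case False
  let ?X = "flag_complex m A"
  define Y where "Y = {(x, y). x \<in> ?X \<and> y \<in> ?X \<and> (\<forall>i. 0 < y i \<longrightarrow> 0 < x i)}"
  define T where "T p \<sigma> = realize p n (sample m n \<sigma>)" for p \<sigma>
  define L where "L p \<sigma> = restrict (\<lambda>t. (\<sigma> t, T p \<sigma> t)) (standard_simplex p)" for p \<sigma>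
  have sz: "singular_simplex d (top_of_set ?X) \<sigma>" if "\<sigma> \<in> Poly_Mapping.keys z" for \<sigma>
    using z that by (auto simp: singular_cycle singular_chain_def)
  have bz: "chain_boundary d z = 0" using z by (simp add: singular_cycle)
  obtain \<sigma>0 where "\<sigma>0 \<in> Poly_Mapping.keys z" using False by (metis ex_in_conv keys_eq_empty)
  then have n: "n > 0" using fl by (auto simp: fine_level_def)
  have T: "singular_simplex d (top_of_set ?X) (T d \<sigma>)" if "\<sigma> \<in> Poly_Mapping.keys z" for \<sigma>
    unfolding T_def by (rule singular_simplex_realize[OF A]) (use fl[OF that] in \<open>auto simp: fine_level_def\<close>)
  have L: "singular_simplex d (top_of_set Y) (L d \<sigma>)" if k: "\<sigma> \<in> Poly_Mapping.keys z" for \<sigma>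
    unfolding singular_simplex_euclidean
  proof (intro conjI)
    have "continuous_on (standard_simplex d) (\<lambda>t. (\<sigma> t, T d \<sigma> t))"
      using sz[OF k] T[OF k] by (intro continuous_on_Pair) (auto simp: singular_simplex_euclidean)
    then show "continuous_on (standard_simplex d) (L d \<sigma>)"
      by (rule continuous_on_eq) (simp add: L_def)
    show "L d \<sigma> ` standard_simplex d \<subseteq> Y"
      using sz[OF k] T[OF k] fl[OF k] by (auto simp: singular_simplex_euclidean L_def Y_def fine_level_def T_def)
  qed (simp add: L_def)
  have face: "singular_face p j (L p \<sigma>) = L (p - 1) (singular_face p j \<sigma>)" if "1 \<le> p" "j \<le> p" for p j \<sigma>
  proof
    fix t
    have "realize (p - 1) n (sample m n \<sigma> \<circ> simplical_face j) = realize (p - 1) n (sample m n (singular_face p j \<sigma>))"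
      by (rule realize_cong) (simp add: sample_face[OF _ n that(1)])
    then have "T p \<sigma> (simplical_face j t) = T (p - 1) (singular_face p j \<sigma>) t" if "t \<in> standard_simplex (p - 1)"
      using fun_cong[OF singular_face_realize[OF \<open>1 \<le> p\<close> \<open>j \<le> p\<close>, of n "sample m n \<sigma>"], of t] that
      by (simp add: T_def singular_face_def)
    then show "singular_face p j (L p \<sigma>) t = L (p - 1) (singular_face p j \<sigma>) t"
      using simplical_face_in_standard_simplex[OF that] by (simp add: singular_face_def L_def)
  qed
  define w where "w = frag_extend (frag_of \<circ> L d) z"
  \<comment> \<open>Pairing with the discretization commutes with faces, so the boundary of
    \<open>w\<close> is the lift of the boundary of \<open>z\<close>.\<close>
  have "chain_boundary d w = 0"
  proof (cases "d = 0")
    case False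
    have cb: "chain_boundary d c = frag_extend (\<lambda>\<sigma>. chain_boundary d (frag_of \<sigma>)) c" for c :: "'x chain"
      using False unfolding chain_boundary_of by (simp add: chain_boundary_def)
    have "chain_boundary d w = frag_extend (\<lambda>\<sigma>. chain_boundary d (frag_of (L d \<sigma>))) z"
      unfolding w_def cb[of "frag_extend (frag_of \<circ> L d) z"] frag_extend_extend by simp
    also have "\<dots> = frag_extend (\<lambda>\<sigma>. frag_extend (frag_of \<circ> L (d - 1)) (chain_boundary d (frag_of \<sigma>))) z"
      by (rule frag_extend_eq)
         (use False in \<open>auto simp: chain_boundary_of frag_extend_sum frag_extend_cmul face intro!: sum.cong\<close>)
    also have "\<dots> = frag_extend (frag_of \<circ> L (d - 1)) (chain_boundary d z)"
      unfolding cb[of z] frag_extend_extend ..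
    finally show ?thesis by (simp add: bz)
  qed (simp add: chain_boundary_def)
  moreover have "singular_chain d (top_of_set Y) w"
    unfolding w_def by (rule singular_chain_extend) (simp add: singular_chain_of L)
  ultimately have w: "singular_relcycle d (top_of_set Y) {} w" by (simp add: singular_cycle)
  have "homotopic_with (\<lambda>h. h \<in> {} \<rightarrow> {}) (top_of_set Y) (top_of_set ?X) fst snd"
  proof -
    \<comment> \<open>On \<open>Y\<close> every point of the segment has support inside that of the
      first component, hence supported on a clique.\<close>
    let ?h = "\<lambda>(s::real, z::(nat \<Rightarrow> real) \<times> (nat \<Rightarrow> real)). \<lambda>i. (1 - s) * fst z i + s * snd z i"
    have c: "continuous_on ({0..1} \<times> Y) ?h"
    proof (rule continuous_on_coordinatewise_then_product)
      fix i
      have "continuous_on ({0..1} \<times> Y) (\<lambda>z. (1 - fst z) * fst (snd z) i + fst z * snd (snd z) i)"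
        by (intro continuous_intros continuous_on_product_then_coordinatewise[of _ "\<lambda>z. fst (snd z)"]
            continuous_on_product_then_coordinatewise[of _ "\<lambda>z. snd (snd z)"])
      then show "continuous_on ({0..1} \<times> Y) (\<lambda>z. ?h z i)" by (simp add: case_prod_unfold)
    qed
    have "?h (s, (x, y)) \<in> ?X" if s: "s \<in> {0..1}" and xy: "(x, y) \<in> Y" for s x y
    proof -
      have x: "\<And>i. 0 \<le> x i" "\<And>i. i \<ge> m \<Longrightarrow> x i = 0" "(\<Sum>i<m. x i) = 1" "\<And>i j. 0 < x i \<Longrightarrow> 0 < x j \<Longrightarrow> A i j"
        and y: "\<And>i. 0 \<le> y i" "\<And>i. i \<ge> m \<Longrightarrow> y i = 0" "(\<Sum>i<m. y i) = 1" "\<And>i. 0 < y i \<Longrightarrow> 0 < x i"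
        using xy by (auto simp: Y_def flag_complex_def)
      have "0 < x i" if "0 < (1 - s) * x i + s * y i" for i
        using that x(1)[of i] y(1)[of i] y(4)[of i] s by (cases "x i = 0") (auto simp: less_eq_real_def)
      moreover have "(\<Sum>i<m. (1 - s) * x i + s * y i) = 1"
        using x(3) y(3) by (simp add: sum.distrib flip: sum_distrib_left)
      ultimately show ?thesis using x y s by (auto simp: flag_complex_def)
    qed
    then have "continuous_map (prod_topology (top_of_set {0..1}) (top_of_set Y)) (top_of_set ?X) ?h"
      using c by (auto simp: continuous_map_in_subtopology continuous_map_iff_continuous)
    then show ?thesis unfolding homotopic_with_def by (intro exI[of _ ?h]) auto
  qed
  from homotopic_imp_homologous_rel_chain_maps[OF this w]
  have "homologous_rel d (top_of_set ?X) {} (chain_map d fst w) (chain_map d snd w)" .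
  moreover have "chain_map d fst w = z"
  proof -
    have "chain_map d fst w = frag_extend (frag_of \<circ> (simplex_map d fst \<circ> L d)) z"
      unfolding chain_map_def w_def by (rule frag_extend_of_compose)
    also have "\<dots> = frag_extend frag_of z"
    proof (rule frag_extend_eq)
      fix \<sigma> assume "\<sigma> \<in> Poly_Mapping.keys z"
      then have "\<sigma> \<in> extensional (standard_simplex d)" using sz by (simp add: singular_simplex_def)
      then have "simplex_map d fst (L d \<sigma>) = \<sigma>"
        by (auto simp: simplex_map_def L_def fun_eq_iff extensional_def restrict_def)
      then show "(frag_of \<circ> (simplex_map d fst \<circ> L d)) \<sigma> = frag_of \<sigma>" by simp
    qed
    finally show ?thesis by (simp flip: frag_expansion)
  qed
  moreover have "chain_map d snd w = frag_extend (frag_of \<circ> T d) z"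
  proof -
    have "chain_map d snd w = frag_extend (frag_of \<circ> (simplex_map d snd \<circ> L d)) z"
      unfolding chain_map_def w_def by (rule frag_extend_of_compose)
    also have "\<dots> = frag_extend (frag_of \<circ> T d) z"
    proof (rule frag_extend_eq)
      fix \<sigma>
      have "simplex_map d snd (L d \<sigma>) = T d \<sigma>"
        by (auto simp: simplex_map_def L_def T_def realize_def fun_eq_iff restrict_def)
      then show "(frag_of \<circ> (simplex_map d snd \<circ> L d)) \<sigma> = (frag_of \<circ> T d) \<sigma>" by simp
    qed
    finally show ?thesis .
  qed
  ultimately show ?thesis by (simp add: T_def[abs_def])
qed simp

text \<open>Resampling a realized table at a multiple of its level is a counting procedure.\<close>

definition refine :: "nat \<Rightarrow> nat \<Rightarrow> (nat \<Rightarrow> nat) \<Rightarrow> nat \<Rightarrow> nat" where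
  "refine r j k i = (sum k {..<Suc i} + j) div r - (sum k {..<i} + j) div r"

text \<open>After multiplication by \<open>r\<close> the value lies in the unit interval starting at
  the integer \<open>a + j\<close>, and no multiple of \<open>r\<close> separates it from
  \<open>a + j\<close>.\<close>

lemma floor_add_fraction:
  assumes "r > 0" "real j \<le> real r * u" "real r * u < real j + 1"
  shows "\<lfloor>real a / real r + u\<rfloor> = int ((a + j) div r)"
proof (rule floor_unique)
  define q where "q = (a + j) div r"
  have "q * r \<le> a + j" unfolding q_def by (simp add: div_times_less_eq_dividend)
  then have "real q * real r \<le> real a + real j" by (metis of_nat_add of_nat_le_iff of_nat_mult)
  then show "real_of_int (int ((a + j) div r)) \<le> real a / real r + u"
    using assms by (simp add: field_simps flip: q_def)
  have "a + j < Suc q * r"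
    unfolding q_def using assms(1) by (metis dividend_less_div_times mult_Suc add.commute)
  then have "a + j + 1 \<le> Suc q * r" by simp
  then have "real (a + j + 1) \<le> real (Suc q * r)" using of_nat_le_iff by blast
  then have "real a + real j + 1 \<le> (real q + 1) * real r" by (simp add: algebra_simps)
  then show "real a / real r + u < real_of_int (int ((a + j) div r)) + 1"
    using assms by (simp add: field_simps flip: q_def)
qed

lemma shift_round_refine:
  assumes "r > 0" "n > 0" "real j \<le> real r * u" "real r * u < real j + 1"
  shows "shift_round n (\<lambda>i. real (k i) / real (n * r)) u = refine r j k"
proof
  fix i
  have "real n * sum (\<lambda>i. real (k i) / real (n * r)) {..<i} = real (sum k {..<i}) / real r" for i
  proof -
    have "sum (\<lambda>i. real (k i) / real (n * r)) {..<i} = real (sum k {..<i}) / real (n * r)"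
      by (simp add: sum_divide_distrib)
    then show ?thesis using assms(1,2) by simp
  qed
  then show "shift_round n (\<lambda>i. real (k i) / real (n * r)) u i = refine r j k i"
    unfolding shift_round_def refine_def by (simp add: floor_add_fraction[OF assms(1,3,4)] nat_diff_distrib' del: sum.lessThan_Suc of_nat_sum)
qed

text \<open>At a lattice point of level \<open>n * r\<close> the rounding depends on the shift only
  through its block of length \<open>1 / r\<close>. The measure becomes a count of the
  \<open>r\<close> blocks.\<close>

lemma realize_lattice_point:
  assumes "r > 0" "n > 0" "k \<in> lattice p (n * r)"
  shows "realize p n f (\<lambda>i. real (k i) / real (n * r)) i = real (card {j. j < r \<and> f (refine r j k) = i}) / real r"
proof -
  let ?t = "\<lambda>i. real (k i) / real (n * r)"
  let ?J = "{j. j < r \<and> f (refine r j k) = i}"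
  define B where "B j = {real j / real r ..< (real j + 1) / real r}" for j
  have Bj: "u \<in> B j \<longleftrightarrow> real j \<le> real r * u \<and> real r * u < real j + 1" for u j
    using assms(1) by (simp add: B_def field_simps)
  have "level_set n f ?t i = (\<Union>j\<in>?J. B j)"
  proof (rule equalityI; rule subsetI)
    fix u assume u: "u \<in> level_set n f ?t i"
    define j where "j = nat \<lfloor>real r * u\<rfloor>"
    have u01: "0 \<le> u" "u < 1" using u by (auto simp: level_set_def)
    then have j: "real j \<le> real r * u" "real r * u < real j + 1" by (auto simp: j_def)
    have "real r * u < real r" using u01 assms(1) by simp
    then have "j < r" using j by linarith
    then show "u \<in> (\<Union>j\<in>?J. B j)"
      using u j shift_round_refine[OF assms(1,2) j, of k] Bj by (auto simp: level_set_def)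
  next
    fix u assume "u \<in> (\<Union>j\<in>?J. B j)"
    then obtain j where j: "j < r" "f (refine r j k) = i" "real j \<le> real r * u" "real r * u < real j + 1"
      using Bj by auto
    have "0 \<le> real r * u" using j(3) by linarith
    then have "0 \<le> u" using assms(1) by (simp add: zero_le_mult_iff)
    have "real j + 1 \<le> real r" using j(1) by linarith
    then have "real r * u < real r" using j(4) by linarith
    then have "u < 1" using assms(1) by simp
    then show "u \<in> level_set n f ?t i"
      using \<open>0 \<le> u\<close> j(2) shift_round_refine[OF assms(1,2) j(3,4), of k] by (simp add: level_set_def)
  qed
  moreover have "measure lborel (\<Union>j\<in>?J. B j) = (\<Sum>j\<in>?J. measure lborel (B j))"
  proof (rule measure_finite_Union)
    show "disjoint_family_on B ?J"
    proof (clarsimp simp: disjoint_family_on_def)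
      fix a b :: nat assume "a \<noteq> b"
      show "B a \<inter> B b = {}"
      proof (rule ccontr)
        assume "B a \<inter> B b \<noteq> {}"
        then obtain u where "u \<in> B a" "u \<in> B b" by blast
        then show False using \<open>a \<noteq> b\<close> unfolding Bj by linarith
      qed
    qed
  next
    fix j
    have "real j / real r \<le> (real j + 1) / real r" by (simp add: divide_right_mono)
    then show "emeasure lborel (B j) \<noteq> \<infinity>" by (simp add: B_def)
  qed (auto simp: B_def)
  moreover have "measure lborel (B j) = 1 / real r" for j
    using assms(1) by (simp add: B_def divide_right_mono add_divide_distrib)
  moreover have "?t \<in> standard_simplex p" using lattice_point_simplex[OF assms(3)] assms(1,2) by simp
  ultimately show ?thesis by (simp add: realize_def)
qed

lemma sample_realize:
  assumes "r > 0" "n > 0" "k \<in> lattice p (n * r)" "m > 0"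
  shows "sample m (n * r) (realize p n f) k = (LEAST i. r \<le> m * card {j. j < r \<and> f (refine r j k) = i})"
proof -
  have "1 / real m \<le> real c / real r \<longleftrightarrow> r \<le> m * c" for c
    using assms(1,4) by (simp add: field_simps flip: of_nat_mult)
  then show ?thesis
    unfolding sample_def top_vertex_def realize_lattice_point[OF assms(1-3)] by presburger
qed

lemma refine_lattice:
  assumes "r > 0" "k \<in> lattice p (n * r)" "j < r"
  shows "refine r j k \<in> lattice p n"
proof -
  have mono: "sum k {..<a} \<le> sum k {..<b}" if "a \<le> b" for a b
    using that by (intro sum_mono2) auto
  have s: "sum (refine r j k) {..<a} = (sum k {..<a} + j) div r" for a
  proof (induction a)
    case (Suc a)
    have "(sum k {..<a} + j) div r \<le> (sum k {..<Suc a} + j) div r"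
      using mono[of a "Suc a"] by (intro div_le_mono add_right_mono) simp
    then show ?case
      unfolding sum.lessThan_Suc[of "refine r j k"] Suc by (simp add: refine_def del: sum.lessThan_Suc)
  qed (use assms in simp)
  have "sum k {..<Suc p} = n * r" using assms by (simp add: lattice_def lessThan_Suc_atMost)
  then have "sum (refine r j k) {..<Suc p} = n" unfolding s using assms by simp
  moreover have "refine r j k i = 0" if "i > p" for i
    using assms that by (simp add: refine_def lattice_def)
  ultimately show ?thesis by (simp add: lattice_def lessThan_Suc_atMost)
qed

section \<open>Chains as indexed families of tables\<close>

lemma sum_blocks:
  fixes g :: "nat \<Rightarrow> 'a::comm_monoid_add"
  shows "(\<Sum>j<a + L * M. g j) = (\<Sum>i<a. g i) + (\<Sum>l<L. \<Sum>k<M. g (a + l * M + k))"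
proof (induction L)
  case (Suc L)
  have "(\<Sum>j<c + M. g j) = (\<Sum>j<c. g j) + (\<Sum>k<M. g (c + k))" for c
    by (induction M) (auto simp: add.assoc)
  from this[of "a + L * M"] Suc show ?case by (simp add: algebra_simps)
qed simp

text \<open>The first \<open>I\<close> positions hold the terms of \<open>q\<close> times the cycle.
  After them comes one block of \<open>d + 2\<close> positions per simplex of the filling, one for
  each face with its sign.\<close>

definition face_weight :: "nat \<Rightarrow> nat \<Rightarrow> nat \<Rightarrow> (nat \<Rightarrow> int) \<Rightarrow> (nat \<Rightarrow> int) \<Rightarrow> nat \<Rightarrow> int" where
  "face_weight d I q \<zeta> \<beta> j = (if j < I then int q * \<zeta> j
     else (-1) ^ ((j - I) mod (d + 2)) * \<beta> ((j - I) div (d + 2)))"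

definition face_family :: "nat \<Rightarrow> nat \<Rightarrow> (nat \<Rightarrow> 'b) \<Rightarrow> (nat \<Rightarrow> nat \<Rightarrow> 'b) \<Rightarrow> nat \<Rightarrow> 'b" where
  "face_family d I S T j = (if j < I then S j else T ((j - I) mod (d + 2)) ((j - I) div (d + 2)))"

lemma chain_as_face_family:
  "frag_cmul (int q) (\<Sum>i<I. frag_cmul (\<zeta> i) (frag_of (S i))) +
     chain_boundary (Suc d) (\<Sum>l<L. frag_cmul (\<beta> l) (frag_of (\<sigma> l))) =
   (\<Sum>j<I + L * (d + 2). frag_cmul (face_weight d I q \<zeta> \<beta> j)
      (frag_of (face_family d I S (\<lambda>k l. singular_face (Suc d) k (\<sigma> l)) j)))"
proof -
  have "frag_cmul (int q) (\<Sum>i<I. frag_cmul (\<zeta> i) (frag_of (S i))) = (\<Sum>i<I. frag_cmul (int q * \<zeta> i) (frag_of (S i)))"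
    by (simp add: frag_cmul_sum)
  moreover have "chain_boundary (Suc d) (\<Sum>l<L. frag_cmul (\<beta> l) (frag_of (\<sigma> l))) =
     (\<Sum>l<L. \<Sum>k<d + 2. frag_cmul ((-1) ^ k * \<beta> l) (frag_of (singular_face (Suc d) k (\<sigma> l))))"
  proof -
    have "chain_boundary (Suc d) (\<Sum>l<L. frag_cmul (\<beta> l) (frag_of (\<sigma> l))) =
       (\<Sum>l<L. frag_cmul (\<beta> l) (chain_boundary (Suc d) (frag_of (\<sigma> l))))"
      by (simp add: chain_boundary_sum chain_boundary_cmul o_def)
    also have "\<dots> = (\<Sum>l<L. \<Sum>k<d + 2. frag_cmul ((-1) ^ k * \<beta> l) (frag_of (singular_face (Suc d) k (\<sigma> l))))"
      by (rule sum.cong) (simp_all add: chain_boundary_of frag_cmul_sum mult.commute o_def del: sum.lessThan_Suc sum.atMost_Suc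
            flip: lessThan_Suc_atMost)
    finally show ?thesis .
  qed
  moreover have "(I + l * (d + 2) + k - I) mod (d + 2) = k \<and> (I + l * (d + 2) + k - I) div (d + 2) = l" if "k < d + 2" for l k
  proof -
    have "I + l * (d + 2) + k - I = l * (d + 2) + k" by (simp only: add.assoc diff_add_inverse)
    moreover have "(l * (d + 2) + k) mod (d + 2) = k"
      using mod_mult_self3[of l "d + 2" k] mod_less[OF that] by (simp only:)
    moreover have "(l * (d + 2) + k) div (d + 2) = l + k div (d + 2)"
      by (rule div_mult_self3) simp
    ultimately show ?thesis using div_less[OF that] by (simp only: add_0_right)
  qed
  ultimately show ?thesis
    unfolding sum_blocks by (simp add: face_weight_def face_family_def)
qed

lemma frag_as_list_sum:
  obtains xs where "set xs = Poly_Mapping.keys c"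
    "c = (\<Sum>i<length xs. frag_cmul (poly_mapping.lookup c (xs ! i)) (frag_of (xs ! i)))"
proof -
  obtain xs where xs: "set xs = Poly_Mapping.keys c" "distinct xs" using finite_distinct_list[OF finite_keys[of c]] by metis
  have bij: "bij_betw (\<lambda>i. xs ! i) {..<length xs} (Poly_Mapping.keys c)"
    using bij_betw_nth[OF xs(2) refl] xs(1) by simp
  have "c = (\<Sum>\<sigma>\<in>Poly_Mapping.keys c. frag_cmul (poly_mapping.lookup c \<sigma>) (frag_of \<sigma>))"
    by (rule frag_as_sum)
  also have "\<dots> = (\<Sum>i<length xs. frag_cmul (poly_mapping.lookup c (xs ! i)) (frag_of (xs ! i)))"
    by (rule sum.reindex_bij_betw[OF bij, symmetric])
  finally show ?thesis by (rule that[OF xs(1)])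
qed

definition small_table_norm where
  "small_table_norm d m A n0 I F \<zeta> q r L tab \<beta> x \<longleftrightarrow> 
     (\<forall>l<L. admissible A (Suc d) (n0 * r) (tab l)) \<and>
     real_of_int (family_norm {..<I + L * (d + 2)} (face_weight d I q \<zeta> \<beta>)
       (\<lambda>j. restrict (face_family d I (\<lambda>i. sample m (n0 * r) (realize d n0 (F i))) (\<lambda>k l. tab l \<circ> simplical_face k) j)
              (lattice d (n0 * r)))) < real q * x"

text \<open>From left to right, the finitely many simplices of the filling are sampled at a common
  fine level, and sampling cannot separate equal simplices. Conversely, tables are realized; this
  bounds the norm for the resampled cycle \<open>W\<close>, and \<open>r \<ge> r1\<close> makes
  \<open>W\<close> homologous to \<open>w\<close>.\<close>

lemma volume_below_iff_tables:
  assumes A: "\<And>i j. A i j \<Longrightarrow> i < m \<and> j < m" and m: "m > 0" and n0: "n0 > 0"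
    and w: "w = (\<Sum>i<I. frag_cmul (\<zeta> i) (frag_of (realize d n0 (F i))))"
    and cyc: "singular_relcycle d (top_of_set (flag_complex m A)) {} w"
    and r1: "\<And>r \<sigma>. r \<ge> r1 \<Longrightarrow> \<sigma> \<in> Poly_Mapping.keys w \<Longrightarrow> fine_level m A d (n0 * r) \<sigma>"
  shows "volume_below d (top_of_set (flag_complex m A)) w x \<longleftrightarrow>
    (\<exists>r q L tab \<beta>. r \<ge> r1 \<and> r > 0 \<and> q > 0 \<and> small_table_norm d m A n0 I F \<zeta> q r L tab \<beta> x)"
proof
  let ?X = "top_of_set (flag_complex m A)"
  assume "volume_below d ?X w x"
  then obtain q b where qb: "q > 0" "singular_chain (Suc d) ?X b"
    "real_of_int (frag_norm (frag_cmul (int q) w + chain_boundary (Suc d) b)) < real q * x"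
    by (auto simp: volume_below_def)
  obtain \<sigma>s where \<sigma>s: "set \<sigma>s = Poly_Mapping.keys b"
    "b = (\<Sum>l<length \<sigma>s. frag_cmul (poly_mapping.lookup b (\<sigma>s ! l)) (frag_of (\<sigma>s ! l)))"
    by (rule frag_as_list_sum)
  define L where "L = length \<sigma>s"
  define \<beta> where "\<beta> l = poly_mapping.lookup b (\<sigma>s ! l)" for l
  have sing: "singular_simplex (Suc d) ?X \<sigma>" if "\<sigma> \<in> set \<sigma>s" for \<sigma>
    using qb(2) that by (auto simp: singular_chain_def \<sigma>s(1))
  then have "\<forall>\<sigma>\<in>set \<sigma>s. \<exists>N. \<forall>n\<ge>N. fine_level m A (Suc d) n \<sigma>"
    using eventually_fine[OF A m] by blast
  then obtain N where N: "\<And>\<sigma> n. \<sigma> \<in> set \<sigma>s \<Longrightarrow> n \<ge> N \<sigma> \<Longrightarrow> fine_level m A (Suc d) n \<sigma>" by metis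
  \<comment> \<open>The sum of the individual levels bounds each of them; the maximum with 1 keeps
    the level positive even for an empty filling.\<close>
  define r where "r = max 1 (max r1 (\<Sum>\<sigma>\<in>set \<sigma>s. N \<sigma>))"
  define n where "n = n0 * r"
  have r: "r \<ge> r1" "r > 0" by (auto simp: r_def)
  have n: "n > 0" using n0 r by (simp add: n_def)
  have fine: "fine_level m A (Suc d) n \<sigma>" if "\<sigma> \<in> set \<sigma>s" for \<sigma>
  proof (rule N[OF that])
    have "N \<sigma> \<le> (\<Sum>\<sigma>\<in>set \<sigma>s. N \<sigma>)" using that by (intro member_le_sum) auto
    also have "\<dots> \<le> r" by (simp add: r_def)
    also have "\<dots> \<le> n" using n0 by (simp add: n_def)
    finally show "N \<sigma> \<le> n" .
  qed
  define tab where "tab l = sample m n (\<sigma>s ! l)" for l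
  define S where "S = face_family d I (\<lambda>i. realize d n0 (F i)) (\<lambda>k l. singular_face (Suc d) k (\<sigma>s ! l))"
  have eq: "frag_cmul (int q) w + chain_boundary (Suc d) b = (\<Sum>j<I + L * (d + 2). frag_cmul (face_weight d I q \<zeta> \<beta> j) (frag_of (S j)))"
    unfolding S_def w L_def \<beta>_def by (subst \<sigma>s(2)) (rule chain_as_face_family)
  have "family_norm {..<I + L * (d + 2)} (face_weight d I q \<zeta> \<beta>)
       (\<lambda>j. restrict (face_family d I (\<lambda>i. sample m n (realize d n0 (F i))) (\<lambda>k l. tab l \<circ> simplical_face k) j) (lattice d n))
    = family_norm {..<I + L * (d + 2)} (face_weight d I q \<zeta> \<beta>) ((\<lambda>\<sigma>. restrict (sample m n \<sigma>) (lattice d n)) \<circ> S)"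
    by (rule family_norm_cong) (auto simp: S_def face_family_def tab_def fun_eq_iff sample_face[OF _ n, of _ "Suc d", simplified] restrict_def)
  also have "\<dots> \<le> family_norm {..<I + L * (d + 2)} (face_weight d I q \<zeta> \<beta>) S"
    by (rule family_norm_image) simp
  also have "\<dots> = frag_norm (frag_cmul (int q) w + chain_boundary (Suc d) b)"
    unfolding eq by (rule frag_norm_sum[symmetric]) simp
  finally have "small_table_norm d m A n0 I F \<zeta> q r L tab \<beta> x"
    using qb(3) fine unfolding small_table_norm_def n_def[symmetric]
    by (auto simp: fine_level_def tab_def L_def)
  then show "\<exists>r q L tab \<beta>. r \<ge> r1 \<and> r > 0 \<and> q > 0 \<and> small_table_norm d m A n0 I F \<zeta> q r L tab \<beta> x"
    using r qb(1) by blast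
next
  let ?X = "top_of_set (flag_complex m A)"
  assume "\<exists>r q L tab \<beta>. r \<ge> r1 \<and> r > 0 \<and> q > 0 \<and> small_table_norm d m A n0 I F \<zeta> q r L tab \<beta> x"
  then obtain r q L tab \<beta> where r: "r \<ge> r1" "r > 0" "q > 0" and st: "small_table_norm d m A n0 I F \<zeta> q r L tab \<beta> x" by blast
  define n where "n = n0 * r"
  define T where "T = face_family d I (\<lambda>i. sample m n (realize d n0 (F i))) (\<lambda>k l. tab l \<circ> simplical_face k)"
  have adm: "\<And>l. l < L \<Longrightarrow> admissible A (Suc d) n (tab l)"
    and less: "real_of_int (family_norm {..<I + L * (d + 2)} (face_weight d I q \<zeta> \<beta>) (\<lambda>j. restrict (T j) (lattice d n))) < real q * x"
    using st unfolding small_table_norm_def n_def[symmetric] T_def by auto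
  define W where "W = (\<Sum>i<I. frag_cmul (\<zeta> i) (frag_of (realize d n (sample m n (realize d n0 (F i))))))"
  have W: "frag_extend (frag_of \<circ> (\<lambda>\<sigma>. realize d n (sample m n \<sigma>))) w = W"
    unfolding w W_def by (simp add: frag_extend_sum frag_extend_cmul o_def)
  have hom: "homologous_rel d ?X {} w W"
    unfolding W[symmetric] by (rule homologous_realize_sample[OF A cyc]) (use r1[OF r(1)] in \<open>auto simp: n_def\<close>)
  define b where "b = (\<Sum>l<L. frag_cmul (\<beta> l) (frag_of (realize (Suc d) n (tab l))))"
  have b: "singular_chain (Suc d) ?X b"
    unfolding b_def by (intro singular_chain_sum singular_chain_cmul) (auto simp: singular_chain_of intro!: singular_simplex_realize[OF A] adm)
  have eq: "frag_cmul (int q) W + chain_boundary (Suc d) b = (\<Sum>j<I + L * (d + 2). frag_cmul (face_weight d I q \<zeta> \<beta> j)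
      (frag_of (face_family d I (\<lambda>i. realize d n (sample m n (realize d n0 (F i)))) (\<lambda>k l. singular_face (Suc d) k (realize (Suc d) n (tab l))) j)))"
    unfolding W_def b_def by (rule chain_as_face_family)
  have "frag_norm (frag_cmul (int q) W + chain_boundary (Suc d) b) =
     family_norm {..<I + L * (d + 2)} (face_weight d I q \<zeta> \<beta>) (face_family d I (\<lambda>i. realize d n (sample m n (realize d n0 (F i)))) (\<lambda>k l. singular_face (Suc d) k (realize (Suc d) n (tab l))))"
    unfolding eq by (rule frag_norm_sum) simp
  also have "\<dots> = family_norm {..<I + L * (d + 2)} (face_weight d I q \<zeta> \<beta>) (realize d n \<circ> (\<lambda>j. restrict (T j) (lattice d n)))"
  proof (rule family_norm_cong[OF _ refl])
    fix j
    have "(j - I) mod (d + 2) < d + 2" by simp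
    then have "(j - I) mod (d + 2) \<le> Suc d" by linarith
    then have "face_family d I (\<lambda>i. realize d n (sample m n (realize d n0 (F i)))) (\<lambda>k l. singular_face (Suc d) k (realize (Suc d) n (tab l))) j = realize d n (T j)"
      unfolding T_def face_family_def by (simp add: singular_face_realize)
    also have "\<dots> = realize d n (restrict (T j) (lattice d n))"
      by (rule realize_cong) simp
    finally show "face_family d I (\<lambda>i. realize d n (sample m n (realize d n0 (F i)))) (\<lambda>k l. singular_face (Suc d) k (realize (Suc d) n (tab l))) j =
      (realize d n \<circ> (\<lambda>j. restrict (T j) (lattice d n))) j" by simp
  qed
  also have "\<dots> \<le> family_norm {..<I + L * (d + 2)} (face_weight d I q \<zeta> \<beta>) (\<lambda>j. restrict (T j) (lattice d n))"
    by (rule family_norm_image) simp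
  finally have "volume_below d ?X W x"
    unfolding volume_below_def using less r(3) b by (intro exI[of _ q] exI[of _ b]) (auto intro: order_le_less_trans)
  moreover have "homologous_rel d ?X {} W w" using hom by (simp add: homologous_rel_sym)
  ultimately show "volume_below d ?X w x" by (rule volume_below_homologous[rotated])
qed

subsection \<open>Arithmetization\<close>

definition digit :: "nat \<Rightarrow> nat \<Rightarrow> nat \<Rightarrow> nat" where
  "digit B c i = c div B ^ i mod B"

definition point :: "nat \<Rightarrow> nat \<Rightarrow> nat \<Rightarrow> nat \<Rightarrow> nat" where
  "point p B c i = (if i < Suc p then digit B c i else 0)"

definition code :: "nat \<Rightarrow> nat \<Rightarrow> (nat \<Rightarrow> nat) \<Rightarrow> nat" where
  "code p B k = (\<Sum>i<Suc p. k i * B ^ i)"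

text \<open>One number \<open>s\<close> stores all tables consecutively. Lattice coordinates are at
  most \<open>n\<close>, so in base \<open>n + 1\<close> a point has a code below
  \<open>Suc n ^ Suc p\<close>, the length of one block.\<close>

definition table :: "nat \<Rightarrow> nat \<Rightarrow> nat \<Rightarrow> nat \<Rightarrow> (nat \<Rightarrow> nat) \<Rightarrow> nat" where
  "table s p n l k = entry s (l * Suc n ^ Suc p + code p (Suc n) k)"

lemma lattice_coord_le: "k \<in> lattice p n \<Longrightarrow> k i \<le> n"
  using member_le_sum[of i "{..p}" k] by (cases "i \<le> p") (auto simp: lattice_def)

lemma code_less: "k \<in> lattice p n \<Longrightarrow> code p (Suc n) k < Suc n ^ Suc p"
  unfolding code_def by (rule digit_sum_less) (simp add: lattice_coord_le le_imp_less_Suc)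

lemma point_code:
  assumes "k \<in> lattice p n" shows "point p (Suc n) (code p (Suc n) k) = k"
proof
  fix i
  have "digit (Suc n) (code p (Suc n) k) i = k i" if "i < Suc p"
    unfolding digit_def code_def
    by (rule digit_sum) (use that assms in \<open>auto simp: lattice_coord_le le_imp_less_Suc\<close>)
  then show "point p (Suc n) (code p (Suc n) k) i = k i"
    using assms by (auto simp: point_def lattice_def)
qed

text \<open>Lattice points correspond to codes with digit sum \<open>n\<close>, so quantification
  over them becomes bounded quantification over numbers.\<close>

lemma ball_lattice_iff:
  "(\<forall>k\<in>lattice p n. \<Phi> k) \<longleftrightarrow>
     (\<forall>c<Suc n ^ Suc p. (\<Sum>i<Suc p. digit (Suc n) c i) = n \<longrightarrow> \<Phi> (point p (Suc n) c))"
proof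
  assume *: "\<forall>k\<in>lattice p n. \<Phi> k"
  have "point p (Suc n) c \<in> lattice p n" if "(\<Sum>i<Suc p. digit (Suc n) c i) = n" for c
    unfolding lattice_def using that by (auto simp: point_def lessThan_Suc_atMost)
  then show "\<forall>c<Suc n ^ Suc p. (\<Sum>i<Suc p. digit (Suc n) c i) = n \<longrightarrow> \<Phi> (point p (Suc n) c)"
    using * by blast
next
  assume *: "\<forall>c<Suc n ^ Suc p. (\<Sum>i<Suc p. digit (Suc n) c i) = n \<longrightarrow> \<Phi> (point p (Suc n) c)"
  show "\<forall>k\<in>lattice p n. \<Phi> k"
  proof
    fix k assume k: "k \<in> lattice p n"
    have "(\<Sum>i<Suc p. digit (Suc n) (code p (Suc n) k) i) = (\<Sum>i<Suc p. k i)"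
    proof (rule sum.cong)
      fix i assume "i \<in> {..<Suc p}"
      then show "digit (Suc n) (code p (Suc n) k) i = k i"
        using fun_cong[OF point_code[OF k], of i] by (simp add: point_def)
    qed simp
    also have "\<dots> = n" using k by (simp add: lattice_def lessThan_Suc_atMost)
    finally show "\<Phi> k" using * code_less[OF k] point_code[OF k] by metis
  qed
qed

lemma table_exists:
  "\<exists>s. \<forall>l<L. \<forall>k\<in>lattice p n. table s p n l k = T l k"
proof -
  let ?E = "Suc n ^ Suc p"
  obtain s where s: "\<And>i. i < L * ?E \<Longrightarrow> entry s i = T (i div ?E) (point p (Suc n) (i mod ?E))"
    using entry_exists[of "L * ?E" "\<lambda>i. T (i div ?E) (point p (Suc n) (i mod ?E))"] by blast
  have "table s p n l k = T l k" if l: "l < L" and k: "k \<in> lattice p n" for l k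
  proof -
    have c: "code p (Suc n) k < ?E" by (rule code_less[OF k])
    have "l * ?E + code p (Suc n) k < Suc l * ?E" using c by simp
    also have "\<dots> \<le> L * ?E" using l by (intro mult_le_mono1) simp
    finally have "entry s (l * ?E + code p (Suc n) k) =
        T ((l * ?E + code p (Suc n) k) div ?E) (point p (Suc n) ((l * ?E + code p (Suc n) k) mod ?E))"
      by (rule s)
    moreover have "(l * ?E + code p (Suc n) k) div ?E = l + code p (Suc n) k div ?E"
      by (rule div_mult_self3) simp
    moreover have "(l * ?E + code p (Suc n) k) mod ?E = code p (Suc n) k"
      unfolding mod_mult_self3 using c by (rule mod_less)
    ultimately show ?thesis unfolding table_def by (simp only: div_less[OF c] add_0_right point_code[OF k])
  qed
  then show ?thesis by blast
qed

section \<open>Decidability of conditions on tables\<close>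

definition computable_seq :: "(nat \<Rightarrow> nat \<Rightarrow> nat) \<Rightarrow> bool" where
  "computable_seq K \<longleftrightarrow> computable_fun (\<lambda>z. K (p1 z) (p2 z))"

lemma computable_seq_apply:
  assumes "computable_seq K" "computable_fun f" "computable_fun i"
  shows "computable_fun (\<lambda>z. K (f z) (i z))"
  using computable_comp[OF assms(1)[unfolded computable_seq_def] computable_pair[OF assms(2,3)]] by simp

lemma computable_seq_comp:
  assumes "computable_seq K" "computable_fun f" shows "computable_seq (\<lambda>z. K (f z))"
  unfolding computable_seq_def
  by (intro computable_seq_apply[OF assms(1)] computable_comp[OF assms(2)] computable_intros)

lemma computable_digit:
  assumes "computable_fun B" "computable_fun c" "computable_fun i"
  shows "computable_fun (\<lambda>z. digit (B z) (c z) (i z))"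
  unfolding digit_def by (intro computable_intros assms)

lemma computable_seq_point:
  assumes "computable_fun B" "computable_fun c"
  shows "computable_seq (\<lambda>z. point p (B z) (c z))"
  unfolding computable_seq_def point_def
  by (intro computable_intros computable_digit computable_comp[OF assms(1)] computable_comp[OF assms(2)])

lemma computable_code:
  assumes "computable_fun B" "computable_seq K"
  shows "computable_fun (\<lambda>z. code p (B z) (K z))"
  unfolding code_def
  by (intro computable_intros computable_seq_apply[OF assms(2)] computable_comp[OF assms(1)])

lemma computable_table:
  assumes "computable_fun s" "computable_fun n" "computable_fun l" "computable_seq K"
  shows "computable_fun (\<lambda>z. table (s z) p (n z) (l z) (K z))"
  unfolding table_def
  by (intro computable_entry computable_intros computable_code assms)

lemma computable_seq_face:
  assumes "computable_fun j" "computable_seq K"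
  shows "computable_seq (\<lambda>z. simplical_face (j z) (K z))"
  unfolding computable_seq_def simplical_face_def
  by (intro computable_intros computable_seq_apply[OF assms(2)] computable_comp[OF assms(1)])

lemma computable_seq_refine:
  assumes "computable_fun r" "computable_fun j" "computable_seq K"
  shows "computable_seq (\<lambda>z. refine (r z) (j z) (K z))"
  unfolding computable_seq_def refine_def
  by (intro computable_intros computable_seq_apply[OF assms(3)] computable_comp[OF assms(1)] computable_comp[OF assms(2)])

text \<open>Under the bounded quantifier the argument becomes a pair of the old argument and a code.
  For this reason the premise allows every computable point \<open>K\<close> and every computable
  change of parameter \<open>f\<close>; this also lets the rule be nested.\<close>

lemma decidable_ball_lattice:
  assumes \<Phi>: "\<And>K f. computable_seq K \<Longrightarrow> computable_fun f \<Longrightarrow> decidable (\<lambda>z. \<Phi> (f z) (K z))"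
    and n: "computable_fun n"
  shows "decidable (\<lambda>z. \<forall>k\<in>lattice p (n z). \<Phi> z k)"
  unfolding ball_lattice_iff
  by (intro computable_intros \<Phi> computable_seq_point computable_digit n computable_comp[OF n])

lemma neighbours_lattice_iff:
  assumes "k \<in> lattice p n" "k' \<in> lattice p n"
  shows "neighbours k k' \<longleftrightarrow>
    (\<forall>j<Suc p. sum k {..<j} \<le> sum k' {..<j} + 1 \<and> sum k' {..<j} \<le> sum k {..<j} + 1)"
proof -
  have "sum k {..<j} = n" if "k \<in> lattice p n" "j \<ge> Suc p" for k j
  proof -
    have "sum k {..<j} = sum k {..p}"
      using that by (intro sum.mono_neutral_right) (auto simp: lattice_def)
    then show ?thesis using that by (simp add: lattice_def)
  qed
  then show ?thesis unfolding neighbours_def using assms by (metis le_add1 not_less)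
qed

lemma admissible_iff:
  "admissible A p n f \<longleftrightarrow> (\<forall>k\<in>lattice p n. \<forall>k'\<in>lattice p n.
    (\<forall>j<Suc p. sum k {..<j} \<le> sum k' {..<j} + 1 \<and> sum k' {..<j} \<le> sum k {..<j} + 1) \<longrightarrow> A (f k) (f k'))"
  unfolding admissible_def using neighbours_lattice_iff by (intro ball_cong refl) simp

text \<open>\<open>A\<close> is arbitrary but finite, so its truth table is stored in a constant
  \<open>a\<close>. Here the complex enters as non-uniform data.\<close>

lemma decidable_finite_relation:
  assumes A: "\<And>i j. A i j \<Longrightarrow> i < m \<and> j < m" and "computable_fun f" "computable_fun g"
  shows "decidable (\<lambda>z. A (f z) (g z))"
proof -
  obtain a where a: "\<And>i. i < m * m \<Longrightarrow> entry a i = (if A (i div m) (i mod m) then 1 else 0)"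
    using entry_exists[of "m * m" "\<lambda>i. if A (i div m) (i mod m) then 1 else 0"] by blast
  have "A u v \<longleftrightarrow> u < m \<and> v < m \<and> entry a (u * m + v) = 1" for u v
  proof (cases "u < m \<and> v < m")
    case True
    have "u * m + v < Suc u * m" using True by simp
    also have "\<dots> \<le> m * m" using True by (intro mult_le_mono1) simp
    finally show ?thesis using a[of "u * m + v"] True by simp
  qed (use A in auto)
  then show ?thesis
    by (simp only:) (intro computable_intros computable_entry assms)
qed

lemma decidable_admissible:
  assumes A: "\<And>i j. A i j \<Longrightarrow> i < m \<and> j < m"
    and c: "computable_fun s" "computable_fun n" "computable_fun l"
  shows "decidable (\<lambda>z. admissible A p (n z) (table (s z) p (n z) (l z)))"
  unfolding admissible_iff
proof (rule decidable_ball_lattice[OF _ c(2)])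
  fix K f assume K: "computable_seq K" "computable_fun f"
  show "decidable (\<lambda>z. \<forall>k'\<in>lattice p (n (f z)).
     (\<forall>j<Suc p. sum (K z) {..<j} \<le> sum k' {..<j} + 1 \<and> sum k' {..<j} \<le> sum (K z) {..<j} + 1) \<longrightarrow>
     A (table (s (f z)) p (n (f z)) (l (f z)) (K z)) (table (s (f z)) p (n (f z)) (l (f z)) k'))"
  proof (rule decidable_ball_lattice[OF _ computable_comp[OF c(2) K(2)]])
    fix K' f' assume K': "computable_seq K'" "computable_fun f'"
    note f = computable_comp[OF K(2) K'(2)]
    note k = computable_seq_comp[OF K(1) K'(2)]
    have 1: "computable_fun (\<lambda>z. table (s (f (f' z))) p (n (f (f' z))) (l (f (f' z))) (K (f' z)))"
      by (rule computable_table[OF computable_comp[OF c(1) f] computable_comp[OF c(2) f] computable_comp[OF c(3) f] k])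
    have 2: "computable_fun (\<lambda>z. table (s (f (f' z))) p (n (f (f' z))) (l (f (f' z))) (K' z))"
      by (rule computable_table[OF computable_comp[OF c(1) f] computable_comp[OF c(2) f] computable_comp[OF c(3) f] K'(1)])
    have 3: "computable_fun (\<lambda>z. sum (H (p1 z)) {..<p2 z})" if "computable_seq H" for H
      by (intro computable_sum computable_seq_apply[OF that] computable_p1 computable_p2 computable_id)
    show "decidable (\<lambda>z. (\<forall>j<Suc p. sum (K (f' z)) {..<j} \<le> sum (K' z) {..<j} + 1 \<and> sum (K' z) {..<j} \<le> sum (K (f' z)) {..<j} + 1) \<longrightarrow>
       A (table (s (f (f' z))) p (n (f (f' z))) (l (f (f' z))) (K (f' z))) (table (s (f (f' z))) p (n (f (f' z))) (l (f (f' z))) (K' z)))"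
      by (intro decidable_imp decidable_finite_relation[OF A 1 2] decidable_ball decidable_conj decidable_le
          computable_add computable_const 3[OF k] 3[OF K'(1)])
  qed
qed

text \<open>The resampling rule with the cutoff \<open>m\<close>, which makes the search end for
  every \<open>f\<close>, hence total. For realizations of admissible tables the result stays below
  the cutoff and is the sampled vertex.\<close>

definition least_count :: "nat \<Rightarrow> nat \<Rightarrow> (nat \<Rightarrow> nat) \<Rightarrow> nat" where
  "least_count m r f = (LEAST i. m \<le> i \<or> r \<le> m * (\<Sum>j<r. if f j = i then 1 else 0))"

lemma computable_least_count:
  assumes r: "computable_fun r" and f: "computable_seq f"
  shows "computable_fun (\<lambda>z. least_count m (r z) (f z))"
  unfolding least_count_def
proof (rule computable_LEAST)
  show "decidable (\<lambda>z. m \<le> p2 z \<or> r (p1 z) \<le> m * (\<Sum>j<r (p1 z). if f (p1 z) j = p2 z then 1 else 0))"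
    by (intro computable_intros computable_comp[OF r] computable_seq_apply[OF f])
  show "\<exists>t. m \<le> t \<or> r n \<le> m * (\<Sum>j<r n. if f n j = t then 1 else 0)" for n by blast
qed

lemma sample_realize_eq_least_count:
  assumes A: "\<And>i j. A i j \<Longrightarrow> i < m \<and> j < m" and F: "admissible A p n F"
    and r: "r > 0" "n > 0" "m > 0" and k: "k \<in> lattice p (n * r)"
  shows "sample m (n * r) (realize p n F) k = least_count m r (\<lambda>j. F (refine r j k))"
proof -
  let ?P = "\<lambda>i. r \<le> m * card {j. j < r \<and> F (refine r j k) = i}"
  have c: "card {j. j < r \<and> F (refine r j k) = i} = (\<Sum>j<r. if F (refine r j k) = i then 1 else 0)" for i
    by (simp add: sum.If_cases Int_def)
  have t: "(\<lambda>i. real (k i) / real (n * r)) \<in> standard_simplex p"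
    using lattice_point_simplex[OF k] r by simp
  note y = realize_simplex[OF A F t]
  have s: "sample m (n * r) (realize p n F) k = (LEAST i. ?P i)"
    by (rule sample_realize[OF r(1,2) k r(3)])
  have lt: "(LEAST i. ?P i) < m"
    unfolding s[symmetric] sample_def by (rule top_vertex(2)[OF y r(3)])
  have ex: "?P (LEAST i. ?P i)"
  proof -
    have "1 / real m \<le> realize p n F (\<lambda>i. real (k i) / real (n * r)) (LEAST i. ?P i)"
      using top_vertex(1)[OF y r(3)] s unfolding sample_def by simp
    then show ?thesis
      unfolding realize_lattice_point[OF r(1,2) k] using r by (simp add: field_simps flip: of_nat_mult)
  qed
  have "(LEAST i. ?P i) = (LEAST i. m \<le> i \<or> ?P i)"
  proof (rule Least_equality[symmetric])
    show "m \<le> (LEAST i. ?P i) \<or> ?P (LEAST i. ?P i)" using ex by blast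
    fix i assume "m \<le> i \<or> ?P i"
    then show "(LEAST i. ?P i) \<le> i" using lt by (auto intro: Least_le)
  qed
  then show ?thesis unfolding s least_count_def c .
qed

text \<open>Each value is charged to its first index. The sum over an image set turns into a bounded
  sum that requires only equality tests.\<close>

lemma family_norm_first:
  fixes N :: nat
  shows "family_norm {..<N} w \<tau> =
    (\<Sum>i<N. if \<exists>i'<i. \<tau> i' = \<tau> i then 0 else \<bar>\<Sum>j<N. if \<tau> j = \<tau> i then w j else 0\<bar>)"
proof -
  define S where "S = {i. i < N \<and> (\<forall>i'<i. \<tau> i' \<noteq> \<tau> i)}"
  have inj: "inj_on \<tau> S"
  proof (rule inj_onI)
    fix a b assume "a \<in> S" "b \<in> S" "\<tau> a = \<tau> b"
    then show "a = b" by (cases a b rule: linorder_cases) (auto simp: S_def)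
  qed
  have "\<tau> ` {..<N} \<subseteq> \<tau> ` S"
  proof
    fix v assume "v \<in> \<tau> ` {..<N}"
    then have ex: "\<exists>i. i < N \<and> \<tau> i = v" by auto
    define i where "i = (LEAST i. i < N \<and> \<tau> i = v)"
    have i: "i < N" "\<tau> i = v" using LeastI_ex[OF ex] by (auto simp: i_def)
    have "\<tau> i' \<noteq> \<tau> i" if "i' < i" for i'
      using not_less_Least[of i' "\<lambda>i. i < N \<and> \<tau> i = v"] that i unfolding i_def[symmetric] by auto
    then have "i \<in> S" using i by (simp add: S_def)
    then show "v \<in> \<tau> ` S" using i by blast
  qed
  then have img: "\<tau> ` {..<N} = \<tau> ` S" by (auto simp: S_def)
  have "family_norm {..<N} w \<tau> = (\<Sum>i\<in>S. \<bar>\<Sum>j | j \<in> {..<N} \<and> \<tau> j = \<tau> i. w j\<bar>)"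
    unfolding family_norm_def img by (subst sum.reindex[OF inj]) simp
  also have "\<dots> = (\<Sum>i\<in>S. \<bar>\<Sum>j<N. if \<tau> j = \<tau> i then w j else 0\<bar>)"
    by (rule sum.cong[OF refl], rule arg_cong[where f = abs], rule sum.inter_filter) simp
  also have "\<dots> = (\<Sum>i<N. if \<exists>i'<i. \<tau> i' = \<tau> i then 0 else \<bar>\<Sum>j<N. if \<tau> j = \<tau> i then w j else 0\<bar>)"
    by (rule sum.mono_neutral_cong_left) (auto simp: S_def)
  finally show ?thesis .
qed

text \<open>The value at the point \<open>k\<close> of the member \<open>j\<close>: resampled from
  the stored cycle \<open>f\<close> for \<open>j < I\<close>, and otherwise read from a face of a
  table in \<open>s\<close>.\<close>

definition vertex :: "nat \<Rightarrow> nat \<Rightarrow> nat \<Rightarrow> nat \<Rightarrow> nat \<Rightarrow> nat \<Rightarrow> nat \<Rightarrow> nat \<Rightarrow> (nat \<Rightarrow> nat) \<Rightarrow> nat" where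
  "vertex d m n0 I f s r j k = (if j < I then least_count m r (\<lambda>t. table f d n0 j (refine r t k))
     else table s (Suc d) (n0 * r) ((j - I) div (d + 2)) (simplical_face ((j - I) mod (d + 2)) k))"

definition agree :: "nat \<Rightarrow> nat \<Rightarrow> nat \<Rightarrow> nat \<Rightarrow> nat \<Rightarrow> nat \<Rightarrow> nat \<Rightarrow> nat \<Rightarrow> nat \<Rightarrow> bool" where
  "agree d m n0 I f s r i j \<longleftrightarrow> (\<forall>k\<in>lattice d (n0 * r). vertex d m n0 I f s r i k = vertex d m n0 I f s r j k)"

text \<open>The nonnegative half of a signed weight. Exchanging \<open>sp\<close> with
  \<open>sn\<close>, and \<open>zp\<close> with \<open>zn\<close>, gives the half to be subtracted;
  faces of odd index exchange the roles of \<open>sp\<close> and \<open>sn\<close>.\<close>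

definition weight_part :: "nat \<Rightarrow> nat \<Rightarrow> nat \<Rightarrow> nat \<Rightarrow> nat \<Rightarrow> nat \<Rightarrow> nat \<Rightarrow> nat" where
  "weight_part d I zp q sp sn j = (if j < I then q * entry zp j
     else if (j - I) mod (d + 2) mod 2 = 0 then entry sp ((j - I) div (d + 2)) else entry sn ((j - I) div (d + 2)))"

definition part_sum where
  "part_sum d m n0 I f s r zp q sp sn L i =
     (\<Sum>j<I + L * (d + 2). if agree d m n0 I f s r j i then weight_part d I zp q sp sn j else 0)"

text \<open>The two truncated differences of the part sums add up to their absolute difference; a
  member equal to an earlier one counts 0.\<close>

definition code_norm where
  "code_norm d m n0 I f zp zn r q L s sp sn = (\<Sum>i<I + L * (d + 2).
     if \<exists>i'<i. agree d m n0 I f s r i' i then 0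
     else (part_sum d m n0 I f s r zp q sp sn L i - part_sum d m n0 I f s r zn q sn sp L i) +
          (part_sum d m n0 I f s r zn q sn sp L i - part_sum d m n0 I f s r zp q sp sn L i))"

lemma computable_vertex:
  assumes "computable_fun s" "computable_fun r" "computable_fun j" "computable_seq K"
  shows "computable_fun (\<lambda>z. vertex d m n0 I f (s z) (r z) (j z) (K z))"
proof -
  have "computable_seq (\<lambda>z t. table f d n0 (j z) (refine (r z) t (K z)))"
    unfolding computable_seq_def
    by (intro computable_table computable_intros computable_seq_refine computable_comp[OF assms(2)]
        computable_comp[OF assms(3)] computable_seq_comp[OF assms(4)])
  then show ?thesis
    unfolding vertex_def
    by (intro computable_intros computable_least_count computable_table computable_seq_face assms)
qed

lemma decidable_agree:
  assumes "computable_fun s" "computable_fun r" "computable_fun i" "computable_fun j"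
  shows "decidable (\<lambda>z. agree d m n0 I f (s z) (r z) (i z) (j z))"
  unfolding agree_def
proof (rule decidable_ball_lattice)
  fix K g assume K: "computable_seq K" and g: "computable_fun g"
  show "decidable (\<lambda>z. vertex d m n0 I f (s (g z)) (r (g z)) (i (g z)) (K z) = vertex d m n0 I f (s (g z)) (r (g z)) (j (g z)) (K z))"
    by (intro decidable_eq computable_vertex K computable_comp[OF assms(1) g] computable_comp[OF assms(2) g]
        computable_comp[OF assms(3) g] computable_comp[OF assms(4) g])
qed (intro computable_intros assms)

lemma computable_weight_part:
  assumes "computable_fun q" "computable_fun sp" "computable_fun sn" "computable_fun j"
  shows "computable_fun (\<lambda>z. weight_part d I zp (q z) (sp z) (sn z) (j z))"
  unfolding weight_part_def by (intro computable_intros computable_entry assms)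

lemma computable_part_sum:
  assumes "computable_fun s" "computable_fun r" "computable_fun q" "computable_fun sp" "computable_fun sn"
    "computable_fun L" "computable_fun i"
  shows "computable_fun (\<lambda>z. part_sum d m n0 I f (s z) (r z) zp (q z) (sp z) (sn z) (L z) (i z))"
  unfolding part_sum_def
  by (rule computable_sum)
     (intro computable_if decidable_agree computable_weight_part computable_intros assms
        computable_comp[OF assms(1)] computable_comp[OF assms(2)] computable_comp[OF assms(3)]
        computable_comp[OF assms(4)] computable_comp[OF assms(5)] computable_comp[OF assms(7)])+

lemma computable_code_norm:
  assumes "computable_fun r" "computable_fun q" "computable_fun L" "computable_fun s" "computable_fun sp" "computable_fun sn"
  shows "computable_fun (\<lambda>z. code_norm d m n0 I f zp zn (r z) (q z) (L z) (s z) (sp z) (sn z))"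
  unfolding code_norm_def
  by (rule computable_sum)
     (intro computable_if decidable_bex decidable_agree computable_part_sum computable_intros assms
        computable_comp[OF assms(1)] computable_comp[OF assms(2)] computable_comp[OF assms(3)]
        computable_comp[OF assms(4)] computable_comp[OF assms(5)] computable_comp[OF assms(6)])+

lemma code_norm_eq_family_norm:
  assumes "\<And>i j. i < I + L * (d + 2) \<Longrightarrow> j < I + L * (d + 2) \<Longrightarrow> agree d m n0 I f s r i j \<longleftrightarrow> \<tau> i = \<tau> j"
    and "\<And>j. j < I + L * (d + 2) \<Longrightarrow> w j = int (weight_part d I zp q sp sn j) - int (weight_part d I zn q sn sp j)"
  shows "int (code_norm d m n0 I f zp zn r q L s sp sn) = family_norm {..<I + L * (d + 2)} w \<tau>"
proof -
  let ?N = "I + L * (d + 2)"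
  let ?P = "part_sum d m n0 I f s r zp q sp sn L" and ?Q = "part_sum d m n0 I f s r zn q sn sp L"
  have w: "(\<Sum>j<?N. if \<tau> j = \<tau> i then w j else 0) = int (?P i) - int (?Q i)" if "i < ?N" for i
    unfolding part_sum_def of_nat_sum sum_subtractf[symmetric]
    by (rule sum.cong) (use assms that in auto)
  have "(\<exists>i'<i. \<tau> i' = \<tau> i) = (\<exists>i'<i. agree d m n0 I f s r i' i)" if "i < ?N" for i
    using assms(1) that by (meson order.strict_trans)
  note e = this
  show ?thesis
    unfolding family_norm_first code_norm_def of_nat_sum
  proof (rule sum.cong)
    fix i assume "i \<in> {..<?N}"
    then have i: "i < ?N" by simp
    show "int (if \<exists>i'<i. agree d m n0 I f s r i' i then 0 else (?P i - ?Q i) + (?Q i - ?P i)) =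
      (if \<exists>i'<i. \<tau> i' = \<tau> i then 0 else \<bar>\<Sum>j<?N. if \<tau> j = \<tau> i then w j else 0\<bar>)"
      unfolding w[OF i] e[OF i] by (cases "?P i \<le> ?Q i") (auto simp: of_nat_diff)
  qed simp
qed

lemma least_count_cong:
  assumes "\<And>j. j < r \<Longrightarrow> f j = g j" shows "least_count m r f = least_count m r g"
proof -
  have "(\<Sum>j<r. if f j = i then 1 else 0 :: nat) = (\<Sum>j<r. if g j = i then 1 else 0)" for i
    using assms by (intro sum.cong) auto
  then show ?thesis by (simp add: least_count_def)
qed

lemma small_table_norm_table_iff:
  assumes A: "\<And>i j. A i j \<Longrightarrow> i < m \<and> j < m" and pos: "m > 0" "n0 > 0" "r > 0"
    and F: "\<And>i. i < I \<Longrightarrow> admissible A d n0 (F i)"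
    and f: "\<And>i k. i < I \<Longrightarrow> k \<in> lattice d n0 \<Longrightarrow> table f d n0 i k = F i k"
    and \<zeta>: "\<And>i. i < I \<Longrightarrow> \<zeta> i = int (entry zp i) - int (entry zn i)"
  shows "small_table_norm d m A n0 I F \<zeta> q r L (table s (Suc d) (n0 * r)) (\<lambda>l. int (entry sp l) - int (entry sn l)) x \<longleftrightarrow>
    (\<forall>l<L. admissible A (Suc d) (n0 * r) (table s (Suc d) (n0 * r) l)) \<and>
    real (code_norm d m n0 I f zp zn r q L s sp sn) < real q * x"
proof -
  let ?n = "n0 * r"
  define T where "T = face_family d I (\<lambda>i. sample m ?n (realize d n0 (F i))) (\<lambda>k l. table s (Suc d) ?n l \<circ> simplical_face k)"
  have v: "vertex d m n0 I f s r j k = T j k" if k: "k \<in> lattice d ?n" for j k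
  proof (cases "j < I")
    case True
    have "least_count m r (\<lambda>t. table f d n0 j (refine r t k)) = least_count m r (\<lambda>t. F j (refine r t k))"
      by (rule least_count_cong) (rule f[OF True refine_lattice[OF pos(3) k]])
    then show ?thesis
      using sample_realize_eq_least_count[OF A F[OF True] pos(3,2,1) k] True
      by (simp add: vertex_def T_def face_family_def)
  qed (simp add: vertex_def T_def face_family_def)
  have ag: "agree d m n0 I f s r i j \<longleftrightarrow> restrict (T i) (lattice d ?n) = restrict (T j) (lattice d ?n)" for i j
  proof -
    have "agree d m n0 I f s r i j \<longleftrightarrow> (\<forall>k\<in>lattice d ?n. T i k = T j k)"
      unfolding agree_def using v by (intro ball_cong refl) simp
    also have "\<dots> \<longleftrightarrow> restrict (T i) (lattice d ?n) = restrict (T j) (lattice d ?n)"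
      by (auto simp: restrict_def fun_eq_iff)
    finally show ?thesis .
  qed
  have wt: "face_weight d I q \<zeta> (\<lambda>l. int (entry sp l) - int (entry sn l)) j =
      int (weight_part d I zp q sp sn j) - int (weight_part d I zn q sn sp j)" for j
  proof (cases "j < I")
    case True
    then show ?thesis by (simp add: face_weight_def weight_part_def \<zeta>[OF True] right_diff_distrib)
  next
    case False
    show ?thesis
    proof (cases "even ((j - I) mod (d + 2))")
      case True
      then show ?thesis using False by (simp add: face_weight_def weight_part_def even_iff_mod_2_eq_zero)
    next
      case odd: False
      then have "(j - I) mod (d + 2) mod 2 = 1" by presburger
      then show ?thesis using False odd by (simp add: face_weight_def weight_part_def)
    qed
  qed
  have "int (code_norm d m n0 I f zp zn r q L s sp sn) =
    family_norm {..<I + L * (d + 2)} (face_weight d I q \<zeta> (\<lambda>l. int (entry sp l) - int (entry sn l))) (\<lambda>j. restrict (T j) (lattice d ?n))"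
    by (rule code_norm_eq_family_norm[OF ag wt])
  then show ?thesis unfolding small_table_norm_def T_def[symmetric] by (metis of_int_of_nat_eq)
qed

lemma int_seq_exists: "\<exists>sp sn. \<forall>l<L. \<beta> l = int (entry sp l) - int (entry sn l)"
proof -
  obtain sp sn where s: "\<And>l. l < L \<Longrightarrow> entry sp l = nat (\<beta> l)" "\<And>l. l < L \<Longrightarrow> entry sn l = nat (- \<beta> l)"
    using entry_exists[of L "\<lambda>l. nat (\<beta> l)"] entry_exists[of L "\<lambda>l. nat (- \<beta> l)"] by metis
  have "\<beta> l = int (entry sp l) - int (entry sn l)" if "l < L" for l
    unfolding s[OF that] by (cases "\<beta> l \<ge> 0") auto
  then show ?thesis by blast
qed

lemma small_table_norm_cong:
  assumes tab: "\<And>l k. l < L \<Longrightarrow> k \<in> lattice (Suc d) (n0 * r) \<Longrightarrow> tab l k = tab' l k"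
    and \<beta>: "\<And>l. l < L \<Longrightarrow> \<beta> l = \<beta>' l"
  shows "small_table_norm d m A n0 I F \<zeta> q r L tab \<beta> x \<longleftrightarrow> small_table_norm d m A n0 I F \<zeta> q r L tab' \<beta>' x"
proof -
  have div: "(j - I) div (d + 2) < L" if "j < I + L * (d + 2)" "\<not> j < I" for j
    using that by (intro less_mult_imp_div_less) simp
  have "admissible A (Suc d) (n0 * r) (tab l) \<longleftrightarrow> admissible A (Suc d) (n0 * r) (tab' l)" if "l < L" for l
    unfolding admissible_def using tab[OF that] by simp
  moreover have "family_norm {..<I + L * (d + 2)} (face_weight d I q \<zeta> \<beta>)
       (\<lambda>j. restrict (face_family d I S (\<lambda>k l. tab l \<circ> simplical_face k) j) (lattice d (n0 * r))) =
     family_norm {..<I + L * (d + 2)} (face_weight d I q \<zeta> \<beta>')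
       (\<lambda>j. restrict (face_family d I S (\<lambda>k l. tab' l \<circ> simplical_face k) j) (lattice d (n0 * r)))" for S
  proof (rule family_norm_cong)
    fix j assume "j \<in> {..<I + L * (d + 2)}"
    then have j: "j < I + L * (d + 2)" by simp
    show "face_weight d I q \<zeta> \<beta> j = face_weight d I q \<zeta> \<beta>' j"
      using \<beta>[OF div[OF j]] by (simp add: face_weight_def)
    show "restrict (face_family d I S (\<lambda>k l. tab l \<circ> simplical_face k) j) (lattice d (n0 * r)) =
        restrict (face_family d I S (\<lambda>k l. tab' l \<circ> simplical_face k) j) (lattice d (n0 * r))"
    proof (rule restrict_ext)
      fix k assume k: "k \<in> lattice d (n0 * r)"
      have "simplical_face ((j - I) mod (d + 2)) k \<in> lattice (Suc d) (n0 * r)"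
        using mod_less_divisor[of "d + 2" "j - I"] by (intro simplical_face_lattice[OF k]) linarith
      then show "face_family d I S (\<lambda>k l. tab l \<circ> simplical_face k) j k = face_family d I S (\<lambda>k l. tab' l \<circ> simplical_face k) j k"
        using tab[OF div[OF j]] by (simp add: face_family_def)
    qed
  qed
  ultimately show ?thesis unfolding small_table_norm_def by simp
qed

lemma finite_cycle_fine_level:
  assumes A: "\<And>i j. A i j \<Longrightarrow> i < m \<and> j < m" and m: "m > 0"
    and c: "singular_chain d (top_of_set (flag_complex m A)) c"
  shows "\<exists>N. \<forall>n\<ge>N. \<forall>\<sigma>\<in>Poly_Mapping.keys c. fine_level m A d n \<sigma>"
proof -
  have "\<forall>\<sigma>\<in>Poly_Mapping.keys c. \<exists>N. \<forall>n\<ge>N. fine_level m A d n \<sigma>"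
    using c by (auto simp: singular_chain_def intro!: eventually_fine[OF A m])
  then obtain N where N: "\<And>\<sigma> n. \<sigma> \<in> Poly_Mapping.keys c \<Longrightarrow> n \<ge> N \<sigma> \<Longrightarrow> fine_level m A d n \<sigma>" by metis
  have "N \<sigma> \<le> (\<Sum>\<sigma>\<in>Poly_Mapping.keys c. N \<sigma>)" if "\<sigma> \<in> Poly_Mapping.keys c" for \<sigma>
    using that by (intro member_le_sum) auto
  then show ?thesis using N by (meson le_trans)
qed

text \<open>After \<open>w0\<close> is replaced by a cycle of realized tables, its labels
  \<open>f\<close>, coefficients \<open>zp\<close>, \<open>zn\<close> and the bound
  \<open>r1\<close> are constants. The search runs over the level factor \<open>r\<close>, the
  scaling \<open>q\<close> and the coded filling \<open>L\<close>, \<open>s\<close>,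
  \<open>sp\<close>, \<open>sn\<close>; every tested condition is decidable.\<close>

lemma enumerable_volume_flag_complex:
  assumes A: "\<And>i j. A i j \<Longrightarrow> i < m \<and> j < m" and m: "m > 0"
    and cyc: "singular_relcycle d (top_of_set (flag_complex m A)) {} w0"
  shows "enumerable (\<lambda>z. p2 z > 0 \<and> volume_below d (top_of_set (flag_complex m A)) w0 (real (p1 z) / real (p2 z)))"
proof -
  let ?X = "top_of_set (flag_complex m A)"
  obtain N where N: "\<And>n \<sigma>. n \<ge> N \<Longrightarrow> \<sigma> \<in> Poly_Mapping.keys w0 \<Longrightarrow> fine_level m A d n \<sigma>"
  proof -
    have "\<exists>N. \<forall>n\<ge>N. \<forall>\<sigma>\<in>Poly_Mapping.keys w0. fine_level m A d n \<sigma>"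
      by (rule finite_cycle_fine_level[OF _ m]) (use A cyc in \<open>auto simp: singular_cycle\<close>)
    then show ?thesis using that by blast
  qed
  define n0 where "n0 = Suc N"
  have n0: "n0 > 0" by (simp add: n0_def)
  have fl: "fine_level m A d n0 \<sigma>" if "\<sigma> \<in> Poly_Mapping.keys w0" for \<sigma>
    using N[of n0] that by (simp add: n0_def)
  obtain \<sigma>s where \<sigma>s: "set \<sigma>s = Poly_Mapping.keys w0"
    "w0 = (\<Sum>i<length \<sigma>s. frag_cmul (poly_mapping.lookup w0 (\<sigma>s ! i)) (frag_of (\<sigma>s ! i)))"
    by (rule frag_as_list_sum)
  define I where "I = length \<sigma>s"
  define \<zeta> where "\<zeta> i = poly_mapping.lookup w0 (\<sigma>s ! i)" for i
  define F where "F i = sample m n0 (\<sigma>s ! i)" for i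
  have F: "admissible A d n0 (F i)" if "i < I" for i
    using fl[of "\<sigma>s ! i"] that \<sigma>s(1) nth_mem[of i \<sigma>s] by (simp add: F_def I_def fine_level_def)
  define w where "w = (\<Sum>i<I. frag_cmul (\<zeta> i) (frag_of (realize d n0 (F i))))"
  have w: "frag_extend (frag_of \<circ> (\<lambda>\<sigma>. realize d n0 (sample m n0 \<sigma>))) w0 = w"
    unfolding w_def \<zeta>_def F_def I_def
    by (subst \<sigma>s(2)) (simp add: frag_extend_sum frag_extend_cmul o_def)
  have hom: "homologous_rel d ?X {} w0 w"
    unfolding w[symmetric] by (rule homologous_realize_sample[OF A cyc fl])
  then have cycw: "singular_relcycle d ?X {} w"
    using cyc homologous_rel_singular_relcycle by blast
  obtain r1 where r1: "\<And>n \<sigma>. n \<ge> r1 \<Longrightarrow> \<sigma> \<in> Poly_Mapping.keys w \<Longrightarrow> fine_level m A d n \<sigma>"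
  proof -
    have "\<exists>N. \<forall>n\<ge>N. \<forall>\<sigma>\<in>Poly_Mapping.keys w. fine_level m A d n \<sigma>"
      by (rule finite_cycle_fine_level[OF _ m]) (use A cycw in \<open>auto simp: singular_cycle\<close>)
    then show ?thesis using that by blast
  qed
  have r1': "fine_level m A d (n0 * r) \<sigma>" if "r \<ge> r1" "\<sigma> \<in> Poly_Mapping.keys w" for r \<sigma>
  proof (rule r1[OF _ that(2)])
    have "r \<le> n0 * r" using n0 by simp
    with that(1) show "r1 \<le> n0 * r" by (rule le_trans)
  qed
  obtain f where f: "\<And>i k. i < I \<Longrightarrow> k \<in> lattice d n0 \<Longrightarrow> table f d n0 i k = F i k"
    using table_exists[of I d n0 F] by blast
  obtain zp zn where z: "\<And>i. i < I \<Longrightarrow> \<zeta> i = int (entry zp i) - int (entry zn i)"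
    using int_seq_exists[of I \<zeta>] by blast
  have vol: "volume_below d ?X w0 x \<longleftrightarrow> volume_below d ?X w x" for x
    using volume_below_homologous[OF hom] volume_below_homologous[of d ?X w w0] hom
    by (metis homologous_rel_sym)
  have tabs: "volume_below d ?X w x \<longleftrightarrow>
      (\<exists>r q L tab \<beta>. r \<ge> r1 \<and> r > 0 \<and> q > 0 \<and> small_table_norm d m A n0 I F \<zeta> q r L tab \<beta> x)" for x
  proof (rule volume_below_iff_tables[OF _ m n0 w_def cycw])
    show "i < m \<and> j < m" if "A i j" for i j by (rule A[OF that])
    show "fine_level m A d (n0 * r) \<sigma>" if "r1 \<le> r" "\<sigma> \<in> Poly_Mapping.keys w" for r \<sigma> by (rule r1'[OF that])
  qed
  have norm: "small_table_norm d m A n0 I F \<zeta> q r L (table s (Suc d) (n0 * r)) (\<lambda>l. int (entry sp l) - int (entry sn l)) x \<longleftrightarrow>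
    (\<forall>l<L. admissible A (Suc d) (n0 * r) (table s (Suc d) (n0 * r) l)) \<and>
    real (code_norm d m n0 I f zp zn r q L s sp sn) < real q * x" if "r > 0" for q r L s sp sn x
  proof (rule small_table_norm_table_iff[OF _ m n0 that])
    show "i < m \<and> j < m" if "A i j" for i j by (rule A[OF that])
  qed (fact F f z)+
  have "volume_below d ?X w0 x \<longleftrightarrow> (\<exists>r q L s sp sn. r1 \<le> r \<and> 0 < r \<and> 0 < q \<and>
     (\<forall>l<L. admissible A (Suc d) (n0 * r) (table s (Suc d) (n0 * r) l)) \<and>
     real (code_norm d m n0 I f zp zn r q L s sp sn) < real q * x)" (is "_ \<longleftrightarrow> ?R") for x
  proof
    assume "volume_below d ?X w0 x"
    then obtain r q L tab \<beta> where *: "r \<ge> r1" "r > 0" "q > 0" "small_table_norm d m A n0 I F \<zeta> q r L tab \<beta> x"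
      unfolding vol tabs by blast
    obtain s where s: "\<And>l k. l < L \<Longrightarrow> k \<in> lattice (Suc d) (n0 * r) \<Longrightarrow> table s (Suc d) (n0 * r) l k = tab l k"
      using table_exists[of L "Suc d" "n0 * r" tab] by blast
    obtain sp sn where b: "\<And>l. l < L \<Longrightarrow> \<beta> l = int (entry sp l) - int (entry sn l)"
      using int_seq_exists[of L \<beta>] by blast
    have "small_table_norm d m A n0 I F \<zeta> q r L (table s (Suc d) (n0 * r)) (\<lambda>l. int (entry sp l) - int (entry sn l)) x"
    proof (rule iffD2[OF small_table_norm_cong *(4)])
      show "table s (Suc d) (n0 * r) l k = tab l k" if "l < L" "k \<in> lattice (Suc d) (n0 * r)" for l k
        by (rule s[OF that])
      show "int (entry sp l) - int (entry sn l) = \<beta> l" if "l < L" for l by (rule b[OF that, symmetric])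
    qed
    then show ?R
      unfolding norm[OF *(2)] using *(1-3) by blast
  next
    assume ?R
    then obtain r q L s sp sn where *: "r1 \<le> r" "0 < r" "0 < q"
     "small_table_norm d m A n0 I F \<zeta> q r L (table s (Suc d) (n0 * r)) (\<lambda>l. int (entry sp l) - int (entry sn l)) x"
      using norm by blast
    then show "volume_below d ?X w0 x"
      unfolding vol tabs by blast
  qed
  note eq = this
  \<comment> \<open>Clearing the positive denominator leaves a comparison of naturals.\<close>
  have "p2 z > 0 \<and> volume_below d ?X w0 (real (p1 z) / real (p2 z)) \<longleftrightarrow>
     p2 z > 0 \<and> (\<exists>r q L s sp sn. r1 \<le> r \<and> 0 < r \<and> 0 < q \<and>
     (\<forall>l<L. admissible A (Suc d) (n0 * r) (table s (Suc d) (n0 * r) l)) \<and>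
     code_norm d m n0 I f zp zn r q L s sp sn * p2 z < q * p1 z)" for z
  proof (cases "p2 z > 0")
    case True
    have "real c < real q * (real (p1 z) / real (p2 z)) \<longleftrightarrow> c * p2 z < q * p1 z" for c q
      using True by (simp add: field_simps flip: of_nat_mult)
    then show ?thesis unfolding eq by simp
  qed simp
  moreover have "enumerable (\<lambda>z. p2 z > 0 \<and> (\<exists>r q L s sp sn. r1 \<le> r \<and> 0 < r \<and> 0 < q \<and>
     (\<forall>l<L. admissible A (Suc d) (n0 * r) (table s (Suc d) (n0 * r) l)) \<and>
     code_norm d m n0 I f zp zn r q L s sp sn * p2 z < q * p1 z))"
    by (intro enumerable_conj enumerable_ex enumerable_decidable decidable_ball decidable_admissible[OF A]
        decidable_less decidable_le computable_mult computable_code_norm computable_const computable_p1 computable_p2 computable_id)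
  ultimately show ?thesis by presburger
qed

text \<open>Both \<open>\<phi>\<close> and \<open>G\<close> can only lower the norm, and the round
  trip returns to the homology class of \<open>z\<close>.\<close>

lemma volume_below_homotopy_retract:
  assumes \<phi>: "continuous_map M X \<phi>" and G: "continuous_map X M G"
    and hom: "homotopic_with (\<lambda>_. True) M M (G \<circ> \<phi>) id" and z: "singular_relcycle d M {} z"
  shows "volume_below d M z x \<longleftrightarrow> volume_below d X (chain_map d \<phi> z) x"
proof
  have chz: "singular_chain d M z" using z by (simp add: singular_cycle)
  show "volume_below d X (chain_map d \<phi> z) x" if "volume_below d M z x"
    by (rule volume_below_chain_map[OF \<phi> chz that])
  assume "volume_below d X (chain_map d \<phi> z) x"
  from volume_below_chain_map[OF G singular_chain_chain_map[OF chz \<phi>] this]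
  have "volume_below d M (chain_map d (G \<circ> \<phi>) z) x"
    by (simp add: chain_map_compose)
  moreover have "homologous_rel d M {} (chain_map d (G \<circ> \<phi>) z) (chain_map d id z)"
    by (rule homotopic_imp_homologous_rel_chain_maps[OF _ z]) (use hom in simp)
  moreover have "chain_map d id z = z" by (rule chain_map_ident[OF chz])
  ultimately show "volume_below d M z x" using volume_below_homologous by metis
qed

theorem enumerable_simplicial_volume:
  fixes M :: "'a topology"
  assumes M: "closed_connected_manifold d M" and \<mu>: "fundamental_class d M \<mu>"
  shows "enumerable (upper_cut (simplicial_volume d M \<mu>))"
proof -
  obtain e :: "'a \<Rightarrow> ambient" and U r where e: "continuous_map M euclidean e" "open U" "e ` topspace M \<subseteq> U"
    "continuous_map (top_of_set U) M r" "\<And>x. x \<in> topspace M \<Longrightarrow> r (e x) = x"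
    using closed_manifold_neighbourhood_retract[OF M] by blast
  have "compact_space M" "topspace M \<noteq> {}" using M by (auto simp: closed_connected_manifold_def)
  from dominated_by_flag_complex[OF this e] obtain m A \<phi> G where X: "m > 0" "\<And>i j. A i j \<Longrightarrow> i < m \<and> j < m"
    "continuous_map M (top_of_set (flag_complex m A)) \<phi>" "continuous_map (top_of_set (flag_complex m A)) M G"
    "homotopic_with (\<lambda>_. True) M M (G \<circ> \<phi>) id" by metis
  have "\<mu> \<in> carrier (homology_group (int d) M)" using \<mu> by (simp add: fundamental_class_def)
  then obtain z where z: "singular_relcycle d M {} z" "\<mu> = homologous_rel_set d M {} z"
    by (auto simp: carrier_relative_homology_group)
  have "upper_cut (simplicial_volume d M \<mu>) = (\<lambda>y. p2 y > 0 \<and> volume_below d (top_of_set (flag_complex m A)) (chain_map d \<phi> z) (real (p1 y) / real (p2 y)))"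
    unfolding upper_cut_def simplicial_volume_less_iff[OF z] volume_below_homotopy_retract[OF X(3-5) z(1)] ..
  moreover have "singular_relcycle d (top_of_set (flag_complex m A)) {} (chain_map d \<phi> z)"
    by (rule singular_relcycle_chain_map[OF z(1) X(3)]) simp
  ultimately show ?thesis
    using enumerable_volume_flag_complex[OF X(2) X(1)] by simp
qed

section \<open>Dividing a cut by a computable real\<close>

text \<open>The integer coding sends nonnegative \<open>n\<close> to \<open>2 * n\<close> and
  negative numbers to odd codes, so positivity can be read off the numerator's code.\<close>

lemma positive_rat_code:
  assumes "0 < x"
  obtains a where "0 < a" "p1 (rat_code x) = 2 * a" "0 < p2 (rat_code x)"
    "real_of_rat x = real a / real (p2 (rat_code x))"
proof -
  obtain n d where nd: "quotient_of x = (n, d)" by (cases "quotient_of x")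
  have d: "d > 0" using quotient_of_denom_pos[OF nd] .
  have x: "x = of_int n / of_int d" using quotient_of_div[OF nd] .
  then have n: "n > 0" using assms d by (simp add: zero_less_divide_iff)
  have p: "p1 (rat_code x) = 2 * nat n" "p2 (rat_code x) = nat d"
    using n nd by (simp_all add: rat_code_def int_encode_def sum_encode_def)
  have r: "real_of_rat x = real (nat n) / real (nat d)"
    using n d by (simp add: x of_rat_divide)
  show ?thesis
    by (rule that[of "nat n"]) (use n d in \<open>simp_all add: p r\<close>)
qed

lemma even_rat_code_positive:
  assumes "even (p1 (rat_code x))" "0 < p1 (rat_code x)" shows "0 < x"
proof -
  obtain n d where nd: "quotient_of x = (n, d)" by (cases "quotient_of x")
  have d: "d > 0" using quotient_of_denom_pos[OF nd] .
  have "p1 (rat_code x) = int_encode n" using nd by (simp add: rat_code_def)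
  then have "n > 0" using assms by (auto simp: int_encode_def sum_encode_def split: if_splits)
  then show ?thesis using quotient_of_div[OF nd] d by simp
qed

text \<open>For a positive fraction q, \<open>\<alpha> < q\<close> holds iff
  \<open>c * \<alpha> < u * q\<close> for some positive rational \<open>u < c\<close>. The lower cut
  of \<open>c\<close> enumerates such \<open>u\<close>, and the product inequality is an instance of
  the cut of \<open>\<beta>\<close>.\<close>

lemma enumerable_upper_cut_quotient:
  assumes c: "computable_real c" "c > 0" and \<beta>: "enumerable (upper_cut \<beta>)" and eq: "\<beta> = c * \<alpha>" and \<alpha>: "\<alpha> \<ge> 0"
  shows "enumerable (upper_cut \<alpha>)"
proof -
  define C where "C = rat_code ` {x. real_of_rat x < c}"
  have C: "enumerable (\<lambda>n. n \<in> C)"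
    using c(1) re_set_imp_enumerable by (simp add: computable_real_def re_rat_set_def C_def)
  have "upper_cut \<alpha> z \<longleftrightarrow> 0 < p2 z \<and> (\<exists>N. N \<in> C \<and> (p1 N mod 2 = 0 \<and> 0 < p1 N \<and> 0 < p2 N) \<and>
     upper_cut \<beta> (pair (p1 z * (p1 N div 2)) (p2 z * p2 N)))" for z
  proof
    assume "upper_cut \<alpha> z"
    then have z: "0 < p2 z" "\<alpha> < real (p1 z) / real (p2 z)" by (auto simp: upper_cut_def)
    define q where "q = real (p1 z) / real (p2 z)"
    have q: "\<alpha> < q" "0 < q" using z \<alpha> by (auto simp: q_def)
    \<comment> \<open>The strict gap leaves room for a rational \<open>u\<close>, which is positive
      because the left side is nonnegative.\<close>
    have "c * \<alpha> / q < c" using q c(2) by (simp add: field_simps)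
    then obtain u where u: "c * \<alpha> / q < real_of_rat u" "real_of_rat u < c" using of_rat_dense by blast
    have "0 \<le> c * \<alpha> / q" using c(2) \<alpha> q by simp
    then have "0 < u" using u(1) by (metis of_rat_0 of_rat_less order_le_less_trans)
    then obtain a where a: "0 < a" "p1 (rat_code u) = 2 * a" "0 < p2 (rat_code u)"
      "real_of_rat u = real a / real (p2 (rat_code u))" by (rule positive_rat_code)
    have "c * \<alpha> < real_of_rat u * q" using u(1) q by (simp add: field_simps)
    then have "upper_cut \<beta> (pair (p1 z * a) (p2 z * p2 (rat_code u)))"
      using z(1) a(3) by (simp add: upper_cut_def eq a(4) q_def mult.commute)
    then show "0 < p2 z \<and> (\<exists>N. N \<in> C \<and> (p1 N mod 2 = 0 \<and> 0 < p1 N \<and> 0 < p2 N) \<and>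
       upper_cut \<beta> (pair (p1 z * (p1 N div 2)) (p2 z * p2 N)))"
      using z(1) a u(2) by (intro conjI exI[of _ "rat_code u"]) (auto simp: C_def)
  next
    assume "0 < p2 z \<and> (\<exists>N. N \<in> C \<and> (p1 N mod 2 = 0 \<and> 0 < p1 N \<and> 0 < p2 N) \<and>
       upper_cut \<beta> (pair (p1 z * (p1 N div 2)) (p2 z * p2 N)))"
    then obtain u where z: "0 < p2 z" and u: "real_of_rat u < c" "even (p1 (rat_code u))" "0 < p1 (rat_code u)"
      "upper_cut \<beta> (pair (p1 z * (p1 (rat_code u) div 2)) (p2 z * p2 (rat_code u)))"
      by (auto simp: C_def)
    obtain a where a: "0 < a" "p1 (rat_code u) = 2 * a" "0 < p2 (rat_code u)"
      "real_of_rat u = real a / real (p2 (rat_code u))"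
      by (rule positive_rat_code[OF even_rat_code_positive[OF u(2,3)]])
    define q where "q = real (p1 z) / real (p2 z)"
    have "c * \<alpha> < q * real_of_rat u"
      using u(4) by (simp add: upper_cut_def eq a(2,4) q_def)
    also have "\<dots> \<le> q * c" using u(1) by (intro mult_left_mono) (auto simp: q_def)
    finally have "\<alpha> < q" using c(2) by (simp add: mult.commute)
    then show "upper_cut \<alpha> z" using z by (simp add: upper_cut_def q_def)
  qed
  moreover have "enumerable (\<lambda>z. 0 < p2 z \<and> (\<exists>N. N \<in> C \<and> (p1 N mod 2 = 0 \<and> 0 < p1 N \<and> 0 < p2 N) \<and>
     upper_cut \<beta> (pair (p1 z * (p1 N div 2)) (p2 z * p2 N))))"
    by (intro enumerable_conj enumerable_ex enumerable_comp[OF C] enumerable_comp[OF \<beta>] enumerable_decidable computable_intros)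
  ultimately show ?thesis by presburger
qed

lemma recursive_set_empty: "recursive_set {}"
  by (rule enumerable_imp_recursive_set) (simp_all add: enumerable_decidable decidable_const)

lemma binary_sum_positive:
  assumes "A \<noteq> {}" shows "0 < binary_sum A"
proof -
  obtain n where n: "n \<in> A" using assms by blast
  show ?thesis unfolding binary_sum_def
    by (rule suminf_pos2[of _ n]) (use summable_binary n in auto)
qed

theorem theorem1p2:
  fixes d :: nat and A :: "nat set"
  assumes "re_set A" and "\<not> recursive_set A"
  defines "\<alpha> \<equiv> suminf (\<lambda>n. if n \<in> A then (1/2::real) ^ n else 0)"
  shows "\<not> algebraic \<alpha> \<and>
         \<not> (\<exists>(M :: 'a topology) \<mu>. closed_connected_manifold d M \<and> fundamental_class d M \<mu> \<and>
               simplicial_volume d M \<mu> \<in> {c * \<alpha> | c. computable_real c \<and> c > 0})"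
proof -
  have \<alpha>: "\<alpha> = binary_sum A" by (simp add: \<alpha>_def binary_sum_def)
  have "A \<noteq> {}" using assms(2) recursive_set_empty by blast
  then have pos: "\<alpha> > 0" unfolding \<alpha> by (rule binary_sum_positive)
  have no: "\<not> enumerable (upper_cut \<alpha>)"
    using enumerable_upper_cut_imp_recursive[OF re_set_imp_enumerable[OF assms(1)]] assms(2)
    unfolding \<alpha> by blast
  have "\<not> algebraic \<alpha>" using algebraic_imp_enumerable_upper_cut pos no by blast
  moreover have False if "closed_connected_manifold d M" "fundamental_class d M \<mu>"
    "simplicial_volume d M \<mu> = c * \<alpha>" "computable_real c" "c > 0" for M :: "'a topology" and \<mu> c
    using enumerable_upper_cut_quotient[OF that(4,5) enumerable_simplicial_volume[OF that(1,2)] that(3)] pos no by simp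
  ultimately show ?thesis by blast
qed

end
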